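(* Let $U$ be a Haar-uniform random variable on $\mathcal{O}$, and let $r=r(n)$ be positive integers with $p\nmid r$ and $\log r=o(n^2)$. Let $A$ be chosen from $GL_n(\mathcal{O})$ according to the Haar probability measure. Then $$d_{TV}\big(\mu_{\mathrm{tr}(A^r)},\mu_U\big)\to 0\quad\text{as } n\to\infty.$$
   Context: $p$ is an odd prime and $q$ a power of $p$. $\mathcal{F}/\mathbb{Q}_p$ is a finite unramified extension with ring of integers $\mathcal{O}$, uniformizer $\pi$ and residue field $\mathbb{F}_q$. $GL_n(\mathcal{O})$ is the group of invertible matrices over $\mathcal{O}$ whose inverse also has entries in $\mathcal{O}$. $\mu_X(A)=\Pr[X\in A]$ and $d_{TV}(\mu,\nu)=\sup_A|\mu(A)-\nu(A)|$ over Borel sets $A\subset\mathcal{O}$. *)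

theory Defs
  imports
    "HOL-Probability.Probability"
    "HOL-Library.Landau_Symbols"
    "HOL-Computational_Algebra.Computational_Algebra"
    "Jordan_Normal_Form.Matrix"
begin

text \<open>The \<open>p\<close>-adic absolute value on the rational numbers, normalised by \<open>\<bar>p\<bar> = 1/p\<close>.\<close>

definition padic_val :: "nat \<Rightarrow> rat \<Rightarrow> int" where
  "padic_val p x = int (multiplicity (int p) (fst (quotient_of x)))
                 - int (multiplicity (int p) (snd (quotient_of x)))"

definition padic_abs :: "nat \<Rightarrow> rat \<Rightarrow> real" where
  "padic_abs p x = (if x = 0 then 0 else real p powi (- padic_val p x))"

locale nonarch_field =
  fixes absv :: "'a :: field_char_0 \<Rightarrow> real"
  assumes absv_nonneg: "0 \<le> absv x"
    and absv_eq_0_iff: "absv x = 0 \<longleftrightarrow> x = 0"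
    and absv_mult: "absv (x * y) = absv x * absv y"
    and absv_ultrametric: "absv (x + y) \<le> max (absv x) (absv y)"

definition abs_dist :: "('a :: field_char_0 \<Rightarrow> real) \<Rightarrow> 'a \<Rightarrow> 'a \<Rightarrow> real" where
  "abs_dist absv x y = absv (x - y)"

definition field_topology :: "('a :: field_char_0 \<Rightarrow> real) \<Rightarrow> 'a topology" where
  "field_topology absv = Metric_space.mtopology UNIV (abs_dist absv)"

lemma (in nonarch_field) Metric_space_abs_dist: "Metric_space S (abs_dist absv)"
proof -
  have one: "absv 1 = 1"
    using absv_mult[of 1 1] absv_eq_0_iff[of 1] by simp
  have "absv (-1) * absv (-1) = 1"
    using absv_mult[of "-1" "-1"] one by simp
  then have m1: "absv (-1) = 1"
    using absv_nonneg[of "-1"] by (simp add: square_eq_1_iff)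
  have minus: "absv (- x) = absv x" for x
    using absv_mult[of "-1" x] m1 by simp
  show ?thesis
  proof (unfold_locales, goal_cases)
    case (1 x y) show ?case by (simp add: abs_dist_def absv_nonneg)
  next
    case (2 x y) show ?case using minus[of "x - y"] by (simp add: abs_dist_def)
  next
    case (3 x y) then show ?case by (simp add: abs_dist_def absv_eq_0_iff)
  next
    case (4 x y z)
    then show ?case
      using absv_ultrametric[of "x - y" "y - z"] absv_nonneg[of "x - y"] absv_nonneg[of "y - z"]
      by (simp add: abs_dist_def)
  qed
qed

text \<open>
  The type \<open>'a\<close> is a finite extension of \<open>Qp\<close>, where \<open>Qp\<close> is a subfield that is a completion of
  the rationals (complete, containing the rationals as a dense subset) for the \<open>p\<close>-adic absolute
  value.  The parameter \<open>absv\<close> is the extension of the \<open>p\<close>-adic absolute value to \<open>'a\<close>; it exists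
  and is uniquely determined, so that fixing it is no restriction.
\<close>

locale padic_extension = nonarch_field absv
  for absv :: "'a :: field_char_0 \<Rightarrow> real" +
  fixes p :: nat and Qp :: "'a set"
  assumes prime_p: "prime p"
    and absv_of_rat: "absv (of_rat t) = padic_abs p t"
    and Qp_diff: "x \<in> Qp \<Longrightarrow> y \<in> Qp \<Longrightarrow> x - y \<in> Qp"
    and Qp_mult: "x \<in> Qp \<Longrightarrow> y \<in> Qp \<Longrightarrow> x * y \<in> Qp"
    and Qp_inverse: "x \<in> Qp \<Longrightarrow> inverse x \<in> Qp"
    and Rats_subset_Qp: "\<rat> \<subseteq> Qp"
    and Rats_dense_Qp: "Qp \<subseteq> field_topology absv closure_of \<rat>"
    and Qp_complete: "Metric_space.mcomplete Qp (abs_dist absv)"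
    and finite_degree:
      "\<exists>B. finite B \<and> (\<forall>x. \<exists>c. (\<forall>b\<in>B. c b \<in> Qp) \<and> x = (\<Sum>b\<in>B. c b * b))"

text \<open>
  Unramified means ramification index \<open>1\<close>, i.e. both fields have the same value group.
  Separability of the residue extension is automatic, the residue fields being finite.
\<close>

locale unramified_padic_extension = padic_extension +
  assumes value_group_eq: "absv ` (UNIV - {0}) = absv ` (Qp - {0})"

definition integers :: "('a :: field_char_0 \<Rightarrow> real) \<Rightarrow> 'a set" where
  "integers absv = {x. absv x \<le> 1}"

definition maximal_ideal :: "('a :: field_char_0 \<Rightarrow> real) \<Rightarrow> 'a set" where
  "maximal_ideal absv = {x. absv x < 1}"

definition uniformizer :: "('a :: field_char_0 \<Rightarrow> real) \<Rightarrow> 'a \<Rightarrow> bool" where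
  "uniformizer absv \<pi> \<longleftrightarrow> maximal_ideal absv = (\<lambda>x. \<pi> * x) ` integers absv"

definition residue_field :: "('a :: field_char_0 \<Rightarrow> real) \<Rightarrow> 'a set set" where
  "residue_field absv =
     integers absv // {(x, y). x \<in> integers absv \<and> y \<in> integers absv \<and> x - y \<in> maximal_ideal absv}"

definition integers_topology :: "('a :: field_char_0 \<Rightarrow> real) \<Rightarrow> 'a topology" where
  "integers_topology absv = subtopology (field_topology absv) (integers absv)"

definition GL_integers :: "('a :: field_char_0 \<Rightarrow> real) \<Rightarrow> nat \<Rightarrow> 'a mat set" where
  "GL_integers absv n =
     {A \<in> carrier_mat n n. elements_mat A \<subseteq> integers absv \<and>
        (\<exists>B \<in> carrier_mat n n. elements_mat B \<subseteq> integers absv \<and> A * B = 1\<^sub>m n \<and> B * A = 1\<^sub>m n)}"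

text \<open>The topology that \<open>GL_n\<close> inherits from the product topology on the \<open>n * n\<close> matrix entries.\<close>

definition GL_topology :: "('a :: field_char_0 \<Rightarrow> real) \<Rightarrow> nat \<Rightarrow> 'a mat topology" where
  "GL_topology absv n =
     pullback_topology (GL_integers absv n) (\<lambda>A. \<lambda>ij \<in> {..<n} \<times> {..<n}. A $$ ij)
       (product_topology (\<lambda>_. integers_topology absv) ({..<n} \<times> {..<n}))"

definition mat_trace :: "'a :: comm_monoid_add mat \<Rightarrow> 'a" where
  "mat_trace A = (\<Sum>i<dim_row A. A $$ (i, i))"

definition borel_of :: "'a topology \<Rightarrow> 'a measure" where
  "borel_of X = sigma (topspace X) {U. openin X U}"

text \<open>
  The Haar probability measure of a compact group with underlying space \<open>X\<close> and multiplication
  \<open>mul\<close>.  Regularity is not listed: it holds for every finite Borel measure on a compact metrizable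
  space.
\<close>

definition haar_prob :: "'g topology \<Rightarrow> ('g \<Rightarrow> 'g \<Rightarrow> 'g) \<Rightarrow> 'g measure \<Rightarrow> bool" where
  "haar_prob X mul M \<longleftrightarrow>
     prob_space M \<and> sets M = sets (borel_of X) \<and>
     (\<forall>g \<in> topspace X. \<forall>S \<in> sets M. emeasure M (mul g ` S) = emeasure M S)"

definition tv_dist :: "'a topology \<Rightarrow> 'a measure \<Rightarrow> 'a measure \<Rightarrow> real" where
  "tv_dist X \<mu> \<nu> = (SUP S \<in> sets (borel_of X). \<bar>measure \<mu> S - measure \<nu> S\<bar>)"

end

theory Submission
  imports
    Defs
    "Jordan_Normal_Form.Determinant"
    "HOL-Algebra.Algebraic_Closure_Type"
    "HOL-Real_Asymp.Real_Asymp"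
    "HOL-Number_Theory.Cong"
begin

text \<open>
  Let \<open>k\<close> be the residue field.  Since \<open>p\<close> does not divide \<open>r\<close>, multiplying \<open>A\<close> from the left by
  \<open>1 + p\<^sup>j s Z\<close> with \<open>Z\<close> chosen so that \<open>r tr (Z A\<^sup>r) \<equiv> 1\<close> shifts \<open>tr A\<^sup>r\<close> by \<open>p\<^sup>j s\<close> modulo
  \<open>p\<^sup>j\<^sup>+\<^sup>1\<close>.  So \<open>tr A\<^sup>r\<close> is exactly uniform on residue classes given the reduction of \<open>A\<close>, and the
  total variation distance is that of \<open>tr B\<^sup>r\<close> for \<open>B\<close> uniform in \<open>GL\<^sub>n(k)\<close>.

  Over \<open>k\<close>, count the injective maps from the field \<open>K\<^sub>d\<close> with \<open>q\<^sup>d\<close> elements into \<open>k\<^sup>n\<close> on which \<open>B\<close>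
  acts as multiplication by a generator of \<open>K\<^sub>d\<close>.  Suitably normalised and summed with weights \<open>1 / d\<close>
  over a set of degrees \<open>d\<close>, this count has mean about \<open>\<Lambda> = \<Sum> 1 / d\<close> and variance \<open>O(\<Lambda>)\<close>, so for large \<open>\<Lambda>\<close> it may be
  inserted as a weight.  The weighted average splits off a summand \<open>tr x\<^sup>r\<close> with \<open>x\<close> almost uniform in
  \<open>K\<^sub>d\<close>, which is equidistributed as soon as \<open>gcd (r, q\<^sup>d - 1)\<close> is small compared to \<open>q\<^sup>d\<^sup>/\<^sup>2\<close>.  As the
  numbers \<open>gcd (r, q\<^sup>d - 1)\<close> for different \<open>d\<close> have few common factors and all divide \<open>r\<close>, the bound
  \<open>log r = o(n\<^sup>2)\<close> leaves enough degrees \<open>d \<le> n\<close>.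
\<close>

text \<open>The weight works because averaging over \<open>A\<close> with weight
  \<open>card (intertwiners A y)\<close> amounts to averaging over block triangular matrices with
  corner \<open>y\<close>. This change of measure creates a summand of the trace independent of the
  rest, without any classification of conjugacy classes. Its price is the relative deviation of the
  weight, about one over the square root of \<open>\<Lambda>\<close>, so a large constant
  \<open>\<Lambda>\<close> is enough for a given precision. The degrees have the form
  \<open>1 + W * k\<close> with \<open>k\<close> in a fixed number of dyadic blocks that start at a
  fixed fraction of \<open>n\<close>; this is why \<open>log r\<close> must be beaten by every
  constant multiple of \<open>n^2\<close>. The progression keeps the degrees prime to
  \<open>p\<close>, so that scalars already have all traces, and keeps their common divisors small.
  A second obstacle is formal: matrices over the residue field require a type, and a type may depend
  on the field but not on a given absolute value. The field must therefore be shown to determine its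
  valuation, which is done by comparing squares; oddness of \<open>p\<close> enters there, as 2 has
  to be a unit.\<close>

unbundle no vec_syntax

hide_const (open) Polynomials.degree Polynomials.lead_coeff Divisibility.prime Divisibility.irreducible
  Coset.order Module.smult up_ring.monom up_ring.coeff

section \<open>Matrices over a finite field\<close>

lemma bij_betw_carrier_mat:
  "bij_betw (\<lambda>f. mat m n f) (({..<m} \<times> {..<n}) \<rightarrow>\<^sub>E UNIV) (carrier_mat m n :: 'k mat set)"
proof (rule bij_betwI[where g = "\<lambda>A. \<lambda>ij\<in>{..<m} \<times> {..<n}. A $$ ij"])
  show "(\<lambda>A. \<lambda>ij\<in>{..<m} \<times> {..<n}. A $$ ij) (mat m n f) = f"
    if "f \<in> ({..<m} \<times> {..<n}) \<rightarrow>\<^sub>E UNIV" for f :: "nat \<times> nat \<Rightarrow> 'k"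
  proof
    show "(\<lambda>ij\<in>{..<m} \<times> {..<n}. mat m n f $$ ij) x = f x" for x
      using that by (cases x) (auto simp: PiE_def extensional_def)
  qed
qed auto

lemma finite_carrier_mat:
  assumes "finite (UNIV :: 'k set)"
  shows "finite (carrier_mat m n :: 'k mat set)"
  using bij_betw_carrier_mat[of m n, where ?'k = 'k] assms
  by (metis bij_betw_finite finite_PiE finite_SigmaI finite_lessThan)

lemma card_carrier_mat: "card (carrier_mat m n :: 'k mat set) = CARD('k) ^ (m * n)"
  using bij_betw_same_card[OF bij_betw_carrier_mat[of m n, where ?'k = 'k]]
  by (simp add: card_PiE)

lemma card_carrier_vec: 
  assumes "finite (UNIV :: 'k set)"
  shows "finite (carrier_vec n :: 'k vec set)" "card (carrier_vec n :: 'k vec set) = CARD('k) ^ n"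
proof -
  have b: "bij_betw (\<lambda>f. vec n f) ({..<n} \<rightarrow>\<^sub>E UNIV) (carrier_vec n :: 'k vec set)"
  proof (rule bij_betwI[where g = "\<lambda>v :: 'k vec. \<lambda>i\<in>{..<n}. v $ i"])
    show "(\<lambda>v :: 'k vec. \<lambda>i\<in>{..<n}. v $ i) (vec n f) = f"
      if "f \<in> {..<n} \<rightarrow>\<^sub>E UNIV" for f :: "nat \<Rightarrow> 'k"
    proof
      show "(\<lambda>i\<in>{..<n}. vec n f $ i) x = f x" for x
        using that by (auto simp: PiE_def extensional_def)
    qed
  qed auto
  show "card (carrier_vec n :: 'k vec set) = CARD('k) ^ n"
    using bij_betw_same_card[OF b] by (simp add: card_PiE)
  show "finite (carrier_vec n :: 'k vec set)"
    using b assms by (metis bij_betw_finite finite_PiE finite_lessThan)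
qed

definition general_linear :: "nat \<Rightarrow> 'k :: field mat set" where
  "general_linear n = {A \<in> carrier_mat n n. det A \<noteq> 0}"

lemma general_linear_carrier: "A \<in> general_linear n \<Longrightarrow> A \<in> carrier_mat n n"
  by (simp add: general_linear_def)

lemma general_linear_mult:
  "A \<in> general_linear n \<Longrightarrow> B \<in> general_linear n \<Longrightarrow> A * B \<in> general_linear n"
  by (auto simp: general_linear_def det_mult)

lemma one_in_general_linear: "1\<^sub>m n \<in> general_linear n"
  by (simp add: general_linear_def)

lemma general_linear_inverse:
  assumes "A \<in> general_linear n"
  obtains B where "B \<in> general_linear n" "A * B = 1\<^sub>m n" "B * A = 1\<^sub>m n"
proof -
  have A: "A \<in> carrier_mat n n" "det A \<noteq> 0"
    using assms by (auto simp: general_linear_def)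
  obtain B where B: "B \<in> carrier_mat n n" "A * B = 1\<^sub>m n" "B * A = 1\<^sub>m n"
    using det_non_zero_imp_unit[OF A, of "()"] unfolding Units_def ring_mat_def by auto
  have "det A * det B = 1"
    using det_mult[OF A(1) B(1)] B(2) by simp
  then have "B \<in> general_linear n"
    using B(1) by (auto simp: general_linear_def)
  then show thesis using B that by blast
qed

lemma general_linearI:
  assumes "(A :: 'k :: field mat) \<in> carrier_mat n n" "B \<in> carrier_mat n n" "A * B = 1\<^sub>m n"
  shows "A \<in> general_linear n"
  using det_mult[OF assms(1,2)] assms by (auto simp: general_linear_def)

lemma finite_general_linear:
  "finite (UNIV :: 'k :: field set) \<Longrightarrow> finite (general_linear n :: 'k mat set)"
  unfolding general_linear_def by (simp add: finite_carrier_mat)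

lemma card_general_linear_pos:
  "finite (UNIV :: 'k :: field set) \<Longrightarrow> card (general_linear n :: 'k mat set) > 0"
  using one_in_general_linear[of n] by (auto simp: card_gt_0_iff finite_general_linear)

definition inj_mat :: "'k :: field mat \<Rightarrow> bool" where
  "inj_mat H \<longleftrightarrow> (\<forall>v \<in> carrier_vec (dim_col H). H *\<^sub>v v = 0\<^sub>v (dim_row H) \<longrightarrow> v = 0\<^sub>v (dim_col H))"

text \<open>An injective map cannot go from a larger finite set to a smaller one; counting vectors
  on both sides replaces a rank argument.\<close>

lemma inj_mat_card_le:
  assumes fin: "finite (UNIV :: 'k :: field set)" and H: "(H :: 'k mat) \<in> carrier_mat n e"
    and inj: "inj_mat H"
  shows "e \<le> n"
proof -
  have "inj_on (\<lambda>v. H *\<^sub>v v) (carrier_vec e)"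
  proof (rule inj_onI)
    fix v w assume v: "v \<in> carrier_vec e" and w: "w \<in> carrier_vec e" and eq: "H *\<^sub>v v = H *\<^sub>v w"
    have "H *\<^sub>v (v - w) = 0\<^sub>v n"
      using mult_minus_distrib_mat_vec[OF H v w] eq H w by auto
    then have "v - w = 0\<^sub>v e"
      using inj H v w unfolding inj_mat_def by auto
    then show "v = w"
      using v w by (auto simp: vec_eq_iff)
  qed
  then have "card (carrier_vec e :: 'k vec set) \<le> card (carrier_vec n :: 'k vec set)"
    using card_carrier_vec[OF fin] H by (intro card_inj_on_le) auto
  moreover have "CARD('k) > 1"
    using fin by (metis UNIV_I card_1_singletonE card_eq_0_iff empty_iff less_one linorder_neqE_nat
        singletonD zero_neq_one)
  ultimately show ?thesis
    using card_carrier_vec[OF fin] by simp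
qed

section \<open>Stacked and four-block matrices\<close>

lemma mult_append_rows:
  assumes "A1 \<in> carrier_mat a n1" "A2 \<in> carrier_mat a n2" "A3 \<in> carrier_mat b n1" "A4 \<in> carrier_mat b n2"
    and "H1 \<in> carrier_mat n1 e" "H2 \<in> carrier_mat n2 e"
  shows "four_block_mat A1 A2 A3 A4 * (H1 @\<^sub>r H2) =
    ((A1 * H1 + A2 * H2 :: 'k :: field mat) @\<^sub>r (A3 * H1 + A4 * H2))"
proof -
  have d: "dim_row H1 = n1" "dim_row H2 = n2" "dim_row A1 = a" "dim_row A3 = b"
     "dim_row A2 = a" "dim_row A4 = b" using assms by auto
  show ?thesis
    unfolding append_rows_def d
    by (subst mult_four_block_mat[OF assms(1-5) _ assms(6)])
       (use assms in \<open>auto intro!: cong_four_block_mat\<close>)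
qed

lemma append_rows_mult:
  assumes "H1 \<in> carrier_mat n1 e" "H2 \<in> carrier_mat n2 e" "Y \<in> carrier_mat e f"
  shows "(H1 @\<^sub>r H2) * (Y :: 'k :: field mat) = (H1 * Y @\<^sub>r H2 * Y)"
proof (rule eq_matI)
  have R: "H1 * Y @\<^sub>r H2 * Y \<in> carrier_mat (n1 + n2) f"
    using assms by auto
  have L: "H1 @\<^sub>r H2 \<in> carrier_mat (n1 + n2) e"
    using assms by auto
  show "dim_row ((H1 @\<^sub>r H2) * Y) = dim_row (H1 * Y @\<^sub>r H2 * Y)"
    "dim_col ((H1 @\<^sub>r H2) * Y) = dim_col (H1 * Y @\<^sub>r H2 * Y)"
    using R L assms by (metis carrier_matD index_mult_mat(2,3))+
  fix i j assume "i < dim_row (H1 * Y @\<^sub>r H2 * Y)" "j < dim_col (H1 * Y @\<^sub>r H2 * Y)"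
  then have ij: "i < n1 + n2" "j < f" using R by auto
  show "((H1 @\<^sub>r H2) * Y) $$ (i, j) = (H1 * Y @\<^sub>r H2 * Y) $$ (i, j)"
    using ij assms L by (auto simp: append_rows_def scalar_prod_def intro!: sum.cong)
qed

lemma append_rows_eq_iff:
  assumes "H1 \<in> carrier_mat n1 e" "H2 \<in> carrier_mat n2 e" "G1 \<in> carrier_mat n1 e" "G2 \<in> carrier_mat n2 e"
  shows "(H1 @\<^sub>r H2) = (G1 @\<^sub>r G2) \<longleftrightarrow> H1 = G1 \<and> H2 = G2"
proof
  assume eq: "(H1 @\<^sub>r H2) = (G1 @\<^sub>r G2)"
  have "H1 $$ (i, j) = G1 $$ (i, j)" if "i < n1" "j < e" for i j
    using arg_cong[OF eq, of "\<lambda>M. M $$ (i, j)"] that assms by (auto simp: append_rows_def)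
  moreover have "H2 $$ (i, j) = G2 $$ (i, j)" if "i < n2" "j < e" for i j
    using arg_cong[OF eq, of "\<lambda>M. M $$ (n1 + i, j)"] that assms by (auto simp: append_rows_def)
  ultimately show "H1 = G1 \<and> H2 = G2"
    using assms by auto
qed auto

lemma append_rows_cases:
  assumes "H \<in> carrier_mat (a + b) e"
  obtains H1 H2 where "H = (H1 @\<^sub>r H2)" "H1 \<in> carrier_mat a e" "H2 \<in> carrier_mat b (e :: nat)"
proof
  show "H = (mat a e (\<lambda>(i,j). H $$ (i, j)) @\<^sub>r mat b e (\<lambda>(i,j). H $$ (a + i, j)))"
    using assms by (intro eq_matI) (auto simp: append_rows_def)
qed auto

lemma four_block_cases:
  assumes "A \<in> carrier_mat (a + b) (c + d)"
  obtains A1 A2 A3 A4 where "A = four_block_mat A1 A2 A3 A4" "A1 \<in> carrier_mat a c"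
    "A2 \<in> carrier_mat a d" "A3 \<in> carrier_mat b c" "A4 \<in> carrier_mat b (d :: nat)"
  using split_block(1-5)[where A = A and ?sr1.0 = a and ?sc1.0 = c and ?sr2.0 = b and ?sc2.0 = d] assms
  by (cases "split_block A a c") (metis carrier_matD)

lemma four_block_eq_iff:
  assumes "A1 \<in> carrier_mat a c" "A2 \<in> carrier_mat a d" "A3 \<in> carrier_mat b c" "A4 \<in> carrier_mat b d"
    "B1 \<in> carrier_mat a c" "B2 \<in> carrier_mat a d" "B3 \<in> carrier_mat b c" "B4 \<in> carrier_mat b d"
  shows "four_block_mat A1 A2 A3 A4 = four_block_mat B1 B2 B3 B4 \<longleftrightarrow>
     A1 = B1 \<and> A2 = B2 \<and> A3 = B3 \<and> A4 = B4"
proof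
  assume eq: "four_block_mat A1 A2 A3 A4 = four_block_mat B1 B2 B3 B4"
  have "A1 $$ (i, j) = B1 $$ (i, j)" if "i < a" "j < c" for i j
    using arg_cong[OF eq, of "\<lambda>M. M $$ (i, j)"] that assms by auto
  moreover have "A2 $$ (i, j) = B2 $$ (i, j)" if "i < a" "j < d" for i j
    using arg_cong[OF eq, of "\<lambda>M. M $$ (i, c + j)"] that assms by auto
  moreover have "A3 $$ (i, j) = B3 $$ (i, j)" if "i < b" "j < c" for i j
    using arg_cong[OF eq, of "\<lambda>M. M $$ (a + i, j)"] that assms by auto
  moreover have "A4 $$ (i, j) = B4 $$ (i, j)" if "i < b" "j < d" for i j
    using arg_cong[OF eq, of "\<lambda>M. M $$ (a + i, c + j)"] that assms by auto
  ultimately show "A1 = B1 \<and> A2 = B2 \<and> A3 = B3 \<and> A4 = B4"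
    using assms by (auto intro!: eq_matI)
qed auto

text \<open>The standard embedding of dimension \<open>e\<close> into dimension
  \<open>e + m\<close>. It is the base point for the action of the general linear group on injective
  matrices.\<close>

definition column_block :: "nat \<Rightarrow> nat \<Rightarrow> 'k :: field mat" where
  "column_block e m = (1\<^sub>m e @\<^sub>r 0\<^sub>m m e)"

lemma column_block_carrier [simp]: "column_block e m \<in> carrier_mat (e + m) e"
  by (simp add: column_block_def)

lemma four_block_mult_column_block:
  assumes "A1 \<in> carrier_mat a e" "A2 \<in> carrier_mat a m" "A3 \<in> carrier_mat b e" "A4 \<in> carrier_mat b m"
  shows "four_block_mat A1 A2 A3 A4 * column_block e m = (A1 @\<^sub>r A3)"
  unfolding column_block_def using assms
  by (subst mult_append_rows[OF assms]) auto

lemma inj_mat_left_cancel: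
  assumes "g \<in> general_linear n" "H \<in> carrier_mat n e"
  shows "inj_mat (g * H) \<longleftrightarrow> inj_mat H"
proof -
  obtain g' where g': "g' \<in> general_linear n" "g * g' = 1\<^sub>m n" "g' * g = 1\<^sub>m n"
    using general_linear_inverse[OF assms(1)] .
  note c = general_linear_carrier[OF assms(1)] general_linear_carrier[OF g'(1)]
  have "(g * H) *\<^sub>v v = 0\<^sub>v n \<longleftrightarrow> H *\<^sub>v v = 0\<^sub>v n" if v: "v \<in> carrier_vec e" for v
  proof
    assume "(g * H) *\<^sub>v v = 0\<^sub>v n"
    then have "g' *\<^sub>v ((g * H) *\<^sub>v v) = 0\<^sub>v n"
      using c by (auto simp: scalar_prod_def)
    moreover have "g' *\<^sub>v ((g * H) *\<^sub>v v) = (g' * g) *\<^sub>v (H *\<^sub>v v)"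
      using c assms(2) v by (simp add: assoc_mult_mat_vec[of _ n n])
    ultimately show "H *\<^sub>v v = 0\<^sub>v n"
      using g' assms(2) v by auto
  next
    assume "H *\<^sub>v v = 0\<^sub>v n"
    then show "(g * H) *\<^sub>v v = 0\<^sub>v n"
      using c assms(2) v by (auto simp: assoc_mult_mat_vec[of _ n n] scalar_prod_def)
  qed
  then show ?thesis
    using c assms(2) by (auto simp: inj_mat_def)
qed

lemma inj_mat_column_block: "inj_mat (column_block e m)"
  unfolding inj_mat_def
proof (intro ballI impI)
  fix v :: "'a vec" assume v: "v \<in> carrier_vec (dim_col (column_block e m :: 'a mat))"
    and 0: "column_block e m *\<^sub>v v = 0\<^sub>v (dim_row (column_block e m :: 'a mat))"
  have v: "v \<in> carrier_vec e" using v by (simp add: column_block_def append_rows_def)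
  have "v $ i = 0" if i: "i < e" for i
  proof -
    have "(column_block e m *\<^sub>v v) $ i = (\<Sum>j<e. (if i = j then 1 else 0) * v $ j)"
      using i v by (auto simp: column_block_def append_rows_def scalar_prod_def lessThan_atLeast0
         intro!: sum.cong)
    also have "\<dots> = (\<Sum>j<e. if i = j then v $ j else 0)"
      by (intro sum.cong) auto
    also have "\<dots> = v $ i"
      using i by simp
    finally show ?thesis
      unfolding 0 using i by (simp add: column_block_def append_rows_def)
  qed
  then show "v = 0\<^sub>v (dim_col (column_block e m :: 'a mat))"
    using v by (auto simp: column_block_def append_rows_def)
qed

text \<open>Transitivity of the general linear group on injective matrices, by row reduction: a
  column without pivot would yield a kernel vector, so the reduced echelon form of \<open>H\<close>
  has a pivot in every column and is the column block itself.\<close>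

lemma inj_mat_extend:
  assumes H: "(H :: 'k :: field mat) \<in> carrier_mat (e + m) e" and inj: "inj_mat H"
  obtains g where "g \<in> general_linear (e + m)" "H = g * column_block e m"
proof -
  define n where "n = e + m"
  note H = H[folded n_def]
  define C where "C = gauss_jordan_single H"
  note gj = gauss_jordan_single[OF H C_def[symmetric]]
  obtain P Q where PQ: "C = P * H" "P \<in> carrier_mat n n" "Q \<in> carrier_mat n n"
    "P * Q = 1\<^sub>m n" "Q * P = 1\<^sub>m n" using gj(4) by blast
  have Q: "Q \<in> general_linear n" and P: "P \<in> general_linear n"
    using PQ by (auto intro: general_linearI)
  have injC: "inj_mat C"
    using inj_mat_left_cancel[OF P H] inj PQ by simp
  have dim: "dim_row C = n" "dim_col C = e" using gj(2) by auto
  obtain f where f: "pivot_fun C f e"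
    using gj(3) dim unfolding row_echelon_form_def by auto
  note p = pivot_funD[OF dim(1) f]
  have "snd ` set (pivot_positions C) = {0..<e}"
  proof (rule ccontr)
    assume "\<not> ?thesis"
    from find_base_vector[OF gj(3,2) this] injC dim show False
      unfolding inj_mat_def by auto
  qed
  then have surj: "\<exists>i<n. f i = j" if "j < e" for j
  proof -
    have "j \<in> snd ` set (pivot_positions C)"
      using \<open>snd ` set (pivot_positions C) = {0..<e}\<close> that by simp
    then show ?thesis
      unfolding pivot_positions(1)[OF gj(2) f] by auto
  qed
  have ge: "f j = e \<or> f j \<ge> j" if "j < n" for j
    using pivot_bound[OF dim(1) f, of 0 j] that by auto
  have mono: "f (i + j) = e \<or> f (i + j) \<ge> j + f i" if "i + j < n" for i j
    using pivot_bound[OF dim(1) f] that by auto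
  \<comment> \<open>Some row \<open>l\<close> has its pivot in column \<open>i\<close>, and by
    induction it does not lie above row \<open>i\<close>. Pivots advance by at least one per row, so
    \<open>l - i + f i \<le> i\<close>, which together with \<open>f i \<ge> i\<close> leaves only
    \<open>f i = i\<close>.\<close>
  have fid: "f i = i" if "i < e" for i
    using that
  proof (induction i rule: less_induct)
    case (less i)
    obtain l where l: "l < n" "f l = i" using surj less.prems by blast
    have "l \<ge> i"
      using less.IH[of l] l less.prems by (cases "l < i") auto
    have "i < n" using less.prems n_def by simp
    have "f i \<noteq> e \<Longrightarrow> l - i + f i \<le> f l"
      using mono[of i "l - i"] l \<open>l \<ge> i\<close> less.prems by auto
    moreover have "f i \<noteq> e"
      using p(3) mono[of i "l - i"] l \<open>l \<ge> i\<close> less.prems by auto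
    ultimately show ?case
      using ge[of i] \<open>i < n\<close> l \<open>l \<ge> i\<close> by auto
  qed
  have C: "C = column_block e m"
  proof (rule eq_matI)
    show "dim_row C = dim_row (column_block e m :: 'k mat)"
      "dim_col C = dim_col (column_block e m :: 'k mat)"
      using dim n_def by (auto simp: column_block_def append_rows_def)
    fix i j assume "i < dim_row (column_block e m :: 'k mat)" "j < dim_col (column_block e m :: 'k mat)"
    then have ij: "i < n" "j < e" "j < n" using n_def by (auto simp: column_block_def append_rows_def)
    show "C $$ (i, j) = column_block e m $$ (i, j)"
      using p(4)[of j] p(5)[of j i] fid[of j] ij n_def
      by (auto simp: column_block_def append_rows_def)
  qed
  have "H = Q * C"
    using PQ H by (simp flip: assoc_mult_mat[of _ n n _ n _ e])
  then show thesis
    using that[of Q] Q C n_def by simp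
qed

section \<open>Counting intertwiners\<close>

text \<open>A square matrix makes its space a module over the polynomial ring; these are the
  injective module homomorphisms from the module of \<open>y\<close> to that of
  \<open>A\<close>.\<close>

definition intertwiners :: "'k :: field mat \<Rightarrow> 'k mat \<Rightarrow> 'k mat set" where
  "intertwiners A y = {H \<in> carrier_mat (dim_row A) (dim_row y). inj_mat H \<and> A * H = H * y}"

lemma intertwinersD:
  assumes "H \<in> intertwiners A y" "A \<in> carrier_mat n n" "y \<in> carrier_mat e e"
  shows "H \<in> carrier_mat n e" "inj_mat H" "A * H = H * y"
  using assms by (auto simp: intertwiners_def)

lemma finite_intertwiners:
  "finite (UNIV :: 'k :: field set) \<Longrightarrow> finite (intertwiners A (y :: 'k mat))"
  unfolding intertwiners_def by (simp add: finite_carrier_mat)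

text \<open>Left multiplication by \<open>g\<close> embeds one set into the other; the opposite
  inequality is the same statement for the inverse conjugation.\<close>

lemma card_intertwiners_conj:
  assumes fin: "finite (UNIV :: 'k :: field set)"
    and g: "g \<in> general_linear n" "g' \<in> general_linear n" "g * g' = 1\<^sub>m n" "g' * g = 1\<^sub>m n"
    and A: "(A :: 'k mat) \<in> carrier_mat n n" and y: "y \<in> carrier_mat e e"
  shows "card (intertwiners (g * A * g') y) = card (intertwiners A y)"
proof -
  have le: "card (intertwiners A y) \<le> card (intertwiners (g * A * g') y)"
    if g: "g \<in> general_linear n" "g' \<in> general_linear n" "g * g' = 1\<^sub>m n" "g' * g = 1\<^sub>m n"
      and A: "A \<in> carrier_mat n n" for g g' A
  proof (rule card_inj_on_le[where f = "\<lambda>H. g * H"])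
    note c = general_linear_carrier[OF g(1)] general_linear_carrier[OF g(2)]
    have d: "dim_row A = n" "dim_row (g * A * g') = n" "dim_row y = e" using A c y by auto
    show "inj_on (\<lambda>H. g * H) (intertwiners A y)"
    proof (rule inj_onI)
      fix H G assume H: "H \<in> intertwiners A y" and G: "G \<in> intertwiners A y" and eq: "g * H = g * G"
      have HG: "H \<in> carrier_mat n e" "G \<in> carrier_mat n e"
        using intertwinersD(1)[OF H A y] intertwinersD(1)[OF G A y] .
      have "g' * (g * H) = g' * (g * G)" using eq by simp
      then show "H = G"
        using c HG g by (simp flip: assoc_mult_mat[of _ n n _ n _ e])
    qed
    show "(\<lambda>H. g * H) ` intertwiners A y \<subseteq> intertwiners (g * A * g') y"
    proof (rule image_subsetI)
      fix H assume H: "H \<in> intertwiners A y"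
      note H = intertwinersD[OF H A y]
      have "(g * A * g') * (g * H) = g * A * (g' * g) * H"
        using c A H(1) by (simp add: assoc_mult_mat[of _ n n _ n _ e] assoc_mult_mat[of _ n n _ n _ n])
      also have "\<dots> = g * (A * H)"
        using c A H(1) g by (simp add: assoc_mult_mat[of _ n n _ n _ e])
      also have "\<dots> = g * H * y"
        using c y H by (simp add: assoc_mult_mat[of _ n n _ e _ e])
      finally show "g * H \<in> intertwiners (g * A * g') y"
        using inj_mat_left_cancel[OF g(1) H(1)] H c by (simp add: intertwiners_def d)
    qed
  qed (rule finite_intertwiners[OF fin])
  note c = general_linear_carrier[OF g(1)] general_linear_carrier[OF g(2)]
  have "g' * (g * A * g') * g = (g' * g) * A * (g' * g)"
    using c A by (simp add: assoc_mult_mat[of _ n n _ n _ n])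
  also have "\<dots> = A" using g A by simp
  finally have "card (intertwiners (g * A * g') y) \<le> card (intertwiners A y)"
    using le[OF g(2,1,4,3), of "g * A * g'"] c A by simp
  with le[OF g A] show ?thesis by simp
qed

lemma block_triangular_in_general_linear:
  assumes "y \<in> general_linear e" "C \<in> general_linear m" "u \<in> carrier_mat e m"
  shows "four_block_mat y u (0\<^sub>m m e) C \<in> general_linear (e + m)"
  using assms det_four_block_mat_lower_left_zero[of y e u m _ C]
  by (auto simp: general_linear_def)

text \<open>The condition prescribes the first \<open>e\<close> columns of \<open>A\<close> as
  \<open>y\<close> above zero. What remains free is the upper right block \<open>u\<close> and the
  lower right block \<open>C\<close>, and \<open>A\<close> is invertible exactly when
  \<open>C\<close> is, \<open>y\<close> being invertible.\<close>

lemma sum_fixing_column_block: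
  assumes fin: "finite (UNIV :: 'k :: field set)" and y: "(y :: 'k mat) \<in> general_linear e"
  shows "(\<Sum>A\<in>{A \<in> general_linear (e + m). A * column_block e m = column_block e m * y}. (f A :: real)) =
    (\<Sum>u\<in>carrier_mat e m. \<Sum>C\<in>general_linear m. f (four_block_mat y u (0\<^sub>m m e) C))"
proof -
  have yc: "y \<in> carrier_mat e e" using y by (rule general_linear_carrier)
  have Ey: "column_block e m * y = (y @\<^sub>r 0\<^sub>m m e)"
    unfolding column_block_def using yc by (subst append_rows_mult[of _ e e _ m _ e]) auto
  have "(\<Sum>u\<in>carrier_mat e m. \<Sum>C\<in>general_linear m. f (four_block_mat y u (0\<^sub>m m e) C)) =
    (\<Sum>(u,C)\<in>carrier_mat e m \<times> general_linear m. f (four_block_mat y u (0\<^sub>m m e) C))"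
    by (rule sum.cartesian_product)
  also have "\<dots> = (\<Sum>A\<in>(\<lambda>(u,C). four_block_mat y u (0\<^sub>m m e) C) ` (carrier_mat e m \<times> general_linear m). f A)"
  proof (subst sum.reindex)
    show "inj_on (\<lambda>(u, C). four_block_mat y u (0\<^sub>m m e) C) (carrier_mat e m \<times> general_linear m)"
      using yc by (intro inj_onI) (auto simp: four_block_eq_iff[of _ e e _ m _ m] general_linear_carrier)
  qed (auto simp: case_prod_unfold)
  also have "(\<lambda>(u,C). four_block_mat y u (0\<^sub>m m e) C) ` (carrier_mat e m \<times> general_linear m) =
    {A \<in> general_linear (e + m). A * column_block e m = column_block e m * y}" (is "?L = ?R")
  proof
    show "?L \<subseteq> ?R"
      using y yc by (auto simp: Ey block_triangular_in_general_linear four_block_mult_column_block[of _ e e _ m _ m]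
          general_linear_carrier)
    show "?R \<subseteq> ?L"
    proof
      fix A assume A: "A \<in> ?R"
      then have "A \<in> carrier_mat (e + m) (e + m)" by (auto simp: general_linear_carrier)
      then obtain A1 A2 A3 A4 where b: "A = four_block_mat A1 A2 A3 A4" "A1 \<in> carrier_mat e e"
        "A2 \<in> carrier_mat e m" "A3 \<in> carrier_mat m e" "A4 \<in> carrier_mat m m"
        by (rule four_block_cases)
      have "(A1 @\<^sub>r A3) = (y @\<^sub>r 0\<^sub>m m e)"
        using A b Ey four_block_mult_column_block[OF b(2-5)] by simp
      then have 1: "A1 = y" "A3 = 0\<^sub>m m e"
        using append_rows_eq_iff[of A1 e e A3 m y "0\<^sub>m m e"] b yc by auto
      have "det A = det A1 * det A4"
        using det_four_block_mat_lower_left_zero[OF b(2,3) _ b(5)] 1 b(1) by simp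
      then have "A4 \<in> general_linear m"
        using A b(5) by (auto simp: general_linear_def)
      then show "A \<in> ?L" using b 1 by auto
    qed
  qed
  finally show ?thesis by simp
qed

definition inj_mats :: "nat \<Rightarrow> nat \<Rightarrow> 'k :: field mat set" where
  "inj_mats n e = {H \<in> carrier_mat n e. inj_mat H}"

lemma finite_inj_mats: "finite (UNIV :: 'k :: field set) \<Longrightarrow> finite (inj_mats n e :: 'k mat set)"
  unfolding inj_mats_def by (simp add: finite_carrier_mat)

text \<open>Writing \<open>H\<close> as \<open>g\<close> times the column block, conjugation by
  \<open>g\<close> moves one condition to the other; \<open>f\<close> does not notice because it is
  a class function.\<close>

lemma sum_fixing_inj_mat:
  assumes fin: "finite (UNIV :: 'k :: field set)" and y: "(y :: 'k mat) \<in> general_linear e"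
    and H: "H \<in> inj_mats (e + m) e"
    and f: "\<And>g g' A. g \<in> general_linear (e + m) \<Longrightarrow> g' \<in> general_linear (e + m) \<Longrightarrow>
      g * g' = 1\<^sub>m (e + m) \<Longrightarrow> g' * g = 1\<^sub>m (e + m) \<Longrightarrow> A \<in> general_linear (e + m) \<Longrightarrow>
      f (g * A * g') = (f A :: real)"
  shows "(\<Sum>A\<in>{A \<in> general_linear (e + m). A * H = H * y}. f A) =
     (\<Sum>A\<in>{A \<in> general_linear (e + m). A * column_block e m = column_block e m * y}. f A)"
proof -
  define n where "n = e + m"
  let ?E = "column_block e m :: 'k mat"
  obtain g where g: "g \<in> general_linear n" "H = g * ?E"
    using H inj_mat_extend[of H e m] unfolding inj_mats_def n_def by blast
  obtain g' where g': "g' \<in> general_linear n" "g * g' = 1\<^sub>m n" "g' * g = 1\<^sub>m n"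
    using general_linear_inverse[OF g(1)] .
  have E: "?E \<in> carrier_mat n e" unfolding n_def by simp
  have yc: "y \<in> carrier_mat e e" using y by (rule general_linear_carrier)
  note c = general_linear_carrier[OF g(1)] general_linear_carrier[OF g'(1)]
  note as = assoc_mult_mat[of _ n n _ n _ n] assoc_mult_mat[of _ n n _ n _ e] assoc_mult_mat[of _ n n _ e _ e]
  show ?thesis
    unfolding n_def[symmetric]
  proof (rule sum.reindex_bij_witness[where j = "\<lambda>A. g' * A * g" and i = "\<lambda>A. g * A * g'"])
    fix A assume A: "A \<in> {A \<in> general_linear n. A * H = H * y}"
    then have A': "A \<in> general_linear n" "A * H = H * y" by auto
    note Ac = general_linear_carrier[OF A'(1)]
    have "g * (g' * A * g) * g' = (g * g') * A * (g * g')" using c Ac by (simp add: as)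
    then show "g * (g' * A * g) * g' = A" using g' Ac by simp
    have "(g' * A * g) * ?E = g' * (A * H)" using c Ac E g by (simp add: as)
    also have "\<dots> = (g' * g) * (?E * y)" using c E g yc A' by (simp add: as)
    also have "\<dots> = ?E * y" using g' E yc by simp
    finally show "g' * A * g \<in> {A \<in> general_linear n. A * ?E = ?E * y}"
      using A' g g' by (auto intro!: general_linear_mult)
    show "f (g' * A * g) = f A"
      using f[of g' g A] A' g g' unfolding n_def by auto
  next
    fix A assume A: "A \<in> {A \<in> general_linear n. A * ?E = ?E * y}"
    then have A': "A \<in> general_linear n" "A * ?E = ?E * y" by auto
    note Ac = general_linear_carrier[OF A'(1)]
    have "g' * (g * A * g') * g = (g' * g) * A * (g' * g)" using c Ac by (simp add: as)
    then show "g' * (g * A * g') * g = A" using g' Ac by simp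
    have "(g * A * g') * H = g * A * (g' * g) * ?E" using c Ac E g by (simp add: as)
    also have "\<dots> = g * (A * ?E)" using c Ac E g' by (simp add: as)
    also have "\<dots> = H * y" using A' c E yc g by (simp add: as)
    finally show "g * A * g' \<in> {A \<in> general_linear n. A * H = H * y}"
      using A' g g' by (auto intro!: general_linear_mult)
  qed
qed

text \<open>Orbit counting: sending \<open>A\<close> to \<open>A\<close> times the column block maps
  the group onto the injective matrices, all fibres are translates of the stabiliser, and the
  stabiliser is counted by the case \<open>y = 1\<close> of the block triangular
  description.\<close>

lemma card_general_linear_add:
  assumes fin: "finite (UNIV :: 'k :: field set)"
  shows "card (general_linear (e + m) :: 'k mat set) =
    card (inj_mats (e + m) e :: 'k mat set) * (CARD('k) ^ (e * m) * card (general_linear m :: 'k mat set))"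
proof -
  define n where "n = e + m"
  let ?E = "column_block e m :: 'k mat"
  have E: "?E \<in> carrier_mat n e" unfolding n_def by simp
  note as = assoc_mult_mat[of _ n n _ n _ n] assoc_mult_mat[of _ n n _ n _ e]
  have U: "general_linear n = (\<Union>H\<in>inj_mats n e. {A \<in> general_linear n. A * ?E = H})"
    using E inj_mat_left_cancel[OF _ E] inj_mat_column_block[of e m]
    by (auto simp: inj_mats_def intro!: mult_carrier_mat[of _ n n] dest: general_linear_carrier)
  have "card {A \<in> general_linear n. A * ?E = H} = card {A \<in> general_linear n. A * ?E = ?E}"
    if H: "H \<in> inj_mats n e" for H
  proof -
    obtain g where g: "g \<in> general_linear n" "H = g * ?E"
      using H inj_mat_extend[of H e m] unfolding inj_mats_def n_def by blast
    obtain g' where g': "g' \<in> general_linear n" "g * g' = 1\<^sub>m n" "g' * g = 1\<^sub>m n"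
      using general_linear_inverse[OF g(1)] .
    note c = general_linear_carrier[OF g(1)] general_linear_carrier[OF g'(1)]
    show ?thesis
    proof (rule bij_betw_same_card[of "\<lambda>A. g' * A"], rule bij_betwI[where g = "\<lambda>A. g * A"])
      show "(\<lambda>A. g' * A) \<in> {A \<in> general_linear n. A * ?E = H} \<rightarrow> {A \<in> general_linear n. A * ?E = ?E}"
      proof safe
        fix A assume A: "A \<in> general_linear n" "H = A * ?E"
        show "g' * A \<in> general_linear n" using A g' by (simp add: general_linear_mult)
        have "g' * A * ?E = g' * (g * ?E)" using c A E g(2) general_linear_carrier[OF A(1)] by (simp add: as)
        also have "\<dots> = ?E" using c E g' by (simp flip: as(2))
        finally show "g' * A * ?E = ?E" .
      qed
      show "(\<lambda>A. g * A) \<in> {A \<in> general_linear n. A * ?E = ?E} \<rightarrow> {A \<in> general_linear n. A * ?E = H}"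
        using g c E by (auto simp: as general_linear_carrier general_linear_mult)
      show "g * (g' * A) = A" if "A \<in> {A \<in> general_linear n. A * ?E = H}" for A
        using that c g' by (auto simp flip: as dest!: general_linear_carrier[of A])
      show "g' * (g * A) = A" if "A \<in> {A \<in> general_linear n. A * ?E = ?E}" for A
        using that c g' by (auto simp flip: as dest!: general_linear_carrier[of A])
    qed
  qed
  then have "card (general_linear n :: 'k mat set) = card (inj_mats n e :: 'k mat set) * card {A \<in> general_linear n. A * ?E = ?E}"
    by (subst U, subst card_UN_disjoint)
       (auto simp: finite_inj_mats fin finite_general_linear)
  also have "real (card {A \<in> general_linear n. A * ?E = ?E}) = real (CARD('k) ^ (e * m) * card (general_linear m :: 'k mat set))"
    using sum_fixing_column_block[OF fin one_in_general_linear, where f = "\<lambda>_. 1" and m = m and e = e] E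
    by (simp add: n_def card_carrier_mat)
  then have "card {A \<in> general_linear n. A * ?E = ?E} = CARD('k) ^ (e * m) * card (general_linear m :: 'k mat set)"
    by linarith
  finally show ?thesis unfolding n_def by simp
qed

text \<open>Double counting of pairs of a matrix and an intertwiner. All injective \<open>H\<close>
  contribute equally, and their number cancels against the orbit count. Hence weighting by the
  number of intertwiners means conditioning \<open>A\<close> to be block triangular with corner
  \<open>y\<close> and uniform remaining blocks.\<close>

lemma average_intertwiners:
  assumes fin: "finite (UNIV :: 'k :: field set)" and y: "(y :: 'k mat) \<in> general_linear e"
    and f: "\<And>g g' A. g \<in> general_linear (e + m) \<Longrightarrow> g' \<in> general_linear (e + m) \<Longrightarrow>
      g * g' = 1\<^sub>m (e + m) \<Longrightarrow> g' * g = 1\<^sub>m (e + m) \<Longrightarrow> A \<in> general_linear (e + m) \<Longrightarrow>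
      f (g * A * g') = (f A :: real)"
  shows "(\<Sum>A\<in>general_linear (e + m). f A * card (intertwiners A y)) / card (general_linear (e + m) :: 'k mat set) =
     (\<Sum>u\<in>carrier_mat e m. \<Sum>C\<in>general_linear m. f (four_block_mat y u (0\<^sub>m m e) C)) /
     (CARD('k) ^ (e * m) * card (general_linear m :: 'k mat set))"
proof -
  define n where "n = e + m"
  define S where "S = (\<Sum>u\<in>carrier_mat e m. \<Sum>C\<in>general_linear m. f (four_block_mat y u (0\<^sub>m m e) C))"
  have yc: "y \<in> carrier_mat e e" using y by (rule general_linear_carrier)
  have "(\<Sum>A\<in>general_linear n. f A * card (intertwiners A y)) =
     (\<Sum>A\<in>general_linear n. \<Sum>H\<in>inj_mats n e. if A * H = H * y then f A else 0)"
  proof (rule sum.cong[OF refl])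
    fix A :: "'k mat" assume A: "A \<in> general_linear n"
    have "intertwiners A y = {H \<in> inj_mats n e. A * H = H * y}"
      using general_linear_carrier[OF A] yc by (auto simp: intertwiners_def inj_mats_def)
    then show "f A * card (intertwiners A y) = (\<Sum>H\<in>inj_mats n e. if A * H = H * y then f A else 0)"
      by (simp add: sum.inter_filter[symmetric] finite_inj_mats fin)
  qed
  also have "\<dots> = (\<Sum>H\<in>inj_mats n e. \<Sum>A\<in>general_linear n. if A * H = H * y then f A else 0)"
    by (rule sum.swap)
  also have "\<dots> = (\<Sum>H\<in>(inj_mats n e :: 'k mat set). S)"
  proof (rule sum.cong[OF refl])
    fix H :: "'k mat" assume H: "H \<in> inj_mats n e"
    have "(\<Sum>A\<in>general_linear n. if A * H = H * y then f A else 0) =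
       (\<Sum>A\<in>{A \<in> general_linear n. A * H = H * y}. f A)"
      by (simp add: sum.inter_filter[symmetric] finite_general_linear fin)
    also have "\<dots> = S"
      unfolding S_def n_def
      using sum_fixing_inj_mat[OF fin y, where H = H and m = m and f = f] f sum_fixing_column_block[OF fin y, where f = f and m = m] H n_def by simp
    finally show "(\<Sum>A\<in>general_linear n. if A * H = H * y then f A else 0) = S" .
  qed
  also have "\<dots> = card (inj_mats n e :: 'k mat set) * S" by simp
  finally have 1: "(\<Sum>A\<in>general_linear n. f A * card (intertwiners A y)) = card (inj_mats n e :: 'k mat set) * S" .
  have "card (general_linear n :: 'k mat set) > 0" by (rule card_general_linear_pos[OF fin])
  then have "card (inj_mats n e :: 'k mat set) > 0"
    using card_general_linear_add[OF fin, of e m] by (auto simp: n_def intro: Nat.gr0I)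
  then show ?thesis
    unfolding n_def[symmetric] 1 S_def[symmetric]
    using card_general_linear_add[OF fin, of e m] by (simp add: n_def)
qed

text \<open>Simplicity of the module of \<open>y\<close> in the form of Schur's lemma: every
  homomorphism out of it, into any module, is zero or injective. This form is what the counting uses
  and needs no language of invariant subspaces.\<close>

definition irreducible_mat :: "'k :: field mat \<Rightarrow> bool" where
  "irreducible_mat y \<longleftrightarrow> (\<forall>m C H. C \<in> carrier_mat m m \<longrightarrow> H \<in> carrier_mat m (dim_row y) \<longrightarrow>
     C * H = H * y \<longrightarrow> H = 0\<^sub>m m (dim_row y) \<or> inj_mat H)"

text \<open>In a basis in which \<open>H\<close> is the column block, the equation fixes the first
  \<open>e\<close> columns of \<open>u * g\<close> and leaves the other \<open>m - e\<close> columns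
  free.\<close>

lemma card_left_solutions_le:
  assumes fin: "finite (UNIV :: 'k :: field set)" and H: "(H :: 'k mat) \<in> carrier_mat m e" "inj_mat H"
    and em: "e \<le> m"
  shows "card {u \<in> carrier_mat d m. u * H = Z} \<le> CARD('k) ^ (d * (m - e))"
proof -
  define m' where "m' = m - e"
  have m: "m = e + m'" using em m'_def by simp
  obtain g where g: "g \<in> general_linear m" "H = g * column_block e m'"
    using inj_mat_extend[of H e m'] H m by auto
  obtain g' where g': "g' \<in> general_linear m" "g * g' = 1\<^sub>m m" "g' * g = 1\<^sub>m m"
    using general_linear_inverse[OF g(1)] .
  note c = general_linear_carrier[OF g(1)] general_linear_carrier[OF g'(1)]
  define F where "F u = mat d m' (\<lambda>(i,j). (u * g) $$ (i, e + j))" for u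
  have E: "(column_block e m' :: 'k mat) \<in> carrier_mat m e" using m by simp
  have eqs: "(u * g) $$ (i, j) = (u * H) $$ (i, j)" if "u \<in> carrier_mat d m" "i < d" "j < e" for u i j
  proof -
    have "u * H = (u * g) * column_block e m'"
      using that(1) c E g(2) by (simp add: assoc_mult_mat[of _ d m _ m _ e])
    moreover have "((u * g) * column_block e m') $$ (i, j) = (u * g) $$ (i, j)"
    proof -
      have "((u * g) * column_block e m') $$ (i, j) = (\<Sum>l<m. (u * g) $$ (i, l) * (if l = j then 1 else 0))"
        using that c m by (subst index_mult_mat(1))
          (auto simp: scalar_prod_def column_block_def append_rows_def lessThan_atLeast0 intro!: sum.cong)
      also have "\<dots> = (\<Sum>l<m. if l = j then (u * g) $$ (i, l) else 0)"
        by (intro sum.cong) auto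
      also have "\<dots> = (u * g) $$ (i, j)" using that m by simp
      finally show ?thesis .
    qed
    ultimately show ?thesis by simp
  qed
  have "inj_on F {u \<in> carrier_mat d m. u * H = Z}"
  proof (rule inj_onI)
    fix u v assume "u \<in> {u \<in> carrier_mat d m. u * H = Z}" "v \<in> {u \<in> carrier_mat d m. u * H = Z}"
      and eq: "F u = F v"
    then have uv: "u \<in> carrier_mat d m" "v \<in> carrier_mat d m" "u * H = v * H" by auto
    have "u * g = v * g"
    proof (rule eq_matI)
      fix i j assume "i < dim_row (v * g)" "j < dim_col (v * g)"
      then have ij: "i < d" "j < m" using uv c by auto
      show "(u * g) $$ (i, j) = (v * g) $$ (i, j)"
      proof (cases "j < e")
        case True
        then show ?thesis using eqs[OF uv(1) ij(1) True] eqs[OF uv(2) ij(1) True] uv by simp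
      next
        case False
        then show ?thesis
          using arg_cong[OF eq, of "\<lambda>M. M $$ (i, j - e)"] ij m by (simp add: F_def)
      qed
    qed (use uv c in auto)
    then have "u * g * g' = v * g * g'" by simp
    then show "u = v" using uv c g' by (simp add: assoc_mult_mat[of _ d m _ m _ m])
  qed
  then have "card {u \<in> carrier_mat d m. u * H = Z} \<le> card (carrier_mat d m' :: 'k mat set)"
    by (rule card_inj_on_le) (auto simp: F_def finite_carrier_mat fin)
  then show ?thesis by (simp add: card_carrier_mat m'_def)
qed

lemma inj_mat_append_zero:
  assumes "H1 \<in> carrier_mat d e" "inj_mat (H1 @\<^sub>r 0\<^sub>m m e)"
  shows "inj_mat H1"
proof -
  have "(H1 @\<^sub>r 0\<^sub>m m e) *\<^sub>v v = 0\<^sub>v (d + m)" if v: "v \<in> carrier_vec e" "H1 *\<^sub>v v = 0\<^sub>v d" for v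
  proof -
    have "(H1 @\<^sub>r 0\<^sub>m m e) *\<^sub>v v = (H1 *\<^sub>v v) @\<^sub>v (0\<^sub>m m e *\<^sub>v v)"
      by (rule mat_mult_append[OF assms(1) zero_carrier_mat v(1)])
    then show ?thesis using v by (auto simp: scalar_prod_def)
  qed
  moreover have "dim_row (H1 @\<^sub>r 0\<^sub>m m e) = d + m" "dim_col (H1 @\<^sub>r 0\<^sub>m m e) = e"
    using carrier_append_rows[OF assms(1) zero_carrier_mat[of m e]] by (auto simp only: carrier_matD)
  ultimately show ?thesis
    using assms unfolding inj_mat_def by auto
qed

text \<open>Split an intertwiner into an upper part \<open>H1\<close> and a lower part
  \<open>H2\<close>. The lower part intertwines \<open>C\<close> and \<open>y\<close>, so it is zero
  or injective. If it is zero, \<open>H1\<close> intertwines \<open>x\<close> and \<open>y\<close>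
  and \<open>u\<close> is arbitrary; this is the set \<open>?A\<close>. If it is injective,
  \<open>H1\<close> is arbitrary and \<open>u\<close> solves the linear equation in
  \<open>?U\<close>; this is \<open>?B\<close>, where the free choices of \<open>H1\<close> and
  \<open>u\<close> again multiply to at most \<open>CARD('k) ^ (d * m)\<close>.\<close>

lemma sum_intertwiners_block_le:
  assumes fin: "finite (UNIV :: 'k :: field set)" and x: "(x :: 'k mat) \<in> carrier_mat d d"
    and C: "C \<in> carrier_mat m m" and y: "y \<in> carrier_mat e e" "irreducible_mat y"
  shows "(\<Sum>u\<in>carrier_mat d m. card (intertwiners (four_block_mat x u (0\<^sub>m m d) C) y))
    \<le> CARD('k) ^ (d * m) * (card (intertwiners C y) + card (intertwiners x y))"
proof -
  let ?S = "SIGMA u : carrier_mat d m. intertwiners (four_block_mat x u (0\<^sub>m m d) C) y"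
  let ?U = "\<lambda>(H2, H1). {u \<in> carrier_mat d m. u * H2 = H1 * y - x * H1}"
  let ?A = "(\<lambda>(u, H1). (u, H1 @\<^sub>r 0\<^sub>m m e)) ` ((carrier_mat d m :: 'k mat set) \<times> intertwiners x y)"
  let ?P = "intertwiners C y \<times> (carrier_mat d e :: 'k mat set)"
  let ?B = "(\<lambda>((H2, H1), u). (u, H1 @\<^sub>r H2)) ` (SIGMA p : ?P. ?U p)"
  have fi: "finite (intertwiners A y)" for A by (rule finite_intertwiners[OF fin])
  have fc: "finite (carrier_mat a b :: 'k mat set)" for a b by (rule finite_carrier_mat[OF fin])
  have sub: "?S \<subseteq> ?A \<union> ?B"
  proof (clarify)
    fix u H assume u: "u \<in> carrier_mat d m" and H: "H \<in> intertwiners (four_block_mat x u (0\<^sub>m m d) C) y"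
      and nB: "(u, H) \<notin> ?B"
    have bc: "four_block_mat x u (0\<^sub>m m d) C \<in> carrier_mat (d + m) (d + m)" using x C by simp
    note H = intertwinersD[OF H bc y(1)]
    obtain H1 H2 where HH: "H = (H1 @\<^sub>r H2)" "H1 \<in> carrier_mat d e" "H2 \<in> carrier_mat m e"
      using append_rows_cases[OF H(1)] .
    have "((x * H1 + u * H2) @\<^sub>r (0\<^sub>m m d * H1 + C * H2)) = ((H1 * y) @\<^sub>r (H2 * y))"
      using H(3) mult_append_rows[OF x u _ C HH(2,3), of "0\<^sub>m m d"] append_rows_mult[OF HH(2,3) y(1)] HH(1)
      by simp
    then have eq: "x * H1 + u * H2 = H1 * y" "0\<^sub>m m d * H1 + C * H2 = H2 * y"
      using append_rows_eq_iff[of "x * H1 + u * H2" d e "0\<^sub>m m d * H1 + C * H2" m "H1 * y" "H2 * y"]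
        x u C HH y by auto
    have eq2: "C * H2 = H2 * y" using eq(2) HH C by (auto simp: left_add_zero_mat[of _ m e])
    have d: "dim_row y = e" using y by simp
    have "H2 = 0\<^sub>m m e \<or> inj_mat H2"
      using y(2)[unfolded irreducible_mat_def d] C HH(3) eq2 by blast
    then show "(u, H) \<in> ?A"
    proof
      assume 0: "H2 = 0\<^sub>m m e"
      have "x * H1 = H1 * y" using eq(1) 0 u x HH by (simp add: right_add_zero_mat[of _ d e])
      moreover have "inj_mat H1" using inj_mat_append_zero[OF HH(2)] H(2) HH(1) 0 by simp
      ultimately have "H1 \<in> intertwiners x y" using x y HH by (simp add: intertwiners_def)
      then show ?thesis using u HH(1) 0 by auto
    next
      assume "inj_mat H2"
      then have "H2 \<in> intertwiners C y" using eq2 C HH y by (simp add: intertwiners_def)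
      moreover have "u * H2 = H1 * y - x * H1"
        unfolding eq(1)[symmetric] using x u HH by (intro eq_matI) auto
      ultimately have "(u, H) \<in> ?B"
        using u HH by (auto intro!: image_eqI[where x = "((H2, H1), u)"])
      then show ?thesis using nB by simp
    qed
  qed
  have finU: "finite (?U p)" for p by (cases p) (simp add: fc)
  have "card ?S \<le> card ?A + card ?B"
    by (rule order_trans[OF card_mono[OF _ sub] card_Un_le])
      (intro finite_UnI finite_imageI finite_SigmaI finU fi fc)
  also have "card ?A \<le> CARD('k) ^ (d * m) * card (intertwiners x y)"
    by (rule order_trans[OF card_image_le]) (auto simp: fi fc card_carrier_mat card_cartesian_product)
  also have "card ?B \<le> card (SIGMA p : ?P. ?U p)"
    by (intro card_image_le finite_SigmaI finU fi fc)
  also have "\<dots> = (\<Sum>p\<in>?P. card (?U p))"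
    using finU by (intro card_SigmaI) (auto simp: fi fc)
  also have "\<dots> \<le> (\<Sum>p\<in>?P. CARD('k) ^ (d * (m - e)))"
  proof (rule sum_mono)
    fix p assume "p \<in> ?P"
    then obtain H2 H1 where p: "p = (H2, H1)" "H2 \<in> intertwiners C y" by auto
    note H2 = intertwinersD[OF p(2) C y(1)]
    show "card (?U p) \<le> CARD('k) ^ (d * (m - e))"
      using card_left_solutions_le[OF fin H2(1,2) inj_mat_card_le[OF fin H2(1,2)]] by (simp add: p)
  qed
  also have "\<dots> = CARD('k) ^ (d * m) * card (intertwiners C y)"
  \<comment> \<open>The exponents add up to \<open>d * m\<close> only if \<open>e \<le> m\<close>,
    which the existence of an intertwiner guarantees; without one both sides are zero.\<close>
  proof (cases "intertwiners C y = {}")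
    case False
    then obtain H2 where H2: "H2 \<in> intertwiners C y" by blast
    note H2 = intertwinersD[OF H2 C y(1)]
    have "e \<le> m" by (rule inj_mat_card_le[OF fin H2(1,2)])
    then have "d * e + d * (m - e) = d * m"
      by (metis add_mult_distrib2 le_add_diff_inverse)
    then show ?thesis
      by (simp add: card_cartesian_product card_carrier_mat flip: power_add)
  qed auto
  finally have "card ?S \<le> CARD('k) ^ (d * m) * card (intertwiners x y) + CARD('k) ^ (d * m) * card (intertwiners C y)"
    by simp
  moreover have "card ?S = (\<Sum>u\<in>carrier_mat d m. card (intertwiners (four_block_mat x u (0\<^sub>m m d) C) y))"
    by (rule card_SigmaI) (auto simp: fi fc)
  ultimately show ?thesis by (simp add: algebra_simps)
qed

text \<open>The mean number of intertwiners is exactly 1 when the space is large enough for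
  \<open>y\<close>, by \<open>average_intertwiners\<close> with constant weight, and 0
  otherwise.\<close>

lemma sum_intertwiners_le:
  assumes fin: "finite (UNIV :: 'k :: field set)" and y: "(y :: 'k mat) \<in> general_linear e"
  shows "(\<Sum>C\<in>general_linear m. real (card (intertwiners C y))) \<le> card (general_linear m :: 'k mat set)"
proof (cases "e \<le> m")
  case True
  define m' where "m' = m - e"
  have m: "m = e + m'" using True m'_def by simp
  have pos: "card (general_linear n :: 'k mat set) > 0" for n by (rule card_general_linear_pos[OF fin])
  have "CARD('k) > 0" using fin by (simp add: card_gt_0_iff)
  then show ?thesis
    using average_intertwiners[OF fin y, of m' "\<lambda>_. 1"] pos[of m] pos[of m'] unfolding m
    by (simp add: card_carrier_mat divide_simps)
next
  case False
  have "intertwiners C y = {}" if "C \<in> general_linear m" for C :: "'k mat"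
    using intertwinersD(1,2)[OF _ general_linear_carrier[OF that] general_linear_carrier[OF y]]
      inj_mat_card_le[OF fin] False by blast
  then show ?thesis by simp
qed

text \<open>The first factor conditions \<open>A\<close> to have corner \<open>x\<close>, and the
  block estimate then bounds the mean of the second. The summand 1 is what independence would give;
  the number of intertwiners between \<open>x\<close> and \<open>y\<close> is the
  correlation.\<close>

lemma second_moment_intertwiners:
  assumes fin: "finite (UNIV :: 'k :: field set)" and x: "(x :: 'k mat) \<in> general_linear d" and dn: "d \<le> n"
    and y: "y \<in> general_linear e" "irreducible_mat y"
  shows "(\<Sum>A\<in>general_linear n. real (card (intertwiners A x)) * card (intertwiners A y)) /
     card (general_linear n :: 'k mat set) \<le> 1 + card (intertwiners x y)"
proof -
  define m where "m = n - d"
  have n: "n = d + m" using dn m_def by simp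
  have yc: "y \<in> carrier_mat e e" and xc: "x \<in> carrier_mat d d"
    using x y by (auto simp: general_linear_carrier)
  have pos: "card (general_linear m :: 'k mat set) > 0" for m by (rule card_general_linear_pos[OF fin])
  have q: "CARD('k) > 0" using fin by (simp add: card_gt_0_iff)
  have "(\<Sum>A\<in>general_linear n. real (card (intertwiners A x)) * card (intertwiners A y)) /
     card (general_linear n :: 'k mat set) =
     (\<Sum>A\<in>general_linear n. real (card (intertwiners A y)) * card (intertwiners A x)) /
     card (general_linear n :: 'k mat set)"
    by (simp add: mult.commute)
  also have "\<dots> = (\<Sum>u\<in>carrier_mat d m. \<Sum>C\<in>general_linear m. real (card (intertwiners (four_block_mat x u (0\<^sub>m m d) C) y))) /
     (CARD('k) ^ (d * m) * card (general_linear m :: 'k mat set))"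
    unfolding n
    by (rule average_intertwiners[OF fin x])
       (metis card_intertwiners_conj[OF fin] general_linear_carrier yc)
  also have "(\<Sum>u\<in>carrier_mat d m. \<Sum>C\<in>general_linear m. real (card (intertwiners (four_block_mat x u (0\<^sub>m m d) C) y)))
    = (\<Sum>C\<in>general_linear m. \<Sum>u\<in>carrier_mat d m. real (card (intertwiners (four_block_mat x u (0\<^sub>m m d) C) y)))"
    by (rule sum.swap)
  also have "\<dots> \<le> (\<Sum>C\<in>general_linear m. CARD('k) ^ (d * m) * (real (card (intertwiners C y)) + card (intertwiners x y)))"
  proof (rule sum_mono)
    fix C :: "'k mat" assume C: "C \<in> general_linear m"
    show "(\<Sum>u\<in>carrier_mat d m. real (card (intertwiners (four_block_mat x u (0\<^sub>m m d) C) y))) \<le>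
      CARD('k) ^ (d * m) * (real (card (intertwiners C y)) + card (intertwiners x y))"
      using sum_intertwiners_block_le[OF fin xc general_linear_carrier[OF C] yc y(2)]
      by (metis (mono_tags, lifting) of_nat_add of_nat_le_iff of_nat_mult of_nat_sum sum.cong of_nat_power)
  qed
  also have "\<dots> = CARD('k) ^ (d * m) * ((\<Sum>C\<in>general_linear m. real (card (intertwiners C y))) +
      card (general_linear m :: 'k mat set) * real (card (intertwiners x y)))"
    by (simp add: sum.distrib flip: sum_distrib_left)
  also have "\<dots> \<le> CARD('k) ^ (d * m) * (card (general_linear m :: 'k mat set) +
      card (general_linear m :: 'k mat set) * real (card (intertwiners x y)))"
    using sum_intertwiners_le[OF fin y(1)] by (intro mult_left_mono add_right_mono) auto
  also have "\<dots> = (1 + card (intertwiners x y)) * (CARD('k) ^ (d * m) * card (general_linear m :: 'k mat set))"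
    by (simp add: algebra_simps)
  finally show ?thesis
    using pos[of m] q by (simp add: divide_right_mono add_divide_distrib)
qed

section \<open>Finite fields inside an algebraic closure\<close>

text \<open>Multiplication by \<open>y\<close> permutes the nonzero elements of \<open>S\<close>;
  compare the products over both arrangements. \<open>S\<close> is any finite stable set and not
  just a group, so that it can later be the span of some powers of \<open>y\<close>.\<close>

lemma power_card_eq_1:
  fixes y :: "'a :: field"
  assumes "finite S" "y \<noteq> 0" "\<And>s. s \<in> S \<Longrightarrow> y * s \<in> S"
  shows "y ^ card (S - {0}) = 1"
proof -
  have "(*) y ` (S - {0}) = S - {0}"
    using assms by (intro card_subset_eq) (auto simp: card_image inj_on_def)
  then have "(\<Prod>s\<in>S - {0}. s) = (\<Prod>s\<in>(*) y ` (S - {0}). s)" by simp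
  also have "\<dots> = (\<Prod>s\<in>S - {0}. y * s)"
    using assms by (subst prod.reindex) (auto simp: inj_on_def)
  also have "\<dots> = y ^ card (S - {0}) * (\<Prod>s\<in>S - {0}. s)"
    by (simp add: prod.distrib)
  finally show ?thesis using assms by (simp add: prod_zero_iff)
qed

text \<open>A repeated linear factor would make the root a root of the derivative as well, so the
  multiset of roots has no repetitions.\<close>

lemma card_roots_of_separable:
  fixes P :: "'a :: alg_closed_field poly"
  assumes "P \<noteq> 0" "\<And>x. poly P x = 0 \<Longrightarrow> poly (pderiv P) x \<noteq> 0"
  shows "card {x. poly P x = 0} = degree P"
proof -
  obtain A where A: "size A = degree P" "P = smult (lead_coeff P) (\<Prod>x\<in>#A. [:-x, 1:])"
    using alg_closed_imp_factorization[OF assms(1)] by blast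
  have roots: "{x. poly P x = 0} = set_mset A"
  proof -
    have "poly P x = 0 \<longleftrightarrow> x \<in># A" for x
      by (subst A(2), use assms(1) in \<open>auto simp: poly_prod_mset image_iff prod_mset_zero_iff\<close>)
    then show ?thesis by auto
  qed
  have "count A x = 1" if x: "x \<in># A" for x
  proof (rule ccontr)
    assume "count A x \<noteq> 1"
    obtain B where B: "A = add_mset x B" using x by (metis mset_add)
    with \<open>count A x \<noteq> 1\<close> have "x \<in># B" by auto
    then obtain C where C: "B = add_mset x C" by (metis mset_add)
    have "P = [:-x, 1:] * ([:-x, 1:] * smult (lead_coeff P) (\<Prod>x\<in>#C. [:-x, 1:]))"
      by (subst A(2)) (simp add: B C)
    then have "pderiv P = [:-x, 1:] * pderiv ([:-x, 1:] * smult (lead_coeff P) (\<Prod>x\<in>#C. [:-x, 1:])) +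
        [:-x, 1:] * smult (lead_coeff P) (\<Prod>x\<in>#C. [:-x, 1:]) * pderiv [:-x, 1:]"
      by (metis pderiv_mult)
    then have "poly (pderiv P) x = 0"
      by simp
    moreover have "poly P x = 0" using roots x by auto
    ultimately show False using assms(2) by blast
  qed
  then have "size A = card (set_mset A)"
    by (simp add: size_multiset_overloaded_eq)
  then show ?thesis using A(1) roots by simp
qed

locale finite_field =
  fixes ty :: "'k :: field itself" and p m q :: nat
  assumes finite_UNIV_field: "finite (UNIV :: 'k set)"
    and prime_char: "prime p" and char_p: "of_nat p = (0 :: 'k)"
    and card_field: "CARD('k) = q" and q_eq: "q = p ^ m"
begin



lemma q_ge_2: "q \<ge> 2"
proof -
  have "card {0, 1 :: 'k} \<le> CARD('k)"
    by (intro card_mono finite_UNIV_field) auto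
  then show ?thesis by (simp add: card_field)
qed

lemma q_power_gt_1: "d \<ge> 1 \<Longrightarrow> q ^ d > 1"
  using q_ge_2 by (intro one_less_power) auto

lemma CHAR_field: "CHAR('k) = p"
proof -
  have "CHAR('k) dvd p" using char_p by (simp add: of_nat_eq_0_iff_char_dvd)
  moreover have "CHAR('k) \<noteq> 1" by (simp add: CHAR_not_1)
  ultimately show ?thesis using prime_char unfolding prime_nat_iff by blast
qed

lemma field_power_card: "(x :: 'k) ^ q = x"
proof (cases "x = 0")
  case False
  have "x ^ (q - 1) = 1"
    using power_card_eq_1[OF finite_UNIV_field False] by (simp add: card_field finite_UNIV_field)
  then have "x ^ Suc (q - 1) = x" by simp
  moreover have "Suc (q - 1) = q" using q_ge_2 by simp
  ultimately show ?thesis by metis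
qed (use q_ge_2 in simp)

lemma field_power_card_power: "(x :: 'k) ^ (q ^ d) = x"
proof (induction d)
  case (Suc d)
  have "x ^ q ^ Suc d = (x ^ q ^ d) ^ q" by (simp add: mult.commute flip: power_mult)
  then show ?case using Suc field_power_card by simp
qed simp

lemma frobenius_add: "(x + y :: 'k alg_closure) ^ (q ^ d) = x ^ (q ^ d) + y ^ (q ^ d)"
  using prime_char by (intro freshmans_dream'[where n = "m * d"])
    (auto simp: CHAR_field q_eq power_mult)

text \<open>The field with \<open>q ^ d\<close> elements, as the fixed points of a power of
  Frobenius. Placing all of them in one algebraic closure lets \<open>d\<close> vary inside a single
  type.\<close>

definition K :: "nat \<Rightarrow> 'k alg_closure set" where
  "K d = {x. x ^ (q ^ d) = x}"

lemma K_add: "x \<in> K d \<Longrightarrow> y \<in> K d \<Longrightarrow> x + y \<in> K d"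
  by (simp add: K_def frobenius_add)

lemma K_mult: "x \<in> K d \<Longrightarrow> y \<in> K d \<Longrightarrow> x * y \<in> K d"
  by (simp add: K_def power_mult_distrib)

lemma K_power: "x \<in> K d \<Longrightarrow> x ^ n \<in> K d"
  unfolding K_def mem_Collect_eq by (metis mult.commute power_mult)

lemma K_inverse: "x \<in> K d \<Longrightarrow> inverse x \<in> K d"
  by (simp add: K_def power_inverse)

lemma K_to_ac: "to_ac c \<in> K d"
  by (simp add: K_def field_power_card_power flip: to_ac_power)

lemma K_0: "0 \<in> K d" and K_1: "1 \<in> K d"
  using K_to_ac[of 0] K_to_ac[of 1] by simp_all

lemma K_divide: "x \<in> K d \<Longrightarrow> y \<in> K d \<Longrightarrow> x / y \<in> K d"
  by (simp add: divide_inverse K_mult K_inverse)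

lemma K_minus: "x \<in> K d \<Longrightarrow> - x \<in> K d"
  using K_mult[OF K_to_ac[of "-1" d], of x] by simp

lemma K_diff: "x \<in> K d \<Longrightarrow> y \<in> K d \<Longrightarrow> x - y \<in> K d"
  using K_add[of x d "- y"] K_minus by simp

lemma K_sum: "(\<And>i. i \<in> I \<Longrightarrow> f i \<in> K d) \<Longrightarrow> sum f I \<in> K d"
  by (induction I rule: infinite_finite_induct) (auto simp: K_0 K_add)

text \<open>Euclid's algorithm on the exponents of Frobenius: an element fixed by the
  \<open>a\<close>-th and the \<open>b\<close>-th iterate is fixed by the
  \<open>a mod b\<close>-th.\<close>

lemma K_gcd: "x \<in> K a \<Longrightarrow> x \<in> K b \<Longrightarrow> x \<in> K (gcd a b)"
proof (induction a b rule: gcd_nat_induct)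
  case (step a b)
  have "x \<in> K (a mod b)"
  proof -
    have pow: "x ^ q ^ (b * c) = x" for c
    proof (induction c)
      case (Suc c)
      have "x ^ q ^ (b * Suc c) = (x ^ q ^ (b * c)) ^ q ^ b"
        by (simp add: power_add mult.commute flip: power_mult)
      then show ?case using Suc step.prems by (simp add: K_def)
    qed simp
    have "x ^ q ^ a = (x ^ q ^ (b * (a div b))) ^ q ^ (a mod b)"
      by (metis mult_div_mod_eq power_add power_mult)
    then show ?thesis using pow step.prems by (simp add: K_def)
  qed
  then show ?case using step by (metis gcd_red_nat)
qed auto

text \<open>The polynomial with roots \<open>K d\<close> has derivative \<open>-1\<close>, hence
  only simple roots.\<close>

lemma card_K: "d \<ge> 1 \<Longrightarrow> card (K d) = q ^ d" and finite_K: "d \<ge> 1 \<Longrightarrow> finite (K d)"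
proof -
  assume d: "d \<ge> 1"
  define Q where "Q = q ^ d"
  have Q: "Q > 1" unfolding Q_def using q_power_gt_1[OF d] .
  define P :: "'k alg_closure poly" where "P = monom 1 Q - monom 1 1"
  have deg: "degree P = Q"
    unfolding P_def using Q degree_add_eq_left[of "- monom 1 1" "monom (1 :: 'k alg_closure) Q"]
    by (simp add: degree_monom_eq)
  then have P0: "P \<noteq> 0" using Q by auto
  have roots: "{x. poly P x = 0} = K d"
    by (auto simp: P_def K_def Q_def poly_monom)
  have "p dvd q" using q_ge_2 unfolding q_eq by (cases m) auto
  then have "p dvd Q" unfolding Q_def using d by (intro dvd_trans[OF _ dvd_power]) auto
  then have Q0: "of_nat Q = (0 :: 'k alg_closure)"
    using CHAR_field by (simp add: of_nat_eq_0_iff_char_dvd)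
  have "pderiv P = - 1"
    by (simp add: P_def pderiv_diff pderiv_monom Q0 one_pCons monom_0)
  then show "card (K d) = q ^ d"
    using card_roots_of_separable[OF P0] roots deg by (simp add: Q_def)
  then show "finite (K d)" using q_ge_2 by (intro card_ge_0_finite) simp
qed

definition ev :: "(nat \<Rightarrow> 'k) \<Rightarrow> nat \<Rightarrow> 'k alg_closure \<Rightarrow> 'k alg_closure" where
  "ev c n x = (\<Sum>i<n. to_ac (c i) * x ^ i)"

text \<open>Linear independence of the first \<open>n\<close> powers of \<open>x\<close> over the
  base field. For \<open>x\<close> in \<open>K d\<close> and \<open>n = d\<close> it says that
  \<open>x\<close> generates \<open>K d\<close>.\<close>

definition indep :: "nat \<Rightarrow> 'k alg_closure \<Rightarrow> bool" where
  "indep n x \<longleftrightarrow> (\<forall>c. ev c n x = 0 \<longrightarrow> (\<forall>i<n. c i = 0))"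

lemma ev_diff: "ev c n x - ev c' n x = ev (\<lambda>i. c i - c' i) n x"
  by (simp add: ev_def algebra_simps sum_subtractf)

lemma ev_in_K: "x \<in> K d \<Longrightarrow> ev c n x \<in> K d"
  unfolding ev_def by (intro K_sum K_mult K_to_ac K_power)

lemma indep_inj: "indep n x \<Longrightarrow> ev c n x = ev c' n x \<Longrightarrow> i < n \<Longrightarrow> c i = c' i"
  using ev_diff[of c n x c'] unfolding indep_def by (metis (no_types, lifting) eq_iff_diff_eq_0)

lemma inj_on_ev: "indep n x \<Longrightarrow> inj_on (\<lambda>c. ev c n x) ({..<n} \<rightarrow>\<^sub>E UNIV)"
  by (intro inj_onI PiE_ext) (auto dest: indep_inj)

lemma card_functions: "card ({..<n} \<rightarrow>\<^sub>E (UNIV :: 'k set)) = q ^ n"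
  by (simp add: card_PiE card_field)

lemma indep_le: "indep n x \<Longrightarrow> x \<in> K d \<Longrightarrow> d \<ge> 1 \<Longrightarrow> n \<le> d"
proof -
  assume i: "indep n x" "x \<in> K d" "d \<ge> 1"
  then have "q ^ n \<le> q ^ d"
    using card_inj_on_le[OF inj_on_ev[OF i(1)] image_subsetI, of "K d"] ev_in_K[OF i(2)] card_functions[of n]
      card_K[OF i(3)] finite_K[OF i(3)] by simp
  then show ?thesis using q_ge_2 by simp
qed

lemma ev_surj:
  assumes "indep d x" "x \<in> K d" "d \<ge> 1" "z \<in> K d"
  obtains c where "z = ev c d x"
proof -
  have "(\<lambda>c. ev c d x) ` ({..<d} \<rightarrow>\<^sub>E UNIV) = K d"
  proof (rule card_subset_eq[OF finite_K[OF assms(3)]])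
    show "(\<lambda>c. ev c d x) ` ({..<d} \<rightarrow>\<^sub>E UNIV) \<subseteq> K d"
      by (intro image_subsetI ev_in_K assms)
    show "card ((\<lambda>c. ev c d x) ` ({..<d} \<rightarrow>\<^sub>E UNIV)) = card (K d)"
      using card_image[OF inj_on_ev[OF assms(1)]] card_functions[of d] card_K[OF assms(3)] by simp
  qed
  then show thesis using assms(4) that by blast
qed

lemma indep_mono: "indep n x \<Longrightarrow> k \<le> n \<Longrightarrow> indep k x"
  unfolding indep_def
proof (intro allI impI)
  fix c i assume a: "\<forall>c. ev c n x = 0 \<longrightarrow> (\<forall>i<n. c i = 0)" "k \<le> n" "ev c k x = 0" "i < k"
  have "ev (\<lambda>i. if i < k then c i else 0) n x = ev c k x"
    unfolding ev_def using a(2) by (intro sum.mono_neutral_cong_right) auto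
  then show "c i = 0" using a by (metis (mono_tags, lifting) order_less_le_trans)
qed

text \<open>A non-generator lies in a proper subfield. The span \<open>S\<close> of the independent
  powers of \<open>x\<close> is stable under multiplication by \<open>x\<close> and has
  \<open>q ^ e\<close> elements, so \<open>power_card_eq_1\<close> puts \<open>x\<close> into
  \<open>K e\<close>; minimal polynomials are avoided.\<close>

lemma dependent_power:
  assumes x: "x \<in> K d" "d \<ge> 1" and dep: "\<not> indep d x"
  obtains e where "1 \<le> e" "2 * e \<le> d" "x \<in> K e"
proof -
  have ind1: "indep 1 x" by (simp add: indep_def ev_def)
  \<comment> \<open>The degree of \<open>x\<close>: the powers below \<open>x ^ e\<close> are
    independent, and \<open>x ^ e\<close> depends on them.\<close>
  define e where "e = (LEAST n. \<not> indep (Suc n) x)"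
  have "\<not> indep (Suc d) x" using indep_le x by fastforce
  then have e: "\<not> indep (Suc e) x" unfolding e_def by (rule LeastI)
  have e1: "1 \<le> e" using e ind1 by (cases e) auto
  then have ie: "indep e x"
    using not_less_Least[of "e - 1" "\<lambda>n. \<not> indep (Suc n) x"] e1 by (auto simp: e_def)
  have ed: "e < d"
    using ie dep indep_mono[OF ie, of d] by (meson not_le_imp_less)
  define S where "S = range (\<lambda>c. ev c e x)"
  have add: "a + b \<in> S" if ab: "a \<in> S" "b \<in> S" for a b
  proof -
    obtain c c' where "a = ev c e x" "b = ev c' e x" using ab by (auto simp: S_def)
    then have "a + b = ev (\<lambda>i. c i + c' i) e x"
      by (simp add: ev_def sum.distrib algebra_simps)
    then show ?thesis by (auto simp: S_def)
  qed
  have scale: "to_ac k * a \<in> S" if aS: "a \<in> S" for a k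
  proof -
    obtain c where "a = ev c e x" using aS by (auto simp: S_def)
    then have "to_ac k * a = ev (\<lambda>i. k * c i) e x"
      by (simp add: ev_def sum_distrib_left mult.assoc)
    then show ?thesis by (auto simp: S_def)
  qed
  have sum: "sum f I \<in> S" if "\<And>i. i \<in> I \<Longrightarrow> f i \<in> S" for f :: "nat \<Rightarrow> _" and I
    using that
  proof (induction I rule: infinite_finite_induct)
    case empty
    have "(0 :: 'k alg_closure) = ev (\<lambda>_. 0) e x" by (simp add: ev_def)
    then show ?case by (auto simp: S_def)
  next
    case (infinite A)
    have "(0 :: 'k alg_closure) = ev (\<lambda>_. 0) e x" by (simp add: ev_def)
    then show ?case using infinite by (auto simp: S_def)
  qed (auto intro: add)
  have pw: "x ^ i \<in> S" if "i < e" for i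
  proof -
    have "ev (\<lambda>j. if j = i then 1 else 0) e x = (\<Sum>j<e. if j = i then x ^ j else 0)"
      unfolding ev_def by (intro sum.cong) auto
    then have "x ^ i = ev (\<lambda>j. if j = i then 1 else 0) e x"
      using that by simp
    then show ?thesis by (auto simp: S_def)
  qed
  have pwe: "x ^ e \<in> S"
  proof -
    obtain c where c: "ev c (Suc e) x = 0" "\<exists>i<Suc e. c i \<noteq> 0" using e by (auto simp: indep_def)
    have "c e \<noteq> 0"
    proof
      assume "c e = 0"
      then have "ev c e x = 0" using c(1) by (simp add: ev_def)
      then show False using ie c(2) \<open>c e = 0\<close> by (auto simp: indep_def less_Suc_eq)
    qed
    have "to_ac (c e) * x ^ e = to_ac (- 1) * ev c e x"
      using c(1) by (simp add: ev_def eq_neg_iff_add_eq_0 add.commute)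
    then have "x ^ e = to_ac (inverse (c e)) * (to_ac (- 1) * ev c e x)"
      using \<open>c e \<noteq> 0\<close> by (simp add: field_simps)
    moreover have "ev c e x \<in> S" by (simp add: S_def)
    ultimately show ?thesis by (metis scale)
  qed
  have timesx: "x * a \<in> S" if aS: "a \<in> S" for a
  proof -
    obtain c where c: "a = ev c e x" using aS by (auto simp: S_def)
    have eq: "x * a = (\<Sum>i<e. to_ac (c i) * x ^ Suc i)"
      unfolding c ev_def sum_distrib_left by (intro sum.cong) auto
    have "x ^ Suc i \<in> S" if "i < e" for i
      using that pw[of "Suc i"] pwe by (cases "Suc i = e") auto
    then show ?thesis unfolding eq by (intro sum scale) auto
  qed
  have "x \<noteq> 0 \<Longrightarrow> x ^ card (S - {0}) = 1"
  proof (rule power_card_eq_1)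
    have "S \<subseteq> K d" using ev_in_K[OF x(1)] by (auto simp: S_def)
    then show "finite S" using finite_K x(2) finite_subset by blast
  qed (auto intro: timesx)
  moreover have "card S = q ^ e"
  proof -
    have "S = (\<lambda>c. ev c e x) ` ({..<e} \<rightarrow>\<^sub>E UNIV)"
    proof -
      have "ev c e x = ev (restrict c {..<e}) e x" for c by (simp add: ev_def)
      moreover have "restrict c {..<e} \<in> {..<e} \<rightarrow>\<^sub>E UNIV" for c :: "nat \<Rightarrow> 'k" by simp
      ultimately show ?thesis unfolding S_def by (intro equalityI image_subsetI) blast+
    qed
    then show ?thesis using card_image[OF inj_on_ev[OF ie]] card_functions by simp
  qed
  moreover have "0 \<in> S" using sum[of "{}" "\<lambda>_. 0"] by simp
  ultimately have "x \<noteq> 0 \<Longrightarrow> x ^ (q ^ e - 1) = 1"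
    by (simp add: card_Diff_singleton)
  then have "x \<noteq> 0 \<Longrightarrow> x ^ Suc (q ^ e - 1) = x" by simp
  moreover have "Suc (q ^ e - 1) = q ^ e" using q_power_gt_1[OF e1] by simp
  ultimately have "x \<in> K e"
    unfolding K_def using q_ge_2 by (cases "x = 0") auto
  \<comment> \<open>Passing to the gcd yields a proper divisor of \<open>d\<close>, hence at most
    half of \<open>d\<close>, without first showing that \<open>e\<close> divides
    \<open>d\<close>.\<close>
  then have "x \<in> K (gcd e d)" using x K_gcd by blast
  moreover have "2 * gcd e d \<le> d"
  proof -
    obtain k where k: "d = gcd e d * k" by (meson dvdE gcd_dvd2)
    have "gcd e d \<le> e" using e1 by (simp add: gcd_le1_nat)
    then have "gcd e d < d" using ed by simp
    then have "k \<noteq> 1" using k by (metis less_irrefl mult.right_neutral)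
    moreover have "k \<noteq> 0" using k ed by (metis mult_0_right not_less_zero)
    ultimately have "2 \<le> k" by simp
    then have "gcd e d * 2 \<le> gcd e d * k" by (rule mult_le_mono2)
    also have "\<dots> = d" using k by (rule sym)
    finally show ?thesis by (simp only: mult.commute)
  qed
  moreover have "1 \<le> gcd e d" using e1 by (simp add: Suc_leI)
  ultimately show thesis using that by blast
qed

text \<open>All non-generators lie in fields \<open>K e\<close> with \<open>e \<le> d div 2\<close>;
  the geometric sum of their sizes is dominated by its last term.\<close>

lemma card_dependent: "d \<ge> 1 \<Longrightarrow> card {x \<in> K d. \<not> indep d x} \<le> 2 * q ^ (d div 2)"
proof -
  assume d: "d \<ge> 1"
  have "{x \<in> K d. \<not> indep d x} \<subseteq> (\<Union>e\<in>{1..d div 2}. K e)"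
  proof safe
    fix x assume "x \<in> K d" "\<not> indep d x"
    then obtain e where "1 \<le> e" "2 * e \<le> d" "x \<in> K e" using dependent_power d by blast
    then show "x \<in> (\<Union>e\<in>{1..d div 2}. K e)" by (intro UN_I[of e]) auto
  qed
  then have "card {x \<in> K d. \<not> indep d x} \<le> card (\<Union>e\<in>{1..d div 2}. K e)"
    by (intro card_mono) (auto simp: finite_K)
  also have "\<dots> \<le> (\<Sum>e\<in>{1..d div 2}. card (K e))" by (rule card_UN_le) simp
  also have "\<dots> = (\<Sum>e\<in>{1..d div 2}. q ^ e)" by (simp add: card_K)
  also have "\<dots> \<le> 2 * q ^ (d div 2)"
  proof (induction "d div 2")
    case 0 then show ?case by simp
  next
    case (Suc n)
    have "(\<Sum>e\<in>{1..n}. q ^ e) \<le> q ^ Suc n" for n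
    proof (induction n)
      case (Suc n)
      have "(\<Sum>e = 1..Suc n. q ^ e) = (\<Sum>e = 1..n. q ^ e) + q ^ Suc n" by simp
      also have "\<dots> \<le> 2 * q ^ Suc n" using Suc by simp
      also have "\<dots> \<le> q * q ^ Suc n" using q_ge_2 by (intro mult_right_mono) auto
      finally show ?case by simp
    qed simp
    from this[of n] show ?case unfolding Suc(2)[symmetric] by simp
  qed
  finally show ?thesis .
qed

text \<open>The bound of \<open>card_dependent\<close> may equal \<open>q ^ d\<close>, for example
  with \<open>q = 2\<close> and \<open>d = 1\<close>. The union bound is therefore taken over all
  \<open>e < d\<close>, where the geometric sum is strictly smaller than
  \<open>q ^ d\<close>.\<close>

lemma exists_indep:
  assumes "d \<ge> 1"
  shows "\<exists>x \<in> K d. indep d x"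
proof (rule ccontr)
  assume "\<not> ?thesis"
  then have "K d \<subseteq> (\<Union>e\<in>{1..<d}. K e)"
  proof safe
    fix x assume *: "\<not> (\<exists>x\<in>K d. indep d x)" and x: "x \<in> K d"
    then have "\<not> indep d x" by blast
    then obtain e where "1 \<le> e" "2 * e \<le> d" "x \<in> K e" using dependent_power[OF x assms] by blast
    then show "x \<in> (\<Union>e\<in>{1..<d}. K e)" by (intro UN_I[of e]) auto
  qed
  then have "card (K d) \<le> card (\<Union>e\<in>{1..<d}. K e)"
    by (intro card_mono) (auto simp: finite_K)
  also have "\<dots> \<le> (\<Sum>e\<in>{1..<d}. card (K e))" by (rule card_UN_le) simp
  also have "\<dots> = (\<Sum>e\<in>{1..<d}. q ^ e)" by (simp add: card_K)
  also have "\<dots> < q ^ d"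
  proof -
    have "(\<Sum>e\<in>{1..<Suc n}. q ^ e) < q ^ Suc n" for n
    proof (induction n)
      case (Suc n)
      have "(\<Sum>e = 1..<Suc (Suc n). q ^ e) = (\<Sum>e = 1..<Suc n. q ^ e) + q ^ Suc n" by simp
      also have "\<dots> < 2 * q ^ Suc n" using Suc by simp
      also have "\<dots> \<le> q * q ^ Suc n" using q_ge_2 by (intro mult_right_mono) auto
      finally show ?case by simp
    qed (use q_ge_2 in auto)
    from this[of "d - 1"] show ?thesis using assms by simp
  qed
  finally show False using card_K[OF assms] by simp
qed

section \<open>The regular representation\<close>


text \<open>A fixed generator of \<open>K d\<close>. Its first \<open>d\<close> powers are the basis
  in which \<open>coord\<close>, \<open>cvec\<close> and \<open>rho\<close> are written.\<close>

definition zeta :: "nat \<Rightarrow> 'k alg_closure" where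
  "zeta d = (SOME x. x \<in> K d \<and> indep d x)"

lemma zeta: assumes "d \<ge> 1" shows "zeta d \<in> K d" "indep d (zeta d)"
  using someI_ex[of "\<lambda>x. x \<in> K d \<and> indep d x"] exists_indep[OF assms] unfolding zeta_def by blast+

definition coord :: "nat \<Rightarrow> 'k alg_closure \<Rightarrow> nat \<Rightarrow> 'k" where
  "coord d x = (SOME c. x = ev c d (zeta d))"

lemma ev_coord: "d \<ge> 1 \<Longrightarrow> x \<in> K d \<Longrightarrow> ev (coord d x) d (zeta d) = x"
  unfolding coord_def using ev_surj[OF zeta(2) zeta(1)] by (metis (mono_tags, lifting) someI_ex)

lemma coord_ev: "d \<ge> 1 \<Longrightarrow> i < d \<Longrightarrow> coord d (ev c d (zeta d)) i = c i"
  using indep_inj[OF zeta(2)] ev_coord ev_in_K zeta(1) by metis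

lemma coord_add: "d \<ge> 1 \<Longrightarrow> x \<in> K d \<Longrightarrow> y \<in> K d \<Longrightarrow> i < d \<Longrightarrow> coord d (x + y) i = coord d x i + coord d y i"
proof -
  assume a: "d \<ge> 1" "x \<in> K d" "y \<in> K d" "i < d"
  have "x + y = ev (coord d x) d (zeta d) + ev (coord d y) d (zeta d)" using a ev_coord by simp
  also have "\<dots> = ev (\<lambda>i. coord d x i + coord d y i) d (zeta d)"
    by (simp add: ev_def sum.distrib algebra_simps)
  finally show ?thesis using coord_ev[OF a(1,4)] by simp
qed

lemma coord_scale: "d \<ge> 1 \<Longrightarrow> x \<in> K d \<Longrightarrow> i < d \<Longrightarrow> coord d (to_ac c * x) i = c * coord d x i"
proof -
  assume a: "d \<ge> 1" "x \<in> K d" "i < d"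
  have "to_ac c * x = to_ac c * ev (coord d x) d (zeta d)" using a ev_coord by simp
  also have "\<dots> = ev (\<lambda>i. c * coord d x i) d (zeta d)"
    by (simp add: ev_def sum_distrib_left mult.assoc)
  finally show ?thesis using coord_ev[OF a(1,3)] by simp
qed

lemma coord_0: "d \<ge> 1 \<Longrightarrow> i < d \<Longrightarrow> coord d 0 i = 0"
  using coord_scale[of d 0 i 0] K_0 by simp

lemma coord_sum:
  "d \<ge> 1 \<Longrightarrow> (\<And>l. l \<in> I \<Longrightarrow> f l \<in> K d) \<Longrightarrow> i < d \<Longrightarrow> coord d (sum f I) i = (\<Sum>l\<in>I. coord d (f l) i)"
  by (induction I rule: infinite_finite_induct) (auto simp: coord_0 coord_add K_sum)

lemma coord_mult:
  assumes "d \<ge> 1" "x \<in> K d" "y \<in> K d" "i < d"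
  shows "coord d (x * y) i = (\<Sum>l<d. coord d (x * zeta d ^ l) i * coord d y l)"
proof -
  have "x * y = x * ev (coord d y) d (zeta d)" using assms ev_coord by simp
  also have "\<dots> = (\<Sum>l<d. to_ac (coord d y l) * (x * zeta d ^ l))"
    by (simp add: ev_def sum_distrib_left mult_ac)
  finally have "coord d (x * y) i = (\<Sum>l<d. coord d (to_ac (coord d y l) * (x * zeta d ^ l)) i)"
    using assms zeta(1) by (simp add: coord_sum K_mult K_to_ac K_power)
  also have "\<dots> = (\<Sum>l<d. coord d (x * zeta d ^ l) i * coord d y l)"
    using assms zeta(1) by (simp add: coord_scale K_mult K_power mult.commute)
  finally show ?thesis .
qed

text \<open>Column \<open>j\<close> holds the coordinates of \<open>x * zeta d ^ j\<close>, so this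
  is the matrix of multiplication by \<open>x\<close> on \<open>K d\<close> in the power
  basis.\<close>

definition rho :: "nat \<Rightarrow> 'k alg_closure \<Rightarrow> 'k mat" where
  "rho d x = mat d d (\<lambda>(i, j). coord d (x * zeta d ^ j) i)"

definition cvec :: "nat \<Rightarrow> 'k alg_closure \<Rightarrow> 'k vec" where
  "cvec d x = vec d (coord d x)"

lemma rho_carrier [simp]: "rho d x \<in> carrier_mat d d"
  by (simp add: rho_def)

lemma rho_dim [simp]: "dim_row (rho d x) = d" "dim_col (rho d x) = d"
  by (simp_all add: rho_def)

lemma cvec_carrier [simp]: "cvec d x \<in> carrier_vec d"
  by (simp add: cvec_def)

lemma rho_cvec:
  assumes "d \<ge> 1" "x \<in> K d" "y \<in> K d"
  shows "rho d x *\<^sub>v cvec d y = cvec d (x * y)"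
proof (rule eq_vecI)
  fix i assume "i < dim_vec (cvec d (x * y))"
  then have i: "i < d" by (simp add: cvec_def)
  show "(rho d x *\<^sub>v cvec d y) $ i = cvec d (x * y) $ i"
    using i coord_mult[OF assms i]
    by (simp add: rho_def cvec_def scalar_prod_def lessThan_atLeast0)
qed (simp add: rho_def cvec_def)

lemma rho_mult:
  assumes "d \<ge> 1" "x \<in> K d" "y \<in> K d"
  shows "rho d (x * y) = rho d x * rho d y"
proof (rule eq_matI)
  fix i j assume "i < dim_row (rho d x * rho d y)" "j < dim_col (rho d x * rho d y)"
  then have ij: "i < d" "j < d" by auto
  have "y * zeta d ^ j \<in> K d" using assms zeta(1) by (simp add: K_mult K_power)
  from coord_mult[OF assms(1,2) this ij(1)]
  show "rho d (x * y) $$ (i, j) = (rho d x * rho d y) $$ (i, j)"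
    using ij by (simp add: rho_def scalar_prod_def lessThan_atLeast0 mult.assoc)
qed auto

lemma rho_add:
  assumes "d \<ge> 1" "x \<in> K d" "y \<in> K d"
  shows "rho d (x + y) = rho d x + rho d y"
  using assms zeta(1)
  by (intro eq_matI) (auto simp: rho_def distrib_right coord_add K_mult K_power)

lemma rho_scale:
  assumes "d \<ge> 1" "x \<in> K d"
  shows "rho d (to_ac c * x) = c \<cdot>\<^sub>m rho d x"
  using assms zeta(1)
  by (intro eq_matI) (auto simp: rho_def coord_scale K_mult K_power mult.assoc)

lemma coord_zeta_power:
  assumes "d \<ge> 1" "i < d" "j < d"
  shows "coord d (zeta d ^ j) i = (if i = j then 1 else 0)"
proof -
  have "ev (\<lambda>i. if i = j then 1 else 0) d (zeta d) = (\<Sum>i<d. if i = j then zeta d ^ i else 0)"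
    unfolding ev_def by (intro sum.cong) auto
  also have "\<dots> = zeta d ^ j" using assms by simp
  finally show ?thesis
    using coord_ev[OF assms(1,2), of "\<lambda>i. if i = j then 1 else 0"] by simp
qed

lemma rho_1: "d \<ge> 1 \<Longrightarrow> rho d 1 = 1\<^sub>m d"
  by (intro eq_matI) (auto simp: rho_def coord_zeta_power)

lemma rho_0: "d \<ge> 1 \<Longrightarrow> rho d 0 = 0\<^sub>m d d"
  by (intro eq_matI) (auto simp: rho_def coord_0)

lemma rho_power: "d \<ge> 1 \<Longrightarrow> x \<in> K d \<Longrightarrow> rho d (x ^ n) = rho d x ^\<^sub>m n"
proof (induction n)
  case (Suc n)
  then show ?case using rho_mult[of d "x ^ n" x] by (simp add: K_power mult.commute)
qed (simp add: rho_1)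

lemma cvec_surj:
  assumes "d \<ge> 1" "v \<in> carrier_vec d"
  obtains y where "y \<in> K d" "v = cvec d y"
proof
  show "ev (vec_index v) d (zeta d) \<in> K d" using zeta(1)[OF assms(1)] by (rule ev_in_K)
  show "v = cvec d (ev (vec_index v) d (zeta d))"
    using assms by (intro eq_vecI) (auto simp: cvec_def coord_ev)
qed

lemma cvec_0: "d \<ge> 1 \<Longrightarrow> cvec d 0 = 0\<^sub>v d"
  by (intro eq_vecI) (auto simp: cvec_def coord_0)

lemma rho_general_linear: "d \<ge> 1 \<Longrightarrow> x \<in> K d \<Longrightarrow> x \<noteq> 0 \<Longrightarrow> rho d x \<in> general_linear d"
  using rho_mult[of d x "inverse x"] rho_1[of d] K_inverse[of x d]
  by (intro general_linearI[where B = "rho d (inverse x)"]) auto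

text \<open>Vectors are elements of the field \<open>K d\<close>, and the multiplier is their
  quotient. This replaces all arguments about invariant subspaces.\<close>

lemma rho_transitive:
  assumes "d \<ge> 1" "v \<in> carrier_vec d" "v \<noteq> 0\<^sub>v d" "w \<in> carrier_vec d"
  obtains z where "z \<in> K d" "w = rho d z *\<^sub>v v"
proof -
  obtain a where a: "a \<in> K d" "v = cvec d a" using cvec_surj[OF assms(1,2)] .
  obtain b where b: "b \<in> K d" "w = cvec d b" using cvec_surj[OF assms(1,4)] .
  have "a \<noteq> 0" using assms a cvec_0 by auto
  then have "rho d (b / a) *\<^sub>v v = w"
    using rho_cvec[OF assms(1) K_divide[OF b(1) a(1)] a(1)] a b by simp
  then show thesis using that K_divide[OF b(1) a(1)] by metis
qed

text \<open>Every element of \<open>K d\<close> is a polynomial in the generator \<open>x\<close>.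
  An intertwiner commutes a priori only with the action of \<open>x\<close>; this rule extends such
  facts to all of \<open>K d\<close>.\<close>

lemma indep_induct:
  assumes d: "d \<ge> 1" and x: "x \<in> K d" "indep d x" and z: "z \<in> K d"
    and one: "P 1"
    and times: "\<And>z. z \<in> K d \<Longrightarrow> P z \<Longrightarrow> P (x * z)"
    and add: "\<And>z w. z \<in> K d \<Longrightarrow> w \<in> K d \<Longrightarrow> P z \<Longrightarrow> P w \<Longrightarrow> P (z + w)"
    and scale: "\<And>c z. z \<in> K d \<Longrightarrow> P z \<Longrightarrow> P (to_ac c * z)"
  shows "P z"
proof -
  obtain c where c: "z = ev c d x" using ev_surj[OF x(2,1) d z] .
  have pw: "P (x ^ i)" for i
    by (induction i) (auto intro: one times K_power x)
  have "P (\<Sum>i<n. to_ac (c i) * x ^ i)" for n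
  proof (induction n)
    case 0
    show ?case using scale[OF K_1 one, of 0] by simp
  next
    case (Suc n)
    have "(\<Sum>i<n. to_ac (c i) * x ^ i) \<in> K d" by (intro K_sum K_mult K_to_ac K_power x)
    then show ?case using Suc
      by (auto intro!: add scale pw K_mult K_to_ac K_power x)
  qed
  then show ?thesis unfolding c ev_def .
qed

section \<open>Homomorphisms between multiplication modules\<close>

lemma mat_eq_0I:
  assumes "(H :: 'k mat) \<in> carrier_mat n e" "\<And>w. w \<in> carrier_vec e \<Longrightarrow> H *\<^sub>v w = 0\<^sub>v n"
  shows "H = 0\<^sub>m n e"
proof (rule eq_matI)
  fix i j assume "i < dim_row (0\<^sub>m n e :: 'k mat)" "j < dim_col (0\<^sub>m n e :: 'k mat)"
  then have ij: "i < n" "j < e" by auto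
  have "(H *\<^sub>v unit_vec e j) $ i = H $$ (i, j)"
    using assms(1) ij by simp
  then show "H $$ (i, j) = 0\<^sub>m n e $$ (i, j)"
    using assms(2)[of "unit_vec e j"] ij by simp
qed (use assms in auto)

lemma intertwine_vec:
  assumes "C * H = H * Y" "(C :: 'k mat) \<in> carrier_mat n n" "H \<in> carrier_mat n e" "Y \<in> carrier_mat e e" "v \<in> carrier_vec e"
  shows "H *\<^sub>v (Y *\<^sub>v v) = C *\<^sub>v (H *\<^sub>v v)"
  using assms by (metis assoc_mult_mat_vec)

lemma rho_mult_vec: "d \<ge> 1 \<Longrightarrow> x \<in> K d \<Longrightarrow> z \<in> K d \<Longrightarrow> v \<in> carrier_vec d \<Longrightarrow>
    rho d (x * z) *\<^sub>v v = rho d x *\<^sub>v (rho d z *\<^sub>v v)"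
  by (simp add: rho_mult assoc_mult_mat_vec[of _ d d _ d])

lemma rho_add_vec: "d \<ge> 1 \<Longrightarrow> x \<in> K d \<Longrightarrow> z \<in> K d \<Longrightarrow> v \<in> carrier_vec d \<Longrightarrow>
    rho d (x + z) *\<^sub>v v = rho d x *\<^sub>v v + rho d z *\<^sub>v v"
  by (simp add: rho_add add_mult_distrib_mat_vec[of _ d d])

lemma rho_scale_vec: "d \<ge> 1 \<Longrightarrow> x \<in> K d \<Longrightarrow> v \<in> carrier_vec d \<Longrightarrow>
    rho d (to_ac c * x) *\<^sub>v v = c \<cdot>\<^sub>v (rho d x *\<^sub>v v)"
  by (intro eq_vecI) (auto simp: rho_scale scalar_prod_def sum_distrib_left mult.assoc intro!: sum.cong)

text \<open>If \<open>H\<close> and \<open>G\<close> agree at \<open>v\<close>, they agree on the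
  whole orbit of \<open>v\<close> under \<open>K d\<close> by \<open>indep_induct\<close>, and that
  orbit contains every vector.\<close>

lemma intertwiners_determined:
  assumes d: "d \<ge> 1" and y: "y \<in> K d" "indep d y"
    and C: "(C :: 'k mat) \<in> carrier_mat n n"
    and H: "H \<in> carrier_mat n d" "C * H = H * rho d y"
    and G: "G \<in> carrier_mat n d" "C * G = G * rho d y"
    and v: "v \<in> carrier_vec d" "v \<noteq> 0\<^sub>v d" "H *\<^sub>v v = G *\<^sub>v v"
  shows "H = G"
proof -
  have *: "H *\<^sub>v (rho d z *\<^sub>v v) = G *\<^sub>v (rho d z *\<^sub>v v)" if "z \<in> K d" for z
    using d y that
  proof (rule indep_induct)
    show "H *\<^sub>v (rho d 1 *\<^sub>v v) = G *\<^sub>v (rho d 1 *\<^sub>v v)" using v d by (simp add: rho_1)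
  next
    fix z assume z: "z \<in> K d" "H *\<^sub>v (rho d z *\<^sub>v v) = G *\<^sub>v (rho d z *\<^sub>v v)"
    have c: "rho d z *\<^sub>v v \<in> carrier_vec d" using v by (intro mult_mat_vec_carrier[of _ d d]) auto
    show "H *\<^sub>v (rho d (y * z) *\<^sub>v v) = G *\<^sub>v (rho d (y * z) *\<^sub>v v)"
      unfolding rho_mult_vec[OF d y(1) z(1) v(1)]
      using intertwine_vec[OF H(2) C H(1) rho_carrier c] intertwine_vec[OF G(2) C G(1) rho_carrier c] z(2) by simp
  next
    fix z w assume z: "z \<in> K d" "w \<in> K d" "H *\<^sub>v (rho d z *\<^sub>v v) = G *\<^sub>v (rho d z *\<^sub>v v)"
      "H *\<^sub>v (rho d w *\<^sub>v v) = G *\<^sub>v (rho d w *\<^sub>v v)"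
    have c: "rho d x *\<^sub>v v \<in> carrier_vec d" for x using v by (intro mult_mat_vec_carrier[of _ d d]) auto
    show "H *\<^sub>v (rho d (z + w) *\<^sub>v v) = G *\<^sub>v (rho d (z + w) *\<^sub>v v)"
      unfolding rho_add_vec[OF d z(1,2) v(1)]
      using mult_add_distrib_mat_vec[OF H(1) c c] mult_add_distrib_mat_vec[OF G(1) c c] z by simp
  next
    fix c z assume z: "z \<in> K d" "H *\<^sub>v (rho d z *\<^sub>v v) = G *\<^sub>v (rho d z *\<^sub>v v)"
    have cc: "rho d x *\<^sub>v v \<in> carrier_vec d" for x using v by (intro mult_mat_vec_carrier[of _ d d]) auto
    show "H *\<^sub>v (rho d (to_ac c * z) *\<^sub>v v) = G *\<^sub>v (rho d (to_ac c * z) *\<^sub>v v)"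
      unfolding rho_scale_vec[OF d z(1) v(1)]
      using mult_mat_vec[OF H(1) cc] mult_mat_vec[OF G(1) cc] z by simp
  qed
  have "H *\<^sub>v w = G *\<^sub>v w" if w: "w \<in> carrier_vec d" for w
    using rho_transitive[OF d v(1,2) w] * by metis
  then have "(H - G) *\<^sub>v w = 0\<^sub>v n" if "w \<in> carrier_vec d" for w
    using minus_mult_distrib_mat_vec[OF H(1) G(1) that] that G by auto
  then have "H - G = 0\<^sub>m n d" by (intro mat_eq_0I) (use H G in auto)
  then show ?thesis using H G
    by (metis (no_types, lifting) add.left_neutral carrier_matD(1,2) index_minus_mat(1) index_zero_mat(1) eq_iff_diff_eq_0 eq_matI)
qed

text \<open>A homomorphism that kills a nonzero vector agrees there with the zero matrix and is
  therefore zero.\<close>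

lemma irreducible_rho:
  assumes "d \<ge> 1" "y \<in> K d" "indep d y"
  shows "irreducible_mat (rho d y)"
  unfolding irreducible_mat_def rho_dim
proof (intro allI impI)
  fix n and C H :: "'k mat"
  assume H: "C \<in> carrier_mat n n" "H \<in> carrier_mat n d" "C * H = H * rho d y"
  have "H = 0\<^sub>m n d" if v: "v \<in> carrier_vec d" "v \<noteq> 0\<^sub>v d" "H *\<^sub>v v = 0\<^sub>v n" for v
  proof (rule intertwiners_determined[OF assms H])
    show "H *\<^sub>v v = 0\<^sub>m n d *\<^sub>v v" using v by auto
  qed (use v H in auto)
  then show "H = 0\<^sub>m n d \<or> inj_mat H"
    using H by (auto simp: inj_mat_def)
qed

text \<open>Injectivity gives \<open>e \<le> d\<close>. Conversely the image is stable under
  \<open>K d\<close> and contains a nonzero vector, so it is the whole space and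
  \<open>d \<le> e\<close>.\<close>

lemma intertwiners_rho_empty:
  assumes d: "d \<ge> 1" "x \<in> K d" "indep d x" and e: "e \<ge> 1" "y \<in> K e" "indep e y" and ne: "d \<noteq> e"
  shows "intertwiners (rho d x) (rho e y) = {}"
proof (rule ccontr)
  assume "\<not> ?thesis"
  then obtain H where H: "H \<in> intertwiners (rho d x) (rho e y)" by blast
  note H = intertwinersD[OF H rho_carrier rho_carrier]
  have "e \<le> d" by (rule inj_mat_card_le[OF finite_UNIV_field H(1,2)])
  define v where "v = (unit_vec e 0 :: 'k vec)"
  have v: "v \<in> carrier_vec e" "v \<noteq> 0\<^sub>v e" using e by (auto simp: v_def)
  define w where "w = H *\<^sub>v v"
  have w: "w \<in> carrier_vec d" "w \<noteq> 0\<^sub>v d"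
    using H v by (auto simp: w_def inj_mat_def)
  have rng: "\<exists>u\<in>carrier_vec e. rho d z *\<^sub>v w = H *\<^sub>v u" if "z \<in> K d" for z
    using d that
  proof (rule indep_induct)
    show "\<exists>u\<in>carrier_vec e. rho d 1 *\<^sub>v w = H *\<^sub>v u" using v w d by (auto simp: rho_1 w_def)
  next
    fix z assume z: "z \<in> K d" "\<exists>u\<in>carrier_vec e. rho d z *\<^sub>v w = H *\<^sub>v u"
    then obtain u where u: "u \<in> carrier_vec e" "rho d z *\<^sub>v w = H *\<^sub>v u" by blast
    have "rho d (x * z) *\<^sub>v w = H *\<^sub>v (rho e y *\<^sub>v u)"
      unfolding rho_mult_vec[OF d(1,2) z(1) w(1)] u(2)
      by (rule intertwine_vec[OF H(3) rho_carrier H(1) rho_carrier u(1), symmetric])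
    moreover have "rho e y *\<^sub>v u \<in> carrier_vec e" using u by (intro mult_mat_vec_carrier[of _ e e]) auto
    ultimately show "\<exists>u\<in>carrier_vec e. rho d (x * z) *\<^sub>v w = H *\<^sub>v u" by blast
  next
    fix z z' assume z: "z \<in> K d" "z' \<in> K d" "\<exists>u\<in>carrier_vec e. rho d z *\<^sub>v w = H *\<^sub>v u"
      "\<exists>u\<in>carrier_vec e. rho d z' *\<^sub>v w = H *\<^sub>v u"
    then obtain u u' where u: "u \<in> carrier_vec e" "rho d z *\<^sub>v w = H *\<^sub>v u"
       "u' \<in> carrier_vec e" "rho d z' *\<^sub>v w = H *\<^sub>v u'" by blast
    have "rho d (z + z') *\<^sub>v w = H *\<^sub>v (u + u')"
      using rho_add_vec[OF d(1) z(1,2) w(1)] mult_add_distrib_mat_vec[OF H(1) u(1,3)] u by simp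
    then show "\<exists>u\<in>carrier_vec e. rho d (z + z') *\<^sub>v w = H *\<^sub>v u" using u by (metis add_carrier_vec)
  next
    fix c z assume z: "z \<in> K d" "\<exists>u\<in>carrier_vec e. rho d z *\<^sub>v w = H *\<^sub>v u"
    then obtain u where u: "u \<in> carrier_vec e" "rho d z *\<^sub>v w = H *\<^sub>v u" by blast
    have "rho d (to_ac c * z) *\<^sub>v w = H *\<^sub>v (c \<cdot>\<^sub>v u)"
      using rho_scale_vec[OF d(1) z(1) w(1)] mult_mat_vec[OF H(1) u(1)] u by simp
    then show "\<exists>u\<in>carrier_vec e. rho d (to_ac c * z) *\<^sub>v w = H *\<^sub>v u" using u by (metis smult_carrier_vec)
  qed
  have "carrier_vec d \<subseteq> (\<lambda>u. H *\<^sub>v u) ` carrier_vec e"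
  proof
    fix w' :: "'k vec" assume "w' \<in> carrier_vec d"
    then obtain z where "z \<in> K d" "w' = rho d z *\<^sub>v w" using rho_transitive[OF d(1) w] by blast
    then show "w' \<in> (\<lambda>u. H *\<^sub>v u) ` carrier_vec e" using rng by blast
  qed
  then have "card (carrier_vec d :: 'k vec set) \<le> card (carrier_vec e :: 'k vec set)"
    using surj_card_le card_carrier_vec[OF finite_UNIV_field] by blast
  then have "d \<le> e"
    using card_carrier_vec[OF finite_UNIV_field] q_ge_2 by (simp add: card_field)
  with \<open>e \<le> d\<close> ne show False by simp
qed

text \<open>An intertwiner is determined by its value at one unit vector, and this value is
  nonzero.\<close>

lemma card_intertwiners_rho:
  assumes d: "d \<ge> 1" and y: "y \<in> K d" "indep d y" and C: "(C :: 'k mat) \<in> carrier_mat d d"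
  shows "card (intertwiners C (rho d y)) \<le> q ^ d - 1"
proof -
  define v where "v = (unit_vec d 0 :: 'k vec)"
  have v: "v \<in> carrier_vec d" "v \<noteq> 0\<^sub>v d" using d by (auto simp: v_def)
  have "card (intertwiners C (rho d y)) \<le> card (carrier_vec d - {0\<^sub>v d} :: 'k vec set)"
  proof (rule card_inj_on_le[where f = "\<lambda>H. H *\<^sub>v v"])
    show "inj_on (\<lambda>H. H *\<^sub>v v) (intertwiners C (rho d y))"
    proof (rule inj_onI)
      fix H G assume H: "H \<in> intertwiners C (rho d y)" and G: "G \<in> intertwiners C (rho d y)"
        and eq: "H *\<^sub>v v = G *\<^sub>v v"
      show "H = G"
        by (rule intertwiners_determined[OF d y C intertwinersD(1,3)[OF H C rho_carrier]
              intertwinersD(1,3)[OF G C rho_carrier] v eq])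
    qed
    show "(\<lambda>H. H *\<^sub>v v) ` intertwiners C (rho d y) \<subseteq> carrier_vec d - {0\<^sub>v d}"
    proof (rule image_subsetI)
      fix H assume H: "H \<in> intertwiners C (rho d y)"
      note H = intertwinersD[OF H C rho_carrier]
      show "H *\<^sub>v v \<in> carrier_vec d - {0\<^sub>v d}" using H v by (auto simp: inj_mat_def)
    qed
  qed (simp add: card_carrier_vec[OF finite_UNIV_field])
  also have "\<dots> = q ^ d - 1"
    using card_carrier_vec[OF finite_UNIV_field, of d] by (simp add: card_Diff_singleton card_field)
  finally show ?thesis .
qed

text \<open>An intertwiner transports polynomial relations: a polynomial vanishing at
  \<open>x\<close> also vanishes at \<open>y\<close>. So the candidates for \<open>y\<close> are
  roots of one nonzero polynomial of degree at most \<open>d\<close>.\<close>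

lemma card_conjugates_le:
  assumes d: "d \<ge> 1" and x: "x \<in> K d"
  shows "card {y \<in> K d. intertwiners (rho d x) (rho d y) \<noteq> {}} \<le> d"
proof -
  \<comment> \<open>There is no room for \<open>d + 1\<close> independent powers in
    \<open>K d\<close>; a dependence among them is the annihilating polynomial.\<close>
  have "\<not> indep (Suc d) x" using indep_le[OF _ x d, of "Suc d"] by auto
  then obtain c where c: "ev c (Suc d) x = 0" "\<exists>i<Suc d. c i \<noteq> 0" by (auto simp: indep_def)
  define P where "P = (\<Sum>i<Suc d. monom (to_ac (c i)) i)"
  have polyP: "poly P z = ev c (Suc d) z" for z
    by (simp add: P_def ev_def poly_sum poly_monom)
  have "coeff P i = to_ac (c i)" if "i < Suc d" for i
  proof -
    have "coeff P i = (\<Sum>j<Suc d. if j = i then to_ac (c j) else 0)"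
      unfolding P_def coeff_sum by (intro sum.cong) auto
    then show ?thesis using that by simp
  qed
  then have P0: "P \<noteq> 0" using c(2) by (metis coeff_0 to_ac_eq_0_iff)
  have "degree P \<le> d" unfolding P_def
    by (intro degree_sum_le) (auto intro: order_trans[OF degree_monom_le])
  then have "card {z. poly P z = 0} \<le> d" using card_poly_roots_bound[OF P0] by simp
  moreover have "finite {z. poly P z = 0}" using P0 by (rule poly_roots_finite)
  moreover have "{y \<in> K d. intertwiners (rho d x) (rho d y) \<noteq> {}} \<subseteq> {z. poly P z = 0}"
  proof
    fix y assume "y \<in> {y \<in> K d. intertwiners (rho d x) (rho d y) \<noteq> {}}"
    then obtain H where y: "y \<in> K d" and H: "H \<in> intertwiners (rho d x) (rho d y)" by blast
    note H = intertwinersD[OF H rho_carrier rho_carrier]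
    have pw: "H * rho d (y ^ i) = rho d (x ^ i) * H" for i
    proof (induction i)
      case 0 then show ?case using H d by (simp add: rho_1)
    next
      case (Suc i)
      have "H * rho d (y ^ Suc i) = (H * rho d (y ^ i)) * rho d y"
        using rho_mult[OF d K_power[OF y] y, of i] H(1) by (simp add: mult.commute assoc_mult_mat[of _ d d _ d _ d])
      also have "\<dots> = rho d (x ^ i) * (rho d x * H)"
        unfolding Suc using H by (simp add: assoc_mult_mat[of _ d d _ d _ d])
      also have "\<dots> = rho d (x ^ Suc i) * H"
        using rho_mult[OF d K_power[OF x] x, of i] H(1) by (simp add: mult.commute assoc_mult_mat[of _ d d _ d _ d])
      finally show ?case .
    qed
    have "H * rho d (ev c n y) = rho d (ev c n x) * H" for n
    proof (induction n)
      case 0 then show ?case using H d by (simp add: ev_def rho_0)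
    next
      case (Suc n)
      have e: "ev c (Suc n) z = ev c n z + to_ac (c n) * z ^ n" for z by (simp add: ev_def)
      have k: "ev c n z \<in> K d" "to_ac (c n) * z ^ n \<in> K d" if "z \<in> K d" for z
        using that by (auto intro: ev_in_K K_mult K_to_ac K_power)
      have s: "H * rho d (to_ac (c n) * y ^ n) = rho d (to_ac (c n) * x ^ n) * H"
        using pw[of n] H(1) rho_scale[OF d K_power[OF y]] rho_scale[OF d K_power[OF x]]
        by (simp add: mult_smult_distrib[of _ d d _ d] mult_smult_assoc_mat[of _ d d _ d])
      show ?case
        unfolding e rho_add[OF d k[OF y]] rho_add[OF d k[OF x]]
        using Suc s mult_add_distrib_mat[OF H(1) rho_carrier rho_carrier]
          add_mult_distrib_mat[OF rho_carrier rho_carrier H(1)] by metis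
    qed
    from this[of "Suc d"] have z: "H * rho d (ev c (Suc d) y) = 0\<^sub>m d d"
      using H c(1) d by (simp add: rho_0)
    \<comment> \<open>Applying the vanishing product to the coordinate vector of 1 and cancelling
      the injective \<open>H\<close> leaves the coordinates of the value of the polynomial at
      \<open>y\<close>.\<close>
    define u where "u = rho d (ev c (Suc d) y) *\<^sub>v cvec d 1"
    have u: "u \<in> carrier_vec d" unfolding u_def by (intro mult_mat_vec_carrier[of _ d d]) auto
    have "H *\<^sub>v u = (H * rho d (ev c (Suc d) y)) *\<^sub>v cvec d 1"
      unfolding u_def using H(1) by (simp add: assoc_mult_mat_vec[of _ d d _ d])
    also have "\<dots> = 0\<^sub>v d" unfolding z by auto
    finally have "u = 0\<^sub>v d" using H u by (auto simp: inj_mat_def)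
    then have u0: "cvec d (ev c (Suc d) y) = 0\<^sub>v d"
      unfolding u_def using rho_cvec[OF d ev_in_K[OF y] K_1] by simp
    have "coord d (ev c (Suc d) y) i = 0" if "i < d" for i
      using arg_cong[OF u0, of "\<lambda>v. vec_index v i"] that by (simp add: cvec_def)
    then have "ev c (Suc d) y = 0"
      using ev_coord[OF d ev_in_K[OF y, of c "Suc d"]] by (simp add: ev_def[of "coord d _"])
    then show "y \<in> {z. poly P z = 0}" using polyP by simp
  qed
  ultimately show ?thesis by (meson card_mono order_trans)
qed

end

section \<open>Equidistribution of traces of powers in a finite field\<close>

lemma mat_trace_add:
  "A \<in> carrier_mat n n \<Longrightarrow> B \<in> carrier_mat n n \<Longrightarrow> mat_trace (A + B) = mat_trace A + mat_trace B"
  by (auto simp: mat_trace_def sum.distrib)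

lemma mat_trace_smult: "A \<in> carrier_mat n n \<Longrightarrow> mat_trace (c \<cdot>\<^sub>m A) = c * mat_trace A"
  for c :: "'a :: comm_semiring_0"
  by (auto simp: mat_trace_def sum_distrib_left)

context finite_field
begin

text \<open>The field trace of \<open>K d\<close> over the base field, as the trace of the
  multiplication matrix.\<close>

definition tr :: "nat \<Rightarrow> 'k alg_closure \<Rightarrow> 'k" where
  "tr d x = mat_trace (rho d x)"

lemma tr_add: "d \<ge> 1 \<Longrightarrow> x \<in> K d \<Longrightarrow> y \<in> K d \<Longrightarrow> tr d (x + y) = tr d x + tr d y"
  by (simp add: tr_def rho_add mat_trace_add[of _ d])

lemma tr_scale: "d \<ge> 1 \<Longrightarrow> x \<in> K d \<Longrightarrow> tr d (to_ac c * x) = c * tr d x"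
  by (simp add: tr_def rho_scale mat_trace_smult[of _ d])

lemma tr_1: "d \<ge> 1 \<Longrightarrow> tr d 1 = of_nat d"
  by (simp add: tr_def rho_1 mat_trace_def)

lemma tr_diff: "d \<ge> 1 \<Longrightarrow> x \<in> K d \<Longrightarrow> y \<in> K d \<Longrightarrow> tr d (x - y) = tr d x - tr d y"
  using tr_add[of d "x - y" y] K_diff[of x d y] by simp

text \<open>As \<open>p\<close> does not divide \<open>d\<close>, the scalar
  \<open>c / of_nat d\<close> has trace \<open>c\<close>. Translation by it identifies all fibres
  with the kernel, so surjectivity of the trace needs no Galois theory.\<close>

lemma card_tr_fibre:
  assumes d: "d \<ge> 1" "\<not> p dvd d"
  shows "card {a \<in> K d. tr d a = c} = q ^ (d - 1)"
proof -
  have d0: "of_nat d \<noteq> (0 :: 'k)"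
    using d CHAR_field by (simp add: of_nat_eq_0_iff_char_dvd)
  have eq: "card {a \<in> K d. tr d a = c} = card {a \<in> K d. tr d a = 0}" for c
  proof (rule bij_betw_same_card, rule bij_betwI)
    let ?s = "to_ac (c / of_nat d)"
    have s: "?s \<in> K d" "tr d ?s = c"
      using tr_scale[OF d(1) K_1, of "c / of_nat d"] d0 d(1) by (simp_all add: K_to_ac tr_1 flip: to_ac_divide to_ac_of_nat)
    show "(\<lambda>a. a - ?s) \<in> {a \<in> K d. tr d a = c} \<rightarrow> {a \<in> K d. tr d a = 0}"
      using s tr_diff[OF d(1)] K_diff by auto
    show "(\<lambda>a. a + ?s) \<in> {a \<in> K d. tr d a = 0} \<rightarrow> {a \<in> K d. tr d a = c}"
      using s tr_add[OF d(1)] K_add by auto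
  qed auto
  have "K d = (\<Union>c\<in>UNIV. {a \<in> K d. tr d a = c})" by auto
  then have "card (K d) = card (\<Union>c\<in>UNIV. {a \<in> K d. tr d a = c})" by simp
  also have "\<dots> = (\<Sum>c\<in>UNIV. card {a \<in> K d. tr d a = c})"
    using finite_K[OF d(1)] finite_UNIV_field by (subst card_UN_disjoint) auto
  also have "\<dots> = q * card {a \<in> K d. tr d a = 0}"
    by (subst sum.cong[OF refl eq]) (simp add: card_field)
  finally have "q * card {a \<in> K d. tr d a = 0} = q * q ^ (d - 1)"
    using card_K[OF d(1)] d(1) by (auto simp: power_eq_if[of q d])
  then have "card {a \<in> K d. tr d a = 0} = q ^ (d - 1)" using q_ge_2 by simp
  then show ?thesis using eq[of c] by simp
qed

lemma card_tr_mult_zero: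
  assumes d: "d \<ge> 1" "\<not> p dvd d" and z: "z \<in> K d" "z \<noteq> 0"
  shows "card {a \<in> K d. tr d (a * z) = 0} = q ^ (d - 1)"
proof -
  have "card {a \<in> K d. tr d (a * z) = 0} = card {a \<in> K d. tr d a = 0}"
  proof (rule bij_betw_same_card, rule bij_betwI)
    show "(\<lambda>a. a * z) \<in> {a \<in> K d. tr d (a * z) = 0} \<rightarrow> {a \<in> K d. tr d a = 0}"
      using z K_mult by auto
    show "(\<lambda>a. a / z) \<in> {a \<in> K d. tr d a = 0} \<rightarrow> {a \<in> K d. tr d (a * z) = 0}"
      using z K_divide by auto
  qed (use z in auto)
  then show ?thesis using card_tr_fibre[OF d] by simp
qed

text \<open>The quotient \<open>u = t / s\<close> satisfies \<open>u ^ r = 1\<close> and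
  \<open>u ^ (q ^ d - 1) = 1\<close>, hence by Bezout \<open>u ^ g = 1\<close> for the gcd
  \<open>g\<close>, an equation with at most \<open>g\<close> solutions.\<close>

lemma card_power_fibre:
  assumes d: "d \<ge> 1" and r: "r > 0" and s: "s \<in> K d" "s \<noteq> 0"
  shows "card {t \<in> K d - {0}. t ^ r = s ^ r} \<le> gcd r (q ^ d - 1)"
proof -
  define g where "g = gcd r (q ^ d - 1)"
  have g: "g > 0" using r by (simp add: g_def)
  define P :: "'k alg_closure poly" where "P = monom 1 g - 1"
  have "degree P = g"
    using degree_add_eq_left[of "- 1" "monom (1 :: 'k alg_closure) g"] g
    by (simp add: P_def degree_monom_eq)
  then have P0: "P \<noteq> 0" using g by auto
  have fin: "finite {u. poly P u = 0}" using P0 by (rule poly_roots_finite)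
  have "card {t \<in> K d - {0}. t ^ r = s ^ r} \<le> card {u. poly P u = 0}"
  proof (rule card_inj_on_le[where f = "\<lambda>t. t / s"])
    show "inj_on (\<lambda>t. t / s) {t \<in> K d - {0}. t ^ r = s ^ r}" using s by (auto simp: inj_on_def)
    show "(\<lambda>t. t / s) ` {t \<in> K d - {0}. t ^ r = s ^ r} \<subseteq> {u. poly P u = 0}"
    proof (rule image_subsetI)
      fix t assume "t \<in> {t \<in> K d - {0}. t ^ r = s ^ r}"
      then have t: "t \<in> K d" "t \<noteq> 0" "t ^ r = s ^ r" by auto
      define u where "u = t / s"
      have u: "u \<in> K d" "u \<noteq> 0" using t s K_divide by (auto simp: u_def)
      have ur: "u ^ r = 1" using t s by (simp add: u_def power_divide)
      have "Suc (q ^ d - 1) = q ^ d" using q_power_gt_1[OF d] by simp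
      then have "u ^ Suc (q ^ d - 1) = u"
        using u(1) by (simp only: K_def mem_Collect_eq)
      then have uq: "u ^ (q ^ d - 1) = 1" using u(2) by simp
      obtain x y where "r * x = (q ^ d - 1) * y + g"
        using bezout_nat[of r "q ^ d - 1"] r by (auto simp: g_def)
      then have "u ^ (r * x) = u ^ ((q ^ d - 1) * y) * u ^ g" by (simp add: power_add)
      then have "u ^ g = 1" using ur uq by (simp add: power_mult)
      then show "t / s \<in> {u. poly P u = 0}" by (simp add: P_def u_def poly_monom)
    qed
  qed (rule fin)
  also have "\<dots> \<le> g" using card_poly_roots_bound[OF P0] \<open>degree P = g\<close> by simp
  finally show ?thesis by (simp add: g_def)
qed

text \<open>Both sides count pairs of points with the same value, which turns the square norm of a
  distribution into a collision count.\<close>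

lemma sum_card_fibres_squared:
  assumes "finite T" "finite (UNIV :: 'k set)"
  shows "(\<Sum>c\<in>(UNIV :: 'k set). real (card {t \<in> T. f t = c}) ^ 2) = (\<Sum>t\<in>T. \<Sum>t'\<in>T. if f t = f t' then 1 else 0)"
proof -
  have "(\<Sum>t\<in>T. \<Sum>t'\<in>T. if f t = f t' then 1 else 0 :: real) =
     (\<Sum>t\<in>T. \<Sum>t'\<in>T. \<Sum>c\<in>(UNIV :: 'k set). (if f t = c then 1 else 0) * (if f t' = c then 1 else 0))"
  proof (intro sum.cong refl)
    fix t t'
    have "(\<Sum>c\<in>(UNIV :: 'k set). (if f t = c then 1 else 0) * (if f t' = c then 1 else 0 :: real)) =
      (\<Sum>c\<in>UNIV. if f t = c then (if f t' = c then 1 else 0) else 0)"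
      by (intro sum.cong) auto
    also have "\<dots> = (if f t' = f t then 1 else 0)" using assms by simp
    finally show "(if f t = f t' then 1 else 0 :: real) = (\<Sum>c\<in>(UNIV :: 'k set). (if f t = c then 1 else 0) * (if f t' = c then 1 else 0))"
      by auto
  qed
  also have "\<dots> = (\<Sum>t\<in>T. \<Sum>c\<in>(UNIV :: 'k set). \<Sum>t'\<in>T. (if f t = c then 1 else 0) * (if f t' = c then 1 else 0))"
    by (intro sum.cong refl sum.swap)
  also have "\<dots> = (\<Sum>c\<in>(UNIV :: 'k set). \<Sum>t\<in>T. \<Sum>t'\<in>T. (if f t = c then 1 else 0) * (if f t' = c then 1 else 0))"
    by (rule sum.swap)
  also have "\<dots> = (\<Sum>c\<in>(UNIV :: 'k set). (\<Sum>t\<in>T. if f t = c then 1 else 0) * (\<Sum>t'\<in>T. if f t' = c then 1 else 0))"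
    by (simp add: sum_product)
  also have "\<dots> = (\<Sum>c\<in>(UNIV :: 'k set). real (card {t \<in> T. f t = c}) ^ 2)"
  proof (intro sum.cong refl)
    fix c :: 'k
    have "(\<Sum>t\<in>T. if f t = c then 1 else 0) = real (card {t \<in> T. f t = c})"
      using sum.inter_filter[OF assms(1), of "\<lambda>_. 1 :: real" "\<lambda>t. f t = c"] by simp
    then show "(\<Sum>t\<in>T. if f t = c then 1 else 0) * (\<Sum>t'\<in>T. if f t' = c then 1 else 0) = real (card {t \<in> T. f t = c}) ^ 2"
      by (simp add: power2_eq_square)
  qed
  finally show ?thesis by simp
qed

text \<open>
  An elementary Gauss sum bound: the deviation is averaged over all twists \<open>tr (a t\<^sup>r)\<close>, and
  the twists by \<open>r\<close>-th powers \<open>a\<close> all have the same distribution as the one with \<open>a = 1\<close>.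
\<close>

lemma tr_power_equidistributed:
  assumes d: "d \<ge> 1" "\<not> p dvd d" and r: "r > 0"
  shows "(\<Sum>c\<in>UNIV. (real (card {t \<in> K d - {0}. tr d (t ^ r) = c}) - (real q ^ d - 1) / real q) ^ 2)
    \<le> real (gcd r (q ^ d - 1)) ^ 2 * real q ^ d"
proof -
  define T where "T = K d - {0}"
  define \<tau> where "\<tau> = real q ^ d - 1"
  define g where "g = gcd r (q ^ d - 1)"
  define N where "N a c = real (card {t \<in> T. tr d (a * t ^ r) = c})" for a c
  define D where "D a = (\<Sum>c\<in>UNIV. (N a c - \<tau> / q) ^ 2)" for a
  define E where "E = (\<lambda>t t' :: 'k alg_closure. if t ^ r = t' ^ r then 1 else 0 :: real)"
  have q0: "real q > 0" using q_ge_2 by simp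
  have finT: "finite T" using finite_K[OF d(1)] by (simp add: T_def)
  have cardT: "real (card T) = \<tau>"
    using card_K[OF d(1)] q_power_gt_1[OF d(1)] K_0 finite_K[OF d(1)]
    by (simp add: T_def \<tau>_def card_Diff_singleton of_nat_diff)
  have \<tau>0: "\<tau> > 0" using q_power_gt_1[OF d(1)] by (simp add: \<tau>_def flip: of_nat_power)
  have sumN: "(\<Sum>c\<in>UNIV. N a c) = \<tau>" for a
  proof -
    have "T = (\<Union>c\<in>UNIV. {t \<in> T. tr d (a * t ^ r) = c})" by auto
    then have "card T = card (\<Union>c\<in>UNIV. {t \<in> T. tr d (a * t ^ r) = c})" by simp
    also have "\<dots> = (\<Sum>c\<in>UNIV. card {t \<in> T. tr d (a * t ^ r) = c})"
      using finT finite_UNIV_field by (subst card_UN_disjoint) auto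
    finally show ?thesis using cardT by (simp add: N_def)
  qed
  have Deq: "D a = (\<Sum>c\<in>UNIV. N a c ^ 2) - \<tau>\<^sup>2 / q" for a
  proof -
    have "D a = (\<Sum>c\<in>UNIV. N a c ^ 2 - 2 * (\<tau> / q) * N a c + (\<tau> / q)\<^sup>2)"
      unfolding D_def by (simp add: power2_diff algebra_simps)
    also have "\<dots> = (\<Sum>c\<in>UNIV. N a c ^ 2) - 2 * (\<tau> / q) * \<tau> + q * (\<tau> / q)\<^sup>2"
      unfolding sum.distrib sum_subtractf sum_distrib_left[symmetric] sumN by (simp add: card_field)
    also have "\<dots> = (\<Sum>c\<in>UNIV. N a c ^ 2) - \<tau>\<^sup>2 / q"
      using q0 by (simp add: field_simps power2_eq_square)
    finally show ?thesis .
  qed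
  \<comment> \<open>If \<open>t\<close> and \<open>t'\<close> have the same \<open>r\<close>-th
    power, every twist \<open>a\<close> collides. Otherwise the colliding twists are the kernel of a
    nonzero trace form.\<close>
  have cnt: "(\<Sum>a\<in>K d. if tr d (a * t ^ r) = tr d (a * t' ^ r) then 1 else 0 :: real)
      \<le> real q ^ (d - 1) + real q ^ d * E t t'" if "t \<in> T" "t' \<in> T" for t t'
  proof -
    have t: "t \<in> K d" "t' \<in> K d" using that by (auto simp: T_def)
    have "(\<Sum>a\<in>K d. if tr d (a * t ^ r) = tr d (a * t' ^ r) then 1 else 0 :: real) =
       real (card {a \<in> K d. tr d (a * t ^ r) = tr d (a * t' ^ r)})"
      using sum.inter_filter[OF finite_K[OF d(1)], of "\<lambda>_. 1 :: real" "\<lambda>a. tr d (a * t ^ r) = tr d (a * t' ^ r)"] by simp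
    also have "{a \<in> K d. tr d (a * t ^ r) = tr d (a * t' ^ r)} = {a \<in> K d. tr d (a * (t ^ r - t' ^ r)) = 0}"
      using t by (auto simp: right_diff_distrib tr_diff[OF d(1)] K_mult K_power)
    also have "real (card \<dots>) \<le> real q ^ (d - 1) + real q ^ d * E t t'"
    proof (cases "t ^ r = t' ^ r")
      case True
      have "card {a \<in> K d. tr d (a * (t ^ r - t' ^ r)) = 0} \<le> card (K d)"
        by (intro card_mono finite_K d) auto
      then have "real (card {a \<in> K d. tr d (a * (t ^ r - t' ^ r)) = 0}) \<le> real q ^ d"
        using card_K[OF d(1)] by (metis of_nat_le_iff of_nat_power)
      then show ?thesis using True by (simp add: E_def add_increasing)
    next
      case False
      then show ?thesis
        using card_tr_mult_zero[OF d, of "t ^ r - t' ^ r"] t by (simp add: E_def K_diff K_power)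
    qed
    finally show ?thesis .
  qed
  have sumE: "(\<Sum>t'\<in>T. E t t') \<le> g" if "t \<in> T" for t
  proof -
    have "(\<Sum>t'\<in>T. E t t') = real (card {t' \<in> T. t ^ r = t' ^ r})"
      using sum.inter_filter[OF finT, of "\<lambda>_. 1 :: real" "\<lambda>t'. t ^ r = t' ^ r"] by (simp add: E_def)
    also have "{t' \<in> T. t ^ r = t' ^ r} = {t' \<in> K d - {0}. t' ^ r = t ^ r}" by (auto simp: T_def)
    also have "real (card \<dots>) \<le> g"
      using card_power_fibre[OF d(1) r, of t] that by (simp add: T_def g_def)
    finally show ?thesis .
  qed
  have "(\<Sum>a\<in>K d. \<Sum>c\<in>UNIV. N a c ^ 2) =
     (\<Sum>a\<in>K d. \<Sum>t\<in>T. \<Sum>t'\<in>T. if tr d (a * t ^ r) = tr d (a * t' ^ r) then 1 else 0)"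
    unfolding N_def by (intro sum.cong refl sum_card_fibres_squared finT finite_UNIV_field)
  also have "\<dots> = (\<Sum>t\<in>T. \<Sum>a\<in>K d. \<Sum>t'\<in>T. if tr d (a * t ^ r) = tr d (a * t' ^ r) then 1 else 0)"
    by (rule sum.swap)
  also have "\<dots> = (\<Sum>t\<in>T. \<Sum>t'\<in>T. \<Sum>a\<in>K d. if tr d (a * t ^ r) = tr d (a * t' ^ r) then 1 else 0)"
    by (intro sum.cong refl sum.swap)
  also have "\<dots> \<le> (\<Sum>t\<in>T. \<Sum>t'\<in>T. real q ^ (d - 1) + real q ^ d * E t t')"
    by (intro sum_mono cnt)
  also have "\<dots> = (\<Sum>t\<in>T. \<tau> * real q ^ (d - 1) + real q ^ d * (\<Sum>t'\<in>T. E t t'))"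
    by (simp add: sum.distrib cardT flip: sum_distrib_left)
  also have "\<dots> \<le> (\<Sum>t\<in>T. \<tau> * real q ^ (d - 1) + real q ^ d * g)"
    by (intro sum_mono add_left_mono mult_left_mono sumE) auto
  also have "\<dots> = \<tau> * (\<tau> * real q ^ (d - 1) + real q ^ d * g)"
    by (simp add: cardT)
  finally have S: "(\<Sum>a\<in>K d. \<Sum>c\<in>UNIV. N a c ^ 2) \<le> \<tau> * (\<tau> * real q ^ (d - 1) + real q ^ d * g)" .
  have qd: "real q ^ d = real q * real q ^ (d - 1)" using d(1) by (simp add: power_eq_if[of _ d])
  have "(\<Sum>a\<in>K d. D a) = (\<Sum>a\<in>K d. \<Sum>c\<in>UNIV. N a c ^ 2) - real q ^ d * (\<tau>\<^sup>2 / q)"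
    by (simp add: Deq sum_subtractf card_K[OF d(1)])
  also have "real q ^ d * (\<tau>\<^sup>2 / q) = \<tau>\<^sup>2 * real q ^ (d - 1)"
    using q0 unfolding qd by simp
  \<comment> \<open>The main terms cancel exactly; only the pairs with equal \<open>r\<close>-th
    powers survive.\<close>
  finally have SD: "(\<Sum>a\<in>K d. D a) \<le> \<tau> * (real q ^ d * g)"
    using S by (simp add: algebra_simps power2_eq_square)
  have D0: "D a \<ge> 0" for a unfolding D_def by (intro sum_nonneg) auto
  define R where "R = (\<lambda>s. s ^ r) ` T"
  have RK: "R \<subseteq> K d" by (auto simp: R_def T_def K_power)
  have finR: "finite R" using finT by (simp add: R_def)
  \<comment> \<open>For \<open>a = s ^ r\<close> the substitution of \<open>s * t\<close> for
    \<open>t\<close> absorbs the twist.\<close>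
  have DR: "D a = D 1" if aR: "a \<in> R" for a
  proof -
    obtain s where s: "s \<in> K d" "s \<noteq> 0" "a = s ^ r" using aR by (auto simp: R_def T_def)
    have "N a c = N 1 c" for c
    proof -
      have "card {t \<in> T. tr d (a * t ^ r) = c} = card {t \<in> T. tr d (1 * t ^ r) = c}"
      proof (rule bij_betw_same_card, rule bij_betwI)
        show "(\<lambda>t. s * t) \<in> {t \<in> T. tr d (a * t ^ r) = c} \<rightarrow> {t \<in> T. tr d (1 * t ^ r) = c}"
          using s by (auto simp: T_def K_mult power_mult_distrib)
        show "(\<lambda>t. t / s) \<in> {t \<in> T. tr d (1 * t ^ r) = c} \<rightarrow> {t \<in> T. tr d (a * t ^ r) = c}"
          using s by (auto simp: T_def K_divide power_divide)
      qed (use s in auto)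
      then show ?thesis by (simp add: N_def)
    qed
    then show ?thesis by (simp add: D_def)
  qed
  have cardR: "\<tau> \<le> g * card R"
  proof -
    have "T = (\<Union>a\<in>R. {t \<in> T. t ^ r = a})" by (auto simp: R_def)
    then have "card T = card (\<Union>a\<in>R. {t \<in> T. t ^ r = a})" by simp
    also have "\<dots> \<le> (\<Sum>a\<in>R. card {t \<in> T. t ^ r = a})" by (rule card_UN_le[OF finR])
    also have "\<dots> \<le> (\<Sum>a\<in>R. g)"
    proof (rule sum_mono)
      fix a assume "a \<in> R"
      then obtain s where s: "s \<in> K d" "s \<noteq> 0" "a = s ^ r" by (auto simp: R_def T_def)
      show "card {t \<in> T. t ^ r = a} \<le> g"
        using card_power_fibre[OF d(1) r s(1,2)] s(3) by (simp add: T_def g_def)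
    qed
    finally have "card T \<le> g * card R" by (simp add: mult.commute)
    then show ?thesis unfolding cardT[symmetric] by (metis of_nat_le_iff of_nat_mult)
  qed
  \<comment> \<open>At least \<open>\<tau> / g\<close> twists have the same deviation as
    \<open>a = 1\<close>, so the bound on the total becomes a bound on \<open>D 1\<close> at the
    cost of one more factor \<open>g\<close>.\<close>
  have "card R * D 1 = (\<Sum>a\<in>R. D a)" using DR by simp
  also have "\<dots> \<le> (\<Sum>a\<in>K d. D a)" by (intro sum_mono2 finite_K d RK D0)
  finally have "card R * D 1 \<le> \<tau> * (real q ^ d * g)" using SD by simp
  then have "g * (card R * D 1) \<le> g * (\<tau> * (real q ^ d * g))" by (intro mult_left_mono) auto
  moreover have "\<tau> * D 1 \<le> g * card R * D 1" using cardR D0 by (intro mult_right_mono) auto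
  ultimately have "\<tau> * D 1 \<le> \<tau> * (real g ^ 2 * real q ^ d)"
    by (simp add: power2_eq_square mult_ac)
  then have "D 1 \<le> real g ^ 2 * real q ^ d" using \<tau>0 by simp
  then show ?thesis by (simp add: D_def N_def T_def g_def \<tau>_def)
qed

text \<open>The generators of \<open>K d\<close>. Since 0 satisfies \<open>indep 1\<close>,
  nonvanishing is demanded separately; it makes \<open>rho d x\<close> invertible.\<close>

definition gens :: "nat \<Rightarrow> 'k alg_closure set" where
  "gens d = {x \<in> K d. x \<noteq> 0 \<and> indep d x}"

lemma q_power_half_le: "real q ^ (d div 2) \<le> sqrt (real q ^ d)"
proof (rule real_le_rsqrt)
  have "(real q ^ (d div 2))\<^sup>2 = real q ^ (2 * (d div 2))" by (simp add: mult.commute flip: power_mult)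
  also have "\<dots> \<le> real q ^ d" using q_ge_2 by (intro power_increasing) auto
  finally show "(real q ^ (d div 2))\<^sup>2 \<le> real q ^ d" .
qed

text \<open>A single fibre deviates by at most the square norm of the deviation. Discarding the
  non-generators changes it by at most \<open>2 * q ^ (d div 2)\<close>, which is of the same
  order.\<close>

lemma gens_count:
  assumes d: "d \<ge> 1" "\<not> p dvd d" and r: "r > 0"
  shows "\<bar>real (card {x \<in> gens d. mat_trace (rho d x ^\<^sub>m r) = c}) - (real q ^ d - 1) / real q\<bar>
    \<le> (real (gcd r (q ^ d - 1)) + 2) * sqrt (real q ^ d)"
proof -
  define N where "N c = real (card {t \<in> K d - {0}. tr d (t ^ r) = c})" for c
  define M where "M = (real q ^ d - 1) / real q"
  define g where "g = real (gcd r (q ^ d - 1))"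
  have "(N c - M) ^ 2 \<le> (\<Sum>c\<in>UNIV. (N c - M) ^ 2)"
    using finite_UNIV_field by (intro member_le_sum) auto
  also have "\<dots> \<le> g ^ 2 * real q ^ d"
    using tr_power_equidistributed[OF d r] by (simp add: N_def M_def g_def)
  also have "\<dots> = (g * sqrt (real q ^ d)) ^ 2"
    by (simp add: power_mult_distrib)
  finally have "\<bar>N c - M\<bar>\<^sup>2 \<le> (g * sqrt (real q ^ d))\<^sup>2" by simp
  then have 1: "\<bar>N c - M\<bar> \<le> g * sqrt (real q ^ d)"
    by (rule power2_le_imp_le) (simp add: g_def)
  have eq: "{x \<in> gens d. mat_trace (rho d x ^\<^sub>m r) = c} = {t \<in> K d - {0}. tr d (t ^ r) = c} - {x \<in> K d. \<not> indep d x}"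
    using d(1) by (auto simp: gens_def tr_def rho_power)
  have fin: "finite {t \<in> K d - {0}. tr d (t ^ r) = c}" "finite {x \<in> K d. \<not> indep d x}"
    using finite_K[OF d(1)] by auto
  have "card {x \<in> gens d. mat_trace (rho d x ^\<^sub>m r) = c} \<le> card {t \<in> K d - {0}. tr d (t ^ r) = c}"
    unfolding eq using fin by (intro card_mono) auto
  moreover have "card {t \<in> K d - {0}. tr d (t ^ r) = c} - card {x \<in> K d. \<not> indep d x} \<le> card {x \<in> gens d. mat_trace (rho d x ^\<^sub>m r) = c}"
    unfolding eq using fin by (intro diff_card_le_card_Diff)
  ultimately have "\<bar>real (card {x \<in> gens d. mat_trace (rho d x ^\<^sub>m r) = c}) - N c\<bar> \<le> real (card {x \<in> K d. \<not> indep d x})"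
    unfolding N_def by linarith
  also have "\<dots> \<le> 2 * real q ^ (d div 2)"
    using card_dependent[OF d(1)] by (metis (mono_tags, lifting) of_nat_le_iff of_nat_mult of_nat_numeral of_nat_power)
  also have "real q ^ (d div 2) \<le> sqrt (real q ^ d)"
    by (rule q_power_half_le)
  finally show ?thesis using 1 unfolding M_def g_def by (simp add: algebra_simps)
qed

lemma finite_gens: "d \<ge> 1 \<Longrightarrow> finite (gens d)"
  using finite_K by (auto simp: gens_def)

lemma card_gens_le: "d \<ge> 1 \<Longrightarrow> real (card (gens d)) \<le> real q ^ d - 1"
proof -
  assume d: "d \<ge> 1"
  have "card (gens d) \<le> card (K d - {0})"
    using finite_K[OF d] by (intro card_mono) (auto simp: gens_def)
  then have "real (card (gens d)) \<le> real (q ^ d - 1)"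
    using card_K[OF d] K_0 finite_K[OF d] by (simp add: card_Diff_singleton)
  then show ?thesis using q_power_gt_1[OF d] by (simp add: of_nat_diff)
qed

lemma card_gens_ge: "d \<ge> 1 \<Longrightarrow> real (card (gens d)) \<ge> real q ^ d - 1 - 2 * sqrt (real q ^ d)"
proof -
  assume d: "d \<ge> 1"
  have "gens d = (K d - {0}) - {x \<in> K d. \<not> indep d x}" by (auto simp: gens_def)
  then have "card (K d - {0}) - card {x \<in> K d. \<not> indep d x} \<le> card (gens d)"
    using finite_K[OF d] by (metis (no_types, lifting) diff_card_le_card_Diff finite_subset mem_Collect_eq subsetI)
  moreover have "card (K d - {0}) = q ^ d - 1"
    using card_K[OF d] K_0 finite_K[OF d] by (simp add: card_Diff_singleton)
  ultimately have "real (q ^ d - 1) - 2 * real (q ^ (d div 2)) \<le> real (card (gens d))"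
    using card_dependent[OF d] by linarith
  moreover have "real (q ^ d - 1) = real q ^ d - 1" using q_power_gt_1[OF d] by (simp add: of_nat_diff)
  moreover have "real q ^ (d div 2) \<le> sqrt (real q ^ d)"
    by (rule q_power_half_le)
  ultimately show ?thesis by simp
qed

text \<open>Only the at most \<open>d\<close> conjugates of \<open>x\<close> contribute, each with
  at most \<open>q ^ d - 1\<close> intertwiners.\<close>

lemma sum_card_intertwiners_gens:
  assumes d: "d \<ge> 1" and x: "x \<in> gens d"
  shows "(\<Sum>y\<in>gens d. real (card (intertwiners (rho d x) (rho d y)))) \<le> d * (real q ^ d - 1)"
proof -
  let ?B = "{y \<in> gens d. intertwiners (rho d x) (rho d y) \<noteq> {}}"
  have xK: "x \<in> K d" using x by (simp add: gens_def)
  have "(\<Sum>y\<in>gens d. real (card (intertwiners (rho d x) (rho d y)))) = (\<Sum>y\<in>?B. real (card (intertwiners (rho d x) (rho d y))))"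
    using finite_gens[OF d] by (intro sum.mono_neutral_right) auto
  also have "\<dots> \<le> (\<Sum>y\<in>?B. real (q ^ d - 1))"
    using card_intertwiners_rho[OF d] by (intro sum_mono of_nat_mono) (auto simp: gens_def)
  also have "\<dots> = card ?B * (real q ^ d - 1)" using q_power_gt_1[OF d] by (simp add: of_nat_diff)
  also have "\<dots> \<le> d * (real q ^ d - 1)"
  proof (rule mult_right_mono)
    have "card ?B \<le> card {y \<in> K d. intertwiners (rho d x) (rho d y) \<noteq> {}}"
      using finite_K[OF d] by (intro card_mono) (auto simp: gens_def)
    then show "real (card ?B) \<le> real d" using card_conjugates_le[OF d xK] by simp
    show "0 \<le> real q ^ d - 1" using q_power_gt_1[OF d] by (simp flip: of_nat_power)
  qed
  finally show ?thesis .
qed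

end

section \<open>The trace of a random matrix over a finite field\<close>

lemma mat_trace_mult_commute:
  fixes A B :: "'a :: comm_semiring_0 mat"
  assumes "A \<in> carrier_mat n m" "B \<in> carrier_mat m n"
  shows "mat_trace (A * B) = mat_trace (B * A)"
proof -
  have "mat_trace (A * B) = (\<Sum>i<n. \<Sum>j<m. A $$ (i, j) * B $$ (j, i))"
    using assms by (auto simp: mat_trace_def scalar_prod_def lessThan_atLeast0 intro!: sum.cong)
  also have "\<dots> = (\<Sum>j<m. \<Sum>i<n. B $$ (j, i) * A $$ (i, j))"
    by (subst sum.swap) (simp add: mult.commute)
  also have "\<dots> = mat_trace (B * A)"
    using assms by (auto simp: mat_trace_def scalar_prod_def lessThan_atLeast0 intro!: sum.cong)
  finally show ?thesis .
qed

lemma conj_pow_mat: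
  fixes A :: "'a :: field mat"
  assumes "A \<in> carrier_mat n n" "g \<in> carrier_mat n n" "g' \<in> carrier_mat n n" "g' * g = 1\<^sub>m n" "g * g' = 1\<^sub>m n"
  shows "(g * A * g') ^\<^sub>m r = g * (A ^\<^sub>m r) * g'"
proof (induction r)
  case 0
  then show ?case using assms by simp
next
  case (Suc r)
  note as = assoc_mult_mat[of _ n n _ n _ n]
  have c: "A ^\<^sub>m r \<in> carrier_mat n n" using assms by simp
  have mid: "g * B * g' * (g * A * g') = g * B * (g' * g) * A * g'" if "B \<in> carrier_mat n n" for B
    using assms(1-3) that by (simp add: as)
  have "(g * A * g') ^\<^sub>m Suc r = g * (A ^\<^sub>m r) * g' * (g * A * g')" using Suc by simp
  also have "\<dots> = g * (A ^\<^sub>m r) * (g' * g) * A * g'" by (rule mid[OF c])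
  also have "\<dots> = g * (A ^\<^sub>m Suc r) * g'" using assms c by (simp add: as)
  finally show ?case .
qed

text \<open>This makes the indicator of a value of the trace a class function, as
  \<open>average_intertwiners\<close> requires.\<close>

lemma mat_trace_pow_conj:
  fixes A :: "'a :: field mat"
  assumes "A \<in> carrier_mat n n" "g \<in> carrier_mat n n" "g' \<in> carrier_mat n n" "g' * g = 1\<^sub>m n" "g * g' = 1\<^sub>m n"
  shows "mat_trace ((g * A * g') ^\<^sub>m r) = mat_trace (A ^\<^sub>m r)"
proof -
  have c: "A ^\<^sub>m r \<in> carrier_mat n n" using assms by simp
  have "mat_trace ((g * A * g') ^\<^sub>m r) = mat_trace (g * (A ^\<^sub>m r * g'))"
    using conj_pow_mat[OF assms] assms c by (simp add: assoc_mult_mat[of _ n n _ n _ n])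
  also have "\<dots> = mat_trace (A ^\<^sub>m r * g' * g)" by (rule mat_trace_mult_commute) (use assms c in auto)
  also have "\<dots> = mat_trace (A ^\<^sub>m r)" using assms c by (simp add: assoc_mult_mat[of _ n n _ n _ n])
  finally show ?thesis .
qed

lemma pow_block_triangular:
  fixes y :: "'a :: field mat"
  assumes "y \<in> carrier_mat d d" "u \<in> carrier_mat d m" "C \<in> carrier_mat m m"
  shows "\<exists>w \<in> carrier_mat d m. four_block_mat y u (0\<^sub>m m d) C ^\<^sub>m r = four_block_mat (y ^\<^sub>m r) w (0\<^sub>m m d) (C ^\<^sub>m r)"
proof (induction r)
  case 0
  then show ?case using assms by (intro bexI[of _ "0\<^sub>m d m"]) auto
next
  case (Suc r)
  then obtain w where w: "w \<in> carrier_mat d m"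
    "four_block_mat y u (0\<^sub>m m d) C ^\<^sub>m r = four_block_mat (y ^\<^sub>m r) w (0\<^sub>m m d) (C ^\<^sub>m r)" by blast
  have c: "y ^\<^sub>m r \<in> carrier_mat d d" "C ^\<^sub>m r \<in> carrier_mat m m" using assms by auto
  have "four_block_mat y u (0\<^sub>m m d) C ^\<^sub>m Suc r = four_block_mat (y ^\<^sub>m r) w (0\<^sub>m m d) (C ^\<^sub>m r) * four_block_mat y u (0\<^sub>m m d) C"
    using w by simp
  also have "\<dots> = four_block_mat (y ^\<^sub>m Suc r) (y ^\<^sub>m r * u + w * C) (0\<^sub>m m d) (C ^\<^sub>m Suc r)"
    using assms w c by (subst mult_four_block_mat[of _ d d _ m _ m]) (auto intro!: cong_four_block_mat)
  finally show ?case
    by (intro bexI[of _ "y ^\<^sub>m r * u + w * C"]) (use assms w c in auto)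
qed

lemma mat_trace_four_block:
  assumes "A \<in> carrier_mat d d" "D \<in> carrier_mat m m"
  shows "mat_trace (four_block_mat A B C D) = mat_trace A + mat_trace D"
proof -
  have "mat_trace (four_block_mat A B C D) = (\<Sum>i<d + m. four_block_mat A B C D $$ (i, i))"
    using assms by (simp add: mat_trace_def)
  also have "\<dots> = (\<Sum>i<d. four_block_mat A B C D $$ (i, i)) + (\<Sum>i<m. four_block_mat A B C D $$ (d + i, d + i))"
    using sum.shift_bounds_nat_ivl[of "\<lambda>i. four_block_mat A B C D $$ (i, i)" 0 d m]
    by (simp add: lessThan_atLeast0 sum.atLeastLessThan_concat[of 0 d "d + m", symmetric] add.commute)
  also have "\<dots> = mat_trace A + mat_trace D"
    using assms by (simp add: mat_trace_def)
  finally show ?thesis .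
qed

lemma mat_trace_pow_block_triangular:
  fixes y :: "'a :: field mat"
  assumes "y \<in> carrier_mat d d" "u \<in> carrier_mat d m" "C \<in> carrier_mat m m"
  shows "mat_trace (four_block_mat y u (0\<^sub>m m d) C ^\<^sub>m r) = mat_trace (y ^\<^sub>m r) + mat_trace (C ^\<^sub>m r)"
  using pow_block_triangular[OF assms, of r] mat_trace_four_block[of "y ^\<^sub>m r" d "C ^\<^sub>m r" m] assms by auto

context finite_field
begin

text \<open>The order of the multiplicative group of \<open>K d\<close> as a real number; it
  approximates \<open>card (gens d)\<close>.\<close>

definition \<tau> :: "nat \<Rightarrow> real" where "\<tau> d = real q ^ d - 1"

lemma \<tau>_pos: "d \<ge> 1 \<Longrightarrow> \<tau> d > 0"
  using q_power_gt_1[of d] by (simp add: \<tau>_def flip: of_nat_power)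

definition avg :: "nat \<Rightarrow> ('k mat \<Rightarrow> real) \<Rightarrow> real" where
  "avg n f = (\<Sum>A\<in>general_linear n. f A) / card (general_linear n :: 'k mat set)"

lemma avg_sum: "avg n (\<lambda>A. \<Sum>i\<in>I. f i A) = (\<Sum>i\<in>I. avg n (f i))"
  unfolding avg_def by (subst sum.swap) (simp add: sum_divide_distrib)

lemma avg_cmult: "avg n (\<lambda>A. c * f A) = c * avg n f"
  by (simp add: avg_def sum_distrib_left)

lemma avg_add: "avg n (\<lambda>A. f A + g A) = avg n f + avg n g"
  by (simp add: avg_def sum.distrib add_divide_distrib)

lemma avg_const: "avg n (\<lambda>A. c) = c"
  using card_general_linear_pos[OF finite_UNIV_field, of n] by (simp add: avg_def)

lemma avg_mono: "(\<And>A. A \<in> general_linear n \<Longrightarrow> f A \<le> g A) \<Longrightarrow> avg n f \<le> avg n g"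
  unfolding avg_def by (intro divide_right_mono sum_mono) auto

text \<open>The Cauchy-Schwarz inequality, in the form that the variance of the absolute value is
  nonnegative.\<close>

lemma avg_abs_le_sqrt: "avg n (\<lambda>A. \<bar>f A\<bar>) \<le> sqrt (avg n (\<lambda>A. f A ^ 2))"
proof (rule real_le_rsqrt)
  let ?m = "avg n (\<lambda>A. \<bar>f A\<bar>)"
  have "0 \<le> avg n (\<lambda>A. (\<bar>f A\<bar> - ?m) ^ 2)"
    unfolding avg_def by (intro divide_nonneg_nonneg sum_nonneg) auto
  also have "\<dots> = avg n (\<lambda>A. f A ^ 2 + (- 2 * ?m) * \<bar>f A\<bar> + ?m ^ 2)"
    by (simp add: power2_diff algebra_simps)
  also have "\<dots> = avg n (\<lambda>A. f A ^ 2) + (- 2 * ?m) * ?m + ?m ^ 2"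
    by (simp only: avg_add avg_cmult avg_const)
  finally show "?m ^ 2 \<le> avg n (\<lambda>A. f A ^ 2)" by (simp add: power2_eq_square)
qed

definition N :: "nat \<Rightarrow> 'k mat \<Rightarrow> real" where
  "N d A = (\<Sum>y\<in>gens d. real (card (intertwiners A (rho d y))))"

lemma gens_general_linear: "d \<ge> 1 \<Longrightarrow> y \<in> gens d \<Longrightarrow> rho d y \<in> general_linear d"
  by (simp add: gens_def rho_general_linear)

text \<open>After the change of measure the trace is that of \<open>rho d y\<close> to the power
  \<open>r\<close> plus that of an independent matrix \<open>C\<close>. For each fixed
  \<open>C\<close> the generator \<open>y\<close> has to hit the shifted value
  \<open>c - mat_trace (C ^\<^sub>m r)\<close>, and \<open>gens_count\<close> is uniform in that
  value.\<close>

lemma avg_N_trace: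
  assumes d: "d \<ge> 1" "d \<le> n" "\<not> p dvd d" and r: "r > 0"
  shows "\<bar>avg n (\<lambda>A. N d A * (if mat_trace (A ^\<^sub>m r) = c then 1 else 0)) - \<tau> d / q\<bar>
    \<le> (real (gcd r (q ^ d - 1)) + 2) * sqrt (real q ^ d)"
proof -
  define m where "m = n - d"
  have n: "n = d + m" using d m_def by simp
  define f where "f A = (if mat_trace (A ^\<^sub>m r) = c then 1 else 0 :: real)" for A :: "'k mat"
  define G where "G = card (general_linear m :: 'k mat set)"
  have G: "G > 0" unfolding G_def by (rule card_general_linear_pos[OF finite_UNIV_field])
  define \<delta> where "\<delta> = (real (gcd r (q ^ d - 1)) + 2) * sqrt (real q ^ d)"
  have q0: "real q > 0" using q_ge_2 by simp
  have cl: "f (g * A * g') = f A" if "g \<in> general_linear (d + m)" "g' \<in> general_linear (d + m)"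
    "g * g' = 1\<^sub>m (d + m)" "g' * g = 1\<^sub>m (d + m)" "A \<in> general_linear (d + m)" for g g' A
    using that mat_trace_pow_conj[of A "d + m" g g' r] by (simp add: f_def general_linear_carrier)
  have "avg n (\<lambda>A. N d A * f A) = (\<Sum>y\<in>gens d. avg n (\<lambda>A. f A * real (card (intertwiners A (rho d y)))))"
    unfolding N_def avg_sum[symmetric] by (simp add: sum_distrib_left mult.commute)
  also have "\<dots> = (\<Sum>y\<in>gens d. (\<Sum>C\<in>general_linear m. if mat_trace (rho d y ^\<^sub>m r) = c - mat_trace (C ^\<^sub>m r) then 1 else 0 :: real) / G)"
  proof (rule sum.cong[OF refl])
    fix y assume y: "y \<in> gens d"
    have "avg n (\<lambda>A. f A * real (card (intertwiners A (rho d y)))) =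
      (\<Sum>u\<in>carrier_mat d m. \<Sum>C\<in>general_linear m. f (four_block_mat (rho d y) u (0\<^sub>m m d) C)) / (CARD('k) ^ (d * m) * G)"
      unfolding avg_def n G_def
      by (rule average_intertwiners[OF finite_UNIV_field gens_general_linear[OF d(1) y] cl])
    also have "(\<Sum>u\<in>carrier_mat d m. \<Sum>C\<in>general_linear m. f (four_block_mat (rho d y) u (0\<^sub>m m d) C)) =
      (\<Sum>u\<in>(carrier_mat d m :: 'k mat set). \<Sum>C\<in>general_linear m. if mat_trace (rho d y ^\<^sub>m r) = c - mat_trace (C ^\<^sub>m r) then 1 else 0 :: real)"
      by (intro sum.cong refl) (auto simp: f_def mat_trace_pow_block_triangular[of _ d _ m] general_linear_carrier algebra_simps)
    also have "\<dots> = CARD('k) ^ (d * m) * (\<Sum>C\<in>general_linear m. if mat_trace (rho d y ^\<^sub>m r) = c - mat_trace (C ^\<^sub>m r) then 1 else 0 :: real)"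
      by (simp add: card_carrier_mat)
    finally show "avg n (\<lambda>A. f A * real (card (intertwiners A (rho d y)))) =
       (\<Sum>C\<in>general_linear m. if mat_trace (rho d y ^\<^sub>m r) = c - mat_trace (C ^\<^sub>m r) then 1 else 0 :: real) / G"
      using q0 by (simp add: card_field)
  qed
  also have "\<dots> = (\<Sum>C\<in>general_linear m. \<Sum>y\<in>gens d. if mat_trace (rho d y ^\<^sub>m r) = c - mat_trace (C ^\<^sub>m r) then 1 else 0 :: real) / G"
    by (subst sum.swap) (simp add: sum_divide_distrib)
  also have "\<dots> = (\<Sum>C\<in>general_linear m. real (card {y \<in> gens d. mat_trace (rho d y ^\<^sub>m r) = c - mat_trace (C ^\<^sub>m r)})) / G"
    using sum.inter_filter[OF finite_gens[OF d(1)], of "\<lambda>_. 1 :: real"] by simp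
  finally have eq: "avg n (\<lambda>A. N d A * f A) = avg m (\<lambda>C. real (card {y \<in> gens d. mat_trace (rho d y ^\<^sub>m r) = c - mat_trace (C ^\<^sub>m r)}))"
    by (simp add: avg_def G_def)
  have b: "\<bar>real (card {y \<in> gens d. mat_trace (rho d y ^\<^sub>m r) = c'}) - \<tau> d / q\<bar> \<le> \<delta>" for c'
    using gens_count[OF d(1,3) r] unfolding \<delta>_def \<tau>_def .
  have b1: "real (card {y \<in> gens d. mat_trace (rho d y ^\<^sub>m r) = c'}) \<le> \<tau> d / q + \<delta>" for c'
    using b[of c'] by linarith
  have b2: "\<tau> d / q - \<delta> \<le> real (card {y \<in> gens d. mat_trace (rho d y ^\<^sub>m r) = c'})" for c'
    using b[of c'] by linarith
  have "avg n (\<lambda>A. N d A * f A) \<le> avg m (\<lambda>C. \<tau> d / q + \<delta>)"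
    unfolding eq by (intro avg_mono b1)
  moreover have "avg n (\<lambda>A. N d A * f A) \<ge> avg m (\<lambda>C. \<tau> d / q - \<delta>)"
    unfolding eq by (intro avg_mono b2)
  ultimately show ?thesis
    unfolding avg_const f_def \<delta>_def by (simp add: abs_le_iff)
qed

text \<open>Every generator contributes mean exactly 1: this is \<open>average_intertwiners\<close>
  with constant weight.\<close>

lemma avg_N:
  assumes d: "d \<ge> 1" "d \<le> n"
  shows "avg n (N d) = card (gens d)"
proof -
  define m where "m = n - d"
  have n: "n = d + m" using d m_def by simp
  have G: "card (general_linear m :: 'k mat set) > 0" by (rule card_general_linear_pos[OF finite_UNIV_field])
  have "avg n (N d) = (\<Sum>y\<in>gens d. avg n (\<lambda>A. 1 * real (card (intertwiners A (rho d y)))))"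
    unfolding N_def avg_sum[symmetric] by simp
  also have "\<dots> = (\<Sum>y\<in>gens d. 1)"
  proof (rule sum.cong[OF refl])
    fix y assume y: "y \<in> gens d"
    show "avg n (\<lambda>A. 1 * real (card (intertwiners A (rho d y)))) = 1"
      unfolding avg_def n
      by (subst average_intertwiners[OF finite_UNIV_field gens_general_linear[OF d(1) y]])
         (use G q_ge_2 in \<open>simp_all add: card_carrier_mat card_field\<close>)
  qed
  finally show ?thesis by simp
qed

text \<open>The first term bounds the product of the means. Modules of different degrees have no
  intertwiners, so a correlation term appears only for \<open>d = e\<close>.\<close>

lemma avg_N_N:
  assumes d: "d \<ge> 1" "d \<le> n" and e: "e \<ge> 1"
  shows "avg n (\<lambda>A. N d A * N e A) \<le> \<tau> d * \<tau> e + (if d = e then d * \<tau> d * \<tau> e else 0)"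
proof -
  have "avg n (\<lambda>A. N d A * N e A) = (\<Sum>x\<in>gens d. \<Sum>y\<in>gens e. avg n (\<lambda>A. real (card (intertwiners A (rho d x))) * card (intertwiners A (rho e y))))"
    unfolding N_def sum_product avg_sum ..
  also have "\<dots> \<le> (\<Sum>x\<in>gens d. \<Sum>y\<in>gens e. 1 + real (card (intertwiners (rho d x) (rho e y))))"
    unfolding avg_def
  proof (intro sum_mono)
    fix x y assume x: "x \<in> gens d" and y: "y \<in> gens e"
    have "irreducible_mat (rho e y)" using y e by (simp add: gens_def irreducible_rho)
    from second_moment_intertwiners[OF finite_UNIV_field gens_general_linear[OF d(1) x] d(2) gens_general_linear[OF e y] this]
    show "(\<Sum>A\<in>general_linear n. real (card (intertwiners A (rho d x))) * card (intertwiners A (rho e y))) /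
      card (general_linear n :: 'k mat set) \<le> 1 + real (card (intertwiners (rho d x) (rho e y)))" by simp
  qed
  also have "\<dots> = real (card (gens d)) * card (gens e) + (\<Sum>x\<in>gens d. \<Sum>y\<in>gens e. real (card (intertwiners (rho d x) (rho e y))))"
    by (simp add: sum.distrib)
  also have "(\<Sum>x\<in>gens d. \<Sum>y\<in>gens e. real (card (intertwiners (rho d x) (rho e y)))) \<le> (if d = e then d * \<tau> d * \<tau> e else 0)"
  proof (cases "d = e")
    case True
    have "(\<Sum>x\<in>gens d. \<Sum>y\<in>gens e. real (card (intertwiners (rho d x) (rho e y)))) \<le> (\<Sum>x\<in>gens d. d * \<tau> d)"
      unfolding True[symmetric] \<tau>_def by (intro sum_mono sum_card_intertwiners_gens d)
    also have "\<dots> = card (gens d) * (d * \<tau> d)" by simp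
    also have "\<dots> \<le> \<tau> d * (d * \<tau> d)"
      using card_gens_le[OF d(1)] \<tau>_pos[OF d(1)] by (intro mult_right_mono) (auto simp: \<tau>_def)
    finally show ?thesis using True by (simp add: mult_ac)
  next
    case False
    then show ?thesis
      using intertwiners_rho_empty[OF d(1) _ _ e _ _ False] by (simp add: gens_def)
  qed
  also have "real (card (gens d)) * card (gens e) \<le> \<tau> d * \<tau> e"
    using card_gens_le[OF d(1)] card_gens_le[OF e] \<tau>_pos[OF d(1)] by (intro mult_mono) (auto simp: \<tau>_def)
  finally show ?thesis by simp
qed

text \<open>
  A Turan--Kubilius argument: the weighted count \<open>Z\<close> of invariant subspaces on which \<open>A\<close> acts through
  one of the fields \<open>K d\<close> is concentrated around \<open>\<Delta>\<close>, and weighting by \<open>Z\<close> equidistributes the trace.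
\<close>

lemma trace_equidistribution_bound:
  assumes D: "finite D" "D \<noteq> {}" "\<And>d. d \<in> D \<Longrightarrow> d \<ge> 1 \<and> d \<le> n \<and> \<not> p dvd d" and r: "r > 0"
    and \<eta>: "\<And>d. d \<in> D \<Longrightarrow> (real (gcd r (q ^ d - 1)) + 2) * sqrt (real q ^ d) \<le> \<eta> * \<tau> d"
    and \<Delta>: "\<Delta> = (\<Sum>d\<in>D. 1 / real d)"
  shows "\<bar>avg n (\<lambda>A. if mat_trace (A ^\<^sub>m r) = c then 1 else 0) - 1 / q\<bar> \<le> \<eta> + sqrt (1 / \<Delta> + 2 * \<eta>)"
proof -
  define f where "f A = (if mat_trace (A ^\<^sub>m r) = c then 1 else 0 :: real)" for A :: "'k mat"
  \<comment> \<open>An invariant subspace of dimension \<open>d\<close> on which \<open>A\<close>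
    acts as a generator of \<open>K d\<close> is counted \<open>d * \<tau> d\<close> times by
    \<open>N d\<close>, once for each of \<open>d\<close> conjugates and \<open>\<tau> d\<close>
    isomorphisms; the factor normalises this to 1.\<close>
  define Z where "Z A = (\<Sum>d\<in>D. 1 / (d * \<tau> d) * N d A)" for A
  have \<tau>p: "\<tau> d > 0" "real d > 0" if "d \<in> D" for d using D(3)[OF that] \<tau>_pos[of d] by auto
  have \<Delta>0: "\<Delta> > 0" unfolding \<Delta> using D by (intro sum_pos) (use \<tau>p in auto)
  have EX: "avg n Z \<ge> \<Delta> * (1 - \<eta>)"
  proof -
    have "avg n Z = (\<Sum>d\<in>D. 1 / (d * \<tau> d) * card (gens d))"
      unfolding Z_def avg_sum avg_cmult using D(3) avg_N by (intro sum.cong) auto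
    also have "\<dots> \<ge> (\<Sum>d\<in>D. 1 / (d * \<tau> d) * ((1 - \<eta>) * \<tau> d))"
    proof (intro sum_mono mult_left_mono)
      fix d assume d: "d \<in> D"
      have "2 * sqrt (real q ^ d) \<le> (real (gcd r (q ^ d - 1)) + 2) * sqrt (real q ^ d)"
        by (intro mult_right_mono) auto
      then have "2 * sqrt (real q ^ d) \<le> \<eta> * \<tau> d" using \<eta>[OF d] by linarith
      then show "(1 - \<eta>) * \<tau> d \<le> card (gens d)"
        using card_gens_ge[of d] D(3)[OF d] by (simp add: \<tau>_def algebra_simps)
    qed (use \<tau>p in \<open>auto intro!: mult_nonneg_nonneg less_imp_le\<close>)
    also have "(\<Sum>d\<in>D. 1 / (d * \<tau> d) * ((1 - \<eta>) * \<tau> d)) = \<Delta> * (1 - \<eta>)"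
      unfolding \<Delta> sum_distrib_right
    proof (rule sum.cong[OF refl])
      fix d assume "d \<in> D"
      then show "1 / (d * \<tau> d) * ((1 - \<eta>) * \<tau> d) = 1 / d * (1 - \<eta>)"
        using \<tau>p[of d] by (simp add: field_simps)
    qed
    finally show ?thesis .
  qed
  have EZZ: "avg n (\<lambda>A. Z A ^ 2) \<le> \<Delta>\<^sup>2 + \<Delta>"
  proof -
    have "avg n (\<lambda>A. Z A ^ 2) = (\<Sum>d\<in>D. \<Sum>e\<in>D. avg n (\<lambda>A. 1 / (d * \<tau> d) * (1 / (e * \<tau> e)) * (N d A * N e A)))"
      unfolding Z_def power2_eq_square sum_product avg_sum by (simp add: mult_ac)
    also have "\<dots> \<le> (\<Sum>d\<in>D. \<Sum>e\<in>D. 1 / d * (1 / e) + (if d = e then 1 / d else 0))"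
    proof (intro sum_mono)
      fix d e assume d: "d \<in> D" and e: "e \<in> D"
      have "avg n (\<lambda>A. 1 / (d * \<tau> d) * (1 / (e * \<tau> e)) * (N d A * N e A)) =
         1 / (d * \<tau> d) * (1 / (e * \<tau> e)) * avg n (\<lambda>A. N d A * N e A)"
        by (rule avg_cmult)
      also have "\<dots> \<le> 1 / (d * \<tau> d) * (1 / (e * \<tau> e)) * (\<tau> d * \<tau> e + (if d = e then d * \<tau> d * \<tau> e else 0))"
        using avg_N_N[of d n e] D(3)[OF d] D(3)[OF e] \<tau>p[OF d] \<tau>p[OF e] by (intro mult_left_mono) auto
      also have "\<dots> = 1 / d * (1 / e) + (if d = e then 1 / d else 0)"
      proof -
        have "1 / (a * x) * (1 / (b * y)) * (x * y) = 1 / a * (1 / b)"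
          "1 / (a * x) * (1 / (a * y)) * (x * y + a * x * y) = 1 / a * (1 / a) + 1 / a"
          if "x > 0" "y > 0" "a > 0" "b > 0" for a b x y :: real
          using that by (simp_all add: divide_simps)
        then show ?thesis using \<tau>p[OF d] \<tau>p[OF e] by (cases "d = e") simp_all
      qed
      finally show "avg n (\<lambda>A. 1 / (d * \<tau> d) * (1 / (e * \<tau> e)) * (N d A * N e A)) \<le> 1 / d * (1 / e) + (if d = e then 1 / d else 0)" .
    qed
    also have "\<dots> = \<Delta>\<^sup>2 + \<Delta>"
      using D(1) by (simp add: sum.distrib \<Delta> power2_eq_square sum_product)
    finally show ?thesis .
  qed
  \<comment> \<open>Deviations are measured from \<open>\<Delta>\<close> and not from the mean,
    which may be smaller by \<open>\<eta> * \<Delta>\<close>; this is the origin of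
    \<open>2 * \<eta>\<close>.\<close>
  have "avg n (\<lambda>A. (Z A - \<Delta>)\<^sup>2) = avg n (\<lambda>A. Z A ^ 2 + (- 2 * \<Delta>) * Z A + \<Delta>\<^sup>2)"
    by (simp add: power2_diff algebra_simps)
  also have "\<dots> = avg n (\<lambda>A. Z A ^ 2) + (- 2 * \<Delta>) * avg n Z + \<Delta>\<^sup>2"
    by (simp only: avg_add avg_cmult avg_const)
  also have "\<dots> \<le> (\<Delta>\<^sup>2 + \<Delta>) + (- 2 * \<Delta>) * (\<Delta> * (1 - \<eta>)) + \<Delta>\<^sup>2"
    using EZZ EX \<Delta>0 by (intro add_mono mult_left_mono_neg) auto
  also have "\<dots> = \<Delta>\<^sup>2 * (1 / \<Delta> + 2 * \<eta>)"
  proof -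
    have "\<Delta>\<^sup>2 * (1 / \<Delta>) = \<Delta>" using \<Delta>0 by (simp add: power2_eq_square)
    then show ?thesis by (simp add: distrib_left) (simp add: algebra_simps power2_eq_square)
  qed
  finally have var: "avg n (\<lambda>A. (Z A - \<Delta>)\<^sup>2) \<le> \<Delta>\<^sup>2 * (1 / \<Delta> + 2 * \<eta>)" .
  have "avg n (\<lambda>A. \<bar>Z A - \<Delta>\<bar>) \<le> sqrt (\<Delta>\<^sup>2 * (1 / \<Delta> + 2 * \<eta>))"
    using avg_abs_le_sqrt[of n "\<lambda>A. Z A - \<Delta>"] var by (meson order_trans real_sqrt_le_mono)
  also have "\<dots> = \<Delta> * sqrt (1 / \<Delta> + 2 * \<eta>)"
    using \<Delta>0 by (simp add: real_sqrt_mult)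
  finally have dev: "avg n (\<lambda>A. \<bar>Z A - \<Delta>\<bar>) \<le> \<Delta> * sqrt (1 / \<Delta> + 2 * \<eta>)" .
  have f01: "0 \<le> f A" "f A \<le> 1" for A by (auto simp: f_def)
  \<comment> \<open>Since \<open>f\<close> takes values between 0 and 1, replacing the constant
    weight \<open>\<Delta>\<close> by \<open>Z\<close> costs at most the mean absolute deviation of
    \<open>Z\<close>.\<close>
  have "\<Delta> * avg n f - avg n (\<lambda>A. Z A * f A) = avg n (\<lambda>A. (\<Delta> - Z A) * f A)"
    using avg_add[of n "\<lambda>A. \<Delta> * f A" "\<lambda>A. (- 1) * (Z A * f A)"] avg_cmult[of n \<Delta> f] avg_cmult[of n "- 1" "\<lambda>A. Z A * f A"]
    by (simp add: algebra_simps)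
  moreover have "avg n (\<lambda>A. (\<Delta> - Z A) * f A) \<le> avg n (\<lambda>A. \<bar>Z A - \<Delta>\<bar>)"
  proof (rule avg_mono)
    fix A
    have "(\<Delta> - Z A) * f A \<le> \<bar>(\<Delta> - Z A) * f A\<bar>" by simp
    also have "\<dots> = \<bar>Z A - \<Delta>\<bar> * f A" using f01(1)[of A] by (simp add: abs_mult abs_minus_commute)
    also have "\<dots> \<le> \<bar>Z A - \<Delta>\<bar> * 1" using f01 by (intro mult_left_mono) auto
    finally show "(\<Delta> - Z A) * f A \<le> \<bar>Z A - \<Delta>\<bar>" by simp
  qed
  moreover have "avg n (\<lambda>A. (- 1) * ((\<Delta> - Z A) * f A)) \<le> avg n (\<lambda>A. \<bar>Z A - \<Delta>\<bar>)"
  proof (rule avg_mono)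
    fix A
    have "(- 1) * ((\<Delta> - Z A) * f A) \<le> \<bar>(\<Delta> - Z A) * f A\<bar>" by simp
    also have "\<dots> = \<bar>Z A - \<Delta>\<bar> * f A" using f01(1)[of A] by (simp add: abs_mult abs_minus_commute)
    also have "\<dots> \<le> \<bar>Z A - \<Delta>\<bar> * 1" using f01 by (intro mult_left_mono) auto
    finally show "(- 1) * ((\<Delta> - Z A) * f A) \<le> \<bar>Z A - \<Delta>\<bar>" by simp
  qed
  ultimately have 1: "\<bar>\<Delta> * avg n f - avg n (\<lambda>A. Z A * f A)\<bar> \<le> \<Delta> * sqrt (1 / \<Delta> + 2 * \<eta>)"
    using dev unfolding avg_cmult by (simp add: abs_le_iff)
  have "avg n (\<lambda>A. Z A * f A) = (\<Sum>d\<in>D. 1 / (d * \<tau> d) * avg n (\<lambda>A. N d A * f A))"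
    unfolding Z_def sum_distrib_right avg_sum avg_cmult[symmetric] by (simp add: mult.assoc)
  then have "\<bar>avg n (\<lambda>A. Z A * f A) - \<Delta> / q\<bar> = \<bar>\<Sum>d\<in>D. 1 / (d * \<tau> d) * (avg n (\<lambda>A. N d A * f A) - \<tau> d / q)\<bar>"
  proof -
    have "\<Delta> / q = (\<Sum>d\<in>D. 1 / (d * \<tau> d) * (\<tau> d / q))"
      unfolding \<Delta> sum_divide_distrib
    proof (rule sum.cong[OF refl])
      fix d assume "d \<in> D"
      then show "1 / real d / q = 1 / (d * \<tau> d) * (\<tau> d / q)" using \<tau>p[of d] by simp
    qed
    then show ?thesis
      using \<open>avg n (\<lambda>A. Z A * f A) = _\<close> by (simp add: right_diff_distrib sum_subtractf)
  qed
  also have "\<dots> \<le> (\<Sum>d\<in>D. \<bar>1 / (d * \<tau> d) * (avg n (\<lambda>A. N d A * f A) - \<tau> d / q)\<bar>)" by (rule sum_abs)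
  also have "\<dots> \<le> (\<Sum>d\<in>D. 1 / d * \<eta>)"
  proof (rule sum_mono)
    fix d assume d: "d \<in> D"
    have "\<bar>avg n (\<lambda>A. N d A * f A) - \<tau> d / q\<bar> \<le> \<eta> * \<tau> d"
      using avg_N_trace[of d n r c] D(3)[OF d] r \<eta>[OF d] unfolding f_def by fastforce
    then have "1 / (d * \<tau> d) * \<bar>avg n (\<lambda>A. N d A * f A) - \<tau> d / q\<bar> \<le> 1 / (d * \<tau> d) * (\<eta> * \<tau> d)"
      using \<tau>p[OF d] by (intro mult_left_mono) auto
    also have "\<dots> = 1 / d * \<eta>" using \<tau>p[OF d] by simp
    finally show "\<bar>1 / (d * \<tau> d) * (avg n (\<lambda>A. N d A * f A) - \<tau> d / q)\<bar> \<le> 1 / d * \<eta>"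
      using \<tau>p[OF d] by (simp add: abs_mult)
  qed
  also have "\<dots> = \<Delta> * \<eta>" by (simp add: \<Delta> sum_distrib_right)
  finally have 2: "\<bar>avg n (\<lambda>A. Z A * f A) - \<Delta> / q\<bar> \<le> \<Delta> * \<eta>" .
  have "\<Delta> * \<bar>avg n f - 1 / q\<bar> = \<bar>\<Delta> * avg n f - \<Delta> / q\<bar>"
    using \<Delta>0 by (simp add: abs_mult_pos' right_diff_distrib)
  also have "\<dots> \<le> \<Delta> * (\<eta> + sqrt (1 / \<Delta> + 2 * \<eta>))"
    using 1 2 by (simp add: distrib_left)
  finally show ?thesis using \<Delta>0 unfolding f_def by simp
qed

end

section \<open>Degrees in which the power map is nondegenerate\<close>

text \<open>The gcd distributes over the lcm, which is checked on the multiplicity of each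
  prime.\<close>

lemma gcd_lcm_dvd:
  fixes a b c m :: nat
  assumes "gcd a b dvd m" "gcd a c dvd m" "a > 0" "b > 0" "c > 0"
  shows "gcd a (lcm b c) dvd m"
proof -
  have "gcd a (lcm b c) dvd lcm (gcd a b) (gcd a c)"
  proof (rule multiplicity_le_imp_dvd)
    fix p :: nat assume "prime p"
    then show "multiplicity p (gcd a (lcm b c)) \<le> multiplicity p (lcm (gcd a b) (gcd a c))"
      using assms by (simp add: multiplicity_gcd multiplicity_lcm lcm_eq_0_iff)
  qed (use assms in auto)
  also have "lcm (gcd a b) (gcd a c) dvd m" using assms by simp
  finally show ?thesis .
qed

lemma gcd_Lcm_dvd:
  fixes a m :: nat
  assumes "finite S" "\<And>b. b \<in> S \<Longrightarrow> gcd a b dvd m" "\<And>b. b \<in> S \<Longrightarrow> b > 0" "a > 0"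
  shows "gcd a (Lcm S) dvd m"
  using assms
proof (induction S rule: finite_induct)
  case (insert b S)
  have "Lcm S > 0" using insert by (intro Nat.gr0I) (auto simp: Lcm_0_iff)
  then show ?case using insert by (simp add: gcd_lcm_dvd)
qed simp

text \<open>Euclid's algorithm in the exponents: if \<open>q ^ a\<close> and \<open>q ^ b\<close>
  are 1 modulo \<open>g\<close>, so is \<open>q ^ (a mod b)\<close>.\<close>

lemma dvd_power_minus_1_gcd:
  fixes q a b g :: nat
  assumes "q > 0" "g dvd q ^ a - 1" "g dvd q ^ b - 1"
  shows "g dvd q ^ gcd a b - 1"
  using assms
proof (induction a b rule: gcd_nat_induct)
  case (step a b)
  have "g dvd q ^ (a mod b) - 1"
  proof -
    have eq: "[q ^ b = 1] (mod g)" "[q ^ a = 1] (mod g)"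
      using step.prems by (auto simp: cong_altdef_nat)
    have "[q ^ a = (q ^ b) ^ (a div b) * q ^ (a mod b)] (mod g)"
      by (metis cong_refl mult_div_mod_eq power_add power_mult)
    also have "[(q ^ b) ^ (a div b) * q ^ (a mod b) = 1 ^ (a div b) * q ^ (a mod b)] (mod g)"
      using eq by (intro cong_mult cong_pow cong_refl)
    finally have "[q ^ (a mod b) = 1] (mod g)"
      using eq(2) by (metis cong_sym cong_trans mult_1 power_one)
    then show ?thesis using step.prems by (simp add: cong_altdef_nat)
  qed
  then show ?case using step by (metis gcd_red_nat)
qed auto

text \<open>Such a \<open>t\<close> is coprime to \<open>W\<close>, so the solutions
  \<open>k\<close> lie in one class modulo \<open>t\<close>. Dividing their offsets by
  \<open>t\<close> separates them.\<close>

lemma card_arith_progression_le: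
  fixes t W K :: nat
  assumes "t \<ge> 1"
  shows "card {k \<in> {K<..2 * K}. t dvd 1 + W * k} \<le> K div t + 1"
proof -
  let ?S = "{k \<in> {K<..2 * K}. t dvd 1 + W * k}"
  have "inj_on (\<lambda>k. (k - Suc K) div t) ?S"
  proof (rule linorder_inj_onI')
    fix k l assume k: "k \<in> ?S" and l: "l \<in> ?S" and kl: "k < l"
    have "t dvd (1 + W * l) - (1 + W * k)" using k l by (intro dvd_diff_nat) auto
    also have "(1 + W * l) - (1 + W * k) = W * (l - k)" by (simp add: diff_mult_distrib2)
    finally have "t dvd W * (l - k)" .
    moreover have "coprime t W"
    proof (rule coprimeI)
      fix c assume "c dvd t" "c dvd W"
      then have "c dvd 1 + W * k" "c dvd W * k" using k dvd_trans by auto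
      then show "c dvd 1" by (metis add.commute dvd_add_right_iff)
    qed
    ultimately have "t dvd l - k" by (simp add: coprime_dvd_mult_right_iff)
    then obtain s where s: "l - k = t * s" by (elim dvdE)
    have "s \<ge> 1" using s kl by (cases s) auto
    have "l - Suc K = (k - Suc K) + t * s" using s k kl by auto
    then have "(l - Suc K) div t = (k - Suc K) div t + s" using assms by simp
    then show "(k - Suc K) div t \<noteq> (l - Suc K) div t" using \<open>s \<ge> 1\<close> by simp
  qed
  then have "card ?S \<le> card {..K div t}"
  proof (rule card_inj_on_le)
    show "(\<lambda>k. (k - Suc K) div t) ` ?S \<subseteq> {..K div t}"
      by (auto intro!: div_le_mono)
  qed simp
  then show ?thesis by simp
qed

text \<open>After exchanging the sums each \<open>t\<close> contributes at most
  \<open>t * (K div t + 1)\<close>, hence at most \<open>2 * K\<close>.\<close>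

lemma sum_small_divisors_le:
  fixes W K :: nat
  shows "(\<Sum>k\<in>{K<..2 * K}. \<Sum>t\<in>{t \<in> {1..K}. t dvd 1 + W * k}. t) \<le> 2 * K\<^sup>2"
proof -
  have "(\<Sum>k\<in>{K<..2 * K}. \<Sum>t\<in>{t \<in> {1..K}. t dvd 1 + W * k}. t) =
     (\<Sum>k\<in>{K<..2 * K}. \<Sum>t\<in>{1..K}. if t dvd 1 + W * k then t else 0)"
    by (intro sum.cong refl sum.inter_filter) auto
  also have "\<dots> = (\<Sum>t\<in>{1..K}. \<Sum>k\<in>{K<..2 * K}. if t dvd 1 + W * k then t else 0)"
    by (rule sum.swap)
  also have "\<dots> = (\<Sum>t\<in>{1..K}. card {k \<in> {K<..2 * K}. t dvd 1 + W * k} * t)"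
    by (intro sum.cong refl) (simp add: sum.inter_filter[symmetric])
  also have "\<dots> \<le> (\<Sum>t\<in>{1..K}. 2 * K)"
  proof (rule sum_mono)
    fix t assume t: "t \<in> {1..K}"
    have "card {k \<in> {K<..2 * K}. t dvd 1 + W * k} * t \<le> (K div t + 1) * t"
      using card_arith_progression_le[of t K W] t by (intro mult_right_mono) auto
    also have "\<dots> = t * (K div t) + t" by simp
    also have "\<dots> \<le> K + K" using t times_div_less_eq_dividend[of t K] by (intro add_mono) auto
    also have "\<dots> = 2 * K" by simp
    finally show "card {k \<in> {K<..2 * K}. t dvd 1 + W * k} * t \<le> 2 * K" .
  qed
  also have "\<dots> = 2 * K\<^sup>2" by (simp add: power2_eq_square)
  finally show ?thesis .
qed

text \<open>
  If \<open>gcd r (q ^ d - 1)\<close> is large for many \<open>d = 1 + W * k\<close>, then the least common multiple of these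
  numbers, which divides \<open>r\<close>, is huge: their pairwise common factors divide \<open>q ^ t - 1\<close> with \<open>t \<le> K\<close>.
\<close>

lemma few_bad_degrees:
  fixes q r W K :: nat
  assumes q: "q \<ge> 2" and r: "0 < r" "r < q ^ (K\<^sup>2)" and W: "W \<ge> 24"
  shows "2 * card {k \<in> {K<..2 * K}. q ^ (1 + W * k) < gcd r (q ^ (1 + W * k) - 1) ^ 4} \<le> K"
proof -
  define g where "g k = gcd r (q ^ (1 + W * k) - 1)" for k
  define s where "s k = (\<Sum>t\<in>{t \<in> {1..K}. t dvd 1 + W * k}. t)" for k
  define B where "B = {k \<in> {K<..2 * K}. q ^ (1 + W * k) < g k ^ 4}"
  have g0: "g k > 0" for k using r by (simp add: g_def)
  \<comment> \<open>Adding one number to the lcm loses only its gcd with the previous lcm, and the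
    loss is at most \<open>q ^ s k\<close>.\<close>
  have main: "(\<Prod>k\<in>S. g k) \<le> Lcm (g ` S) * q ^ (\<Sum>k\<in>S. s k)" if "finite S" "S \<subseteq> {K<..2 * K}" for S
    using that
  proof (induction S rule: finite_induct)
    case (insert k S)
    \<comment> \<open>A common multiple of all \<open>q ^ t - 1\<close> that can occur as bounds for
      a pairwise gcd; its size is controlled by the sum of the small divisors of
      \<open>1 + W * k\<close>.\<close>
    define m where "m = (\<Prod>t\<in>{t \<in> {1..K}. t dvd 1 + W * k}. q ^ t - 1)"
    have "q ^ t > 1" if "t \<ge> 1" for t using q that by (intro one_less_power) auto
    then have m0: "m > 0" unfolding m_def by (intro prod_pos) auto
    have m1: "m \<le> q ^ s k"
      unfolding m_def s_def power_sum by (intro prod_mono) auto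
    have "gcd (g k) (Lcm (g ` S)) dvd m"
    proof (rule gcd_Lcm_dvd)
      fix b assume "b \<in> g ` S"
      then obtain l where l: "l \<in> S" "b = g l" by blast
      have lk: "l \<noteq> k" "l \<in> {K<..2 * K}" "k \<in> {K<..2 * K}" using l insert by auto
      define t where "t = gcd (1 + W * k) (1 + W * l)"
      have td: "t dvd 1 + W * k" "t dvd 1 + W * l" by (auto simp: t_def)
      have t1: "t \<ge> 1" unfolding t_def by (simp add: Suc_leI)
      \<comment> \<open>A common divisor of two terms of the progression is coprime to
        \<open>W\<close>, so it divides \<open>k - l\<close>, a nonzero number smaller than
        \<open>K\<close> in absolute value.\<close>
      have "t \<le> K"
      proof -
        have "coprime t W"
        proof (rule coprimeI)
          fix c assume "c dvd t" "c dvd W"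
          then have "c dvd 1 + W * k" "c dvd W * k" using td dvd_trans by auto
          then show "c dvd 1" by (metis add.commute dvd_add_right_iff)
        qed
        moreover have "int t dvd int (1 + W * k) - int (1 + W * l)"
          using td by (intro dvd_diff) (simp_all only: int_dvd_int_iff)
        then have "int t dvd int W * (int k - int l)" by (simp add: algebra_simps)
        ultimately have "int t dvd int k - int l"
          by (simp add: coprime_dvd_mult_right_iff)
        then have "int t \<le> \<bar>int k - int l\<bar>" using lk by (intro zdvd_imp_le) auto
        then show ?thesis using lk by auto
      qed
      have "gcd (g k) (g l) dvd q ^ t - 1"
        unfolding t_def using q by (intro dvd_power_minus_1_gcd) (auto simp: g_def dvd_trans[OF gcd_dvd1] dvd_trans[OF gcd_dvd2])
      also have "\<dots> dvd m" unfolding m_def using td t1 \<open>t \<le> K\<close> by (intro dvd_prodI) auto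
      finally show "gcd (g k) b dvd m" using l by simp
    qed (use insert g0 in auto)
    then have gl: "gcd (g k) (Lcm (g ` S)) \<le> q ^ s k" using m0 m1 by (meson dvd_imp_le order_trans)
    have "(\<Prod>k\<in>insert k S. g k) = g k * (\<Prod>k\<in>S. g k)" using insert by simp
    also have "\<dots> \<le> g k * (Lcm (g ` S) * q ^ (\<Sum>k\<in>S. s k))" using insert by (intro mult_left_mono) auto
    also have "\<dots> = (g k * Lcm (g ` S)) * q ^ (\<Sum>k\<in>S. s k)" by simp
    also have "g k * Lcm (g ` S) = gcd (g k) (Lcm (g ` S)) * Lcm (g ` insert k S)"
      unfolding image_insert Lcm_insert by (rule prod_gcd_lcm_nat)
    also have "\<dots> * q ^ (\<Sum>k\<in>S. s k) \<le> q ^ s k * Lcm (g ` insert k S) * q ^ (\<Sum>k\<in>S. s k)"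
      using gl by (intro mult_right_mono) auto
    also have "\<dots> = Lcm (g ` insert k S) * q ^ (\<Sum>k\<in>insert k S. s k)"
      using insert by (simp add: power_add mult_ac)
    finally show ?case .
  qed simp
  have finB: "finite B" "B \<subseteq> {K<..2 * K}" by (auto simp: B_def)
  have "Lcm (g ` B) dvd r" by (rule Lcm_least) (auto simp: g_def)
  then have "Lcm (g ` B) \<le> r" using r by (intro dvd_imp_le) auto
  moreover have "(\<Sum>k\<in>B. s k) \<le> 2 * K\<^sup>2"
    using sum_mono2[OF _ finB(2), of s] sum_small_divisors_le[where K = K and W = W] by (simp add: s_def)
  then have "q ^ (\<Sum>k\<in>B. s k) \<le> q ^ (2 * K\<^sup>2)" using q by (intro power_increasing) auto
  ultimately have P: "(\<Prod>k\<in>B. g k) \<le> r * q ^ (2 * K\<^sup>2)"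
    using main[OF finB] by (meson mult_le_mono order_trans)
  show ?thesis
  proof (rule ccontr)
    assume "\<not> ?thesis"
    then have big: "K < 2 * card B" by (simp add: B_def g_def)
    \<comment> \<open>The origin of 24: more than \<open>K / 2\<close> bad degrees, each with
      \<open>g k ^ 4\<close> above \<open>q ^ (W * K)\<close>, push the fourth power of the product
      to at least \<open>q ^ (12 * K\<^sup>2)\<close>, while \<open>P\<close> allows at most
      \<open>r ^ 4 * q ^ (8 * K\<^sup>2)\<close>. The gap contradicts the bound on
      \<open>r\<close>.\<close>
    have "q ^ (12 * K\<^sup>2) \<le> q ^ (W * K * card B)"
    proof (rule power_increasing)
      have "12 * K\<^sup>2 * 2 = 24 * K * K" by (simp add: power2_eq_square)
      also have "\<dots> \<le> W * K * (2 * card B)" using W big by (intro mult_mono) auto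
      finally show "12 * K\<^sup>2 \<le> W * K * card B" by (simp add: mult_ac)
    qed (use q in auto)
    also have "\<dots> = (\<Prod>k\<in>B. q ^ (W * K))" by (simp add: power_mult)
    also have "\<dots> \<le> (\<Prod>k\<in>B. g k ^ 4)"
    proof (rule prod_mono, safe)
      fix k assume k: "k \<in> B"
      have "q ^ (W * K) \<le> q ^ (1 + W * k)"
        using k q by (intro power_increasing) (auto simp: B_def intro!: le_SucI)
      also have "\<dots> \<le> g k ^ 4" using k by (simp add: B_def)
      finally show "q ^ (W * K) \<le> g k ^ 4" .
    qed
    also have "\<dots> = (\<Prod>k\<in>B. g k) ^ 4" by (simp add: prod_power_distrib)
    also have "\<dots> \<le> (r * q ^ (2 * K\<^sup>2)) ^ 4" by (intro power_mono P) simp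
    also have "\<dots> = r ^ 4 * q ^ (8 * K\<^sup>2)" by (simp add: power_mult_distrib flip: power_mult)
    finally have "q ^ (4 * K\<^sup>2) * q ^ (8 * K\<^sup>2) \<le> r ^ 4 * q ^ (8 * K\<^sup>2)" by (simp flip: power_add)
    then have "(q ^ K\<^sup>2) ^ 4 \<le> r ^ 4" using q by (simp add: mult.commute flip: power_mult)
    then have "q ^ K\<^sup>2 \<le> r" by (subst (asm) power_mono_iff) auto
    then show False using r by simp
  qed
qed

text \<open>In each dyadic block above \<open>K' \<ge> K\<close> at least half of the
  \<open>k\<close> are good, and each contributes at least \<open>1 / (3 * W * K')\<close>, so every
  block adds \<open>1 / (6 * W)\<close>. The bound on \<open>r\<close> for \<open>K\<close> persists
  for the larger \<open>K'\<close>.\<close>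

lemma good_degrees_harmonic:
  fixes q r W K :: nat
  assumes q: "q \<ge> 2" and K: "K \<ge> 1" and r: "0 < r" "r < q ^ (K\<^sup>2)" and W: "W \<ge> 24"
  shows "(\<Sum>k\<in>{k \<in> {K<..K * 2 ^ J}. gcd r (q ^ (1 + W * k) - 1) ^ 4 \<le> q ^ (1 + W * k)}. 1 / real (1 + W * k))
    \<ge> real J / (6 * W)"
proof (induction J)
  case (Suc J)
  define P where "P k \<longleftrightarrow> gcd r (q ^ (1 + W * k) - 1) ^ 4 \<le> q ^ (1 + W * k)" for k
  define K' where "K' = K * 2 ^ J"
  have KK: "K \<le> K'" by (simp add: K'_def)
  have split: "{k \<in> {K<..K * 2 ^ Suc J}. P k} = {k \<in> {K<..K * 2 ^ J}. P k} \<union> {k \<in> {K'<..2 * K'}. P k}"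
    unfolding K'_def
    by (force dest: le_less_trans[OF KK[unfolded K'_def]])
  have "r < q ^ (K'\<^sup>2)"
    using r(2) power_increasing[of "K\<^sup>2" "K'\<^sup>2" q] q KK by (meson less_le_trans one_le_numeral order_trans power_mono zero_le)
  then have bad: "2 * card {k \<in> {K'<..2 * K'}. \<not> P k} \<le> K'"
    using few_bad_degrees[OF q r(1) _ W, of K'] by (simp add: P_def not_le)
  have "card {K'<..2 * K'} = card ({k \<in> {K'<..2 * K'}. P k} \<union> {k \<in> {K'<..2 * K'}. \<not> P k})"
    by (rule arg_cong[of _ _ card]) auto
  also have "\<dots> = card {k \<in> {K'<..2 * K'}. P k} + card {k \<in> {K'<..2 * K'}. \<not> P k}"
    by (rule card_Un_disjoint) auto
  finally have "K' = card {k \<in> {K'<..2 * K'}. P k} + card {k \<in> {K'<..2 * K'}. \<not> P k}" by simp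
  then have good: "real K' \<le> 2 * real (card {k \<in> {K'<..2 * K'}. P k})" using bad by linarith
  have K'0: "real K' \<ge> 1" "real W \<ge> 24" using KK K W by auto
  have "1 / (6 * real W) = (K' / 2) * (1 / (3 * W * K'))" using K'0 by simp
  also have "\<dots> \<le> real (card {k \<in> {K'<..2 * K'}. P k}) * (1 / (3 * W * K'))"
    using good by (intro mult_right_mono) auto
  also have "\<dots> = (\<Sum>k\<in>{k \<in> {K'<..2 * K'}. P k}. 1 / (3 * W * K'))" by simp
  also have "\<dots> \<le> (\<Sum>k\<in>{k \<in> {K'<..2 * K'}. P k}. 1 / real (1 + W * k))"
  proof (intro sum_mono divide_left_mono)
    fix k assume k: "k \<in> {k \<in> {K'<..2 * K'}. P k}"
    have "W * k \<le> W * (2 * K')" using k by (intro mult_left_mono) auto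
    moreover have "1 \<le> W * K'" using KK K W by (simp add: Suc_le_eq)
    ultimately have "1 + W * k \<le> W * K' + W * (2 * K')" by (intro add_mono)
    also have "\<dots> = 3 * W * K'" by simp
    finally have "1 + W * k \<le> 3 * W * K'" .
    then show "real (1 + W * k) \<le> real (3 * W * K')" by (simp only: of_nat_le_iff)
    have "0 < 1 + W * k" "0 < 3 * W * K'" using KK K W by auto
    then show "0 < real (3 * W * K') * real (1 + W * k)" by (intro mult_pos_pos) (simp_all only: of_nat_0_less_iff)
  qed simp
  finally have "real (Suc J) / (6 * W) \<le> (\<Sum>k\<in>{k \<in> {K<..K * 2 ^ J}. P k}. 1 / real (1 + W * k)) +
      (\<Sum>k\<in>{k \<in> {K'<..2 * K'}. P k}. 1 / real (1 + W * k))"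
    using Suc.IH by (simp add: P_def add_divide_distrib)
  also have "\<dots> = (\<Sum>k\<in>{k \<in> {K<..K * 2 ^ Suc J}. P k}. 1 / real (1 + W * k))"
    unfolding split by (rule sum.union_disjoint[symmetric]) (auto simp: K'_def)
  finally show ?case unfolding P_def .
qed simp

section \<open>The limit over the finite field\<close>

context finite_field
begin

text \<open>In a good degree the gcd is at most the fourth root of \<open>q ^ d\<close>, so the
  error is of order \<open>q ^ (3 * d / 4)\<close> against \<open>q ^ d\<close>.\<close>

lemma error_eventually_small:
  assumes "\<eta> > 0"
  shows "\<exists>d0. \<forall>d\<ge>d0. (sqrt (sqrt (real q ^ d)) + 2) * sqrt (real q ^ d) \<le> \<eta> * \<tau> d"
proof -
  have "((\<lambda>x :: real. (sqrt (sqrt x) + 2) * sqrt x / (x - 1)) \<longlongrightarrow> 0) at_top"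
    by real_asymp
  moreover have "filterlim (\<lambda>d. real q ^ d) at_top sequentially"
  proof (rule filterlim_at_top_mono[OF filterlim_real_sequentially], intro always_eventually allI)
    fix d
    have "d < q ^ d" using q_ge_2 by (intro power_gt_expt) auto
    then have "real d \<le> real (q ^ d)" by (intro of_nat_mono) simp
    then show "real d \<le> real q ^ d" by simp
  qed
  ultimately have "((\<lambda>d. (sqrt (sqrt (real q ^ d)) + 2) * sqrt (real q ^ d) / (real q ^ d - 1)) \<longlongrightarrow> 0) sequentially"
    by (rule filterlim_compose)
  then have "eventually (\<lambda>d. (sqrt (sqrt (real q ^ d)) + 2) * sqrt (real q ^ d) / (real q ^ d - 1) < \<eta>) sequentially"
    using assms by (rule order_tendstoD)
  then have "eventually (\<lambda>d. (sqrt (sqrt (real q ^ d)) + 2) * sqrt (real q ^ d) \<le> \<eta> * \<tau> d) sequentially"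
    using eventually_ge_at_top[of 1]
  proof eventually_elim
    case (elim d)
    then show ?case using \<tau>_pos[of d] by (simp add: \<tau>_def divide_less_eq)
  qed
  then show ?thesis by (simp add: eventually_sequentially)
qed

theorem trace_equidistribution:
  assumes r: "\<And>n. n \<ge> 1 \<Longrightarrow> r n > 0"
    and growth: "(\<lambda>n. ln (real (r n))) \<in> o(\<lambda>n. (real n)\<^sup>2)"
  shows "(\<lambda>n. avg n (\<lambda>A. if mat_trace (A ^\<^sub>m r n) = c then 1 else 0)) \<longlonglongrightarrow> 1 / q"
proof (rule LIMSEQ_I)
  fix \<epsilon> :: real assume \<epsilon>: "\<epsilon> > 0"
  \<comment> \<open>Makes \<open>\<eta>\<close> and the square root at most
    \<open>\<epsilon> / 4\<close> each; under the root, \<open>\<epsilon>\<^sup>2 / 16\<close> is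
    split evenly between \<open>1 / \<Delta>\<close> and \<open>2 * \<eta>\<close>.\<close>
  define \<eta> where "\<eta> = min (\<epsilon> / 4) (\<epsilon>\<^sup>2 / 64)"
  have \<eta>: "\<eta> > 0" "\<eta> \<le> \<epsilon> / 4" "2 * \<eta> \<le> \<epsilon>\<^sup>2 / 32" using \<epsilon> by (auto simp: \<eta>_def min_def)
  \<comment> \<open>At least 24 for \<open>few_bad_degrees\<close>, and divisible by
    \<open>p\<close> so that all degrees are 1 modulo \<open>p\<close>.\<close>
  define W where "W = 24 * p"
  have W: "W \<ge> 24" "p dvd W" using prime_char by (auto simp: W_def dest: prime_gt_0_nat)
  \<comment> \<open>The number of dyadic blocks, large enough for \<open>J / (6 * W)\<close> to be
    at least \<open>32 / \<epsilon>\<^sup>2\<close>.\<close>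
  define J where "J = Suc (nat \<lceil>192 * W / \<epsilon>\<^sup>2\<rceil>)"
  have J: "6 * W / J \<le> \<epsilon>\<^sup>2 / 32" "J \<ge> 1"
  proof -
    have "192 * W / \<epsilon>\<^sup>2 \<le> J" unfolding J_def by linarith
    moreover have "J > 0" by (simp only: J_def zero_less_Suc)
    ultimately show "6 * W / J \<le> \<epsilon>\<^sup>2 / 32" using \<epsilon> by (simp add: field_simps)
  qed (simp add: J_def)
  obtain d0 where d0: "(sqrt (sqrt (real q ^ d)) + 2) * sqrt (real q ^ d) \<le> \<eta> * \<tau> d" if "d \<ge> d0" for d
    using error_eventually_small[OF \<eta>(1)] by blast
  \<comment> \<open>The degrees reach up to \<open>1 + M * K0\<close>, so \<open>K0\<close> may be
    about \<open>n / M\<close>.\<close>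
  define M where "M = W * 2 ^ J"
  have M: "M \<ge> 1" using W by (simp add: M_def Suc_le_eq)
  have lnq: "ln (real q) > 0" using q_ge_2 by simp
  \<comment> \<open>From \<open>K0 \<ge> n / (2 * M)\<close> follows
    \<open>K0\<^sup>2 * ln q \<ge> 2 * \<delta> * n\<^sup>2\<close>; the spare factor 2 makes
    \<open>r n < q ^ (K0\<^sup>2)\<close> strict.\<close>
  define \<delta> where "\<delta> = ln (real q) / (8 * M\<^sup>2)"
  have \<delta>: "\<delta> > 0" using lnq M by (simp add: \<delta>_def)
  have "eventually (\<lambda>n. \<bar>ln (real (r n))\<bar> \<le> \<delta> * (real n)\<^sup>2) sequentially"
    using landau_o.smallD[OF growth \<delta>] by simp
  then obtain n0 where n0: "\<bar>ln (real (r n))\<bar> \<le> \<delta> * (real n)\<^sup>2" if "n \<ge> n0" for n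
    by (auto simp: eventually_sequentially)
  show "\<exists>no. \<forall>n\<ge>no. norm (avg n (\<lambda>A. if mat_trace (A ^\<^sub>m r n) = c then 1 else 0) - 1 / q) < \<epsilon>"
  proof (intro exI allI impI)
    fix n assume n: "n \<ge> max n0 (2 * M * (d0 + 2))"
    define K0 where "K0 = (n - 1) div M"
    have n1: "n \<ge> 1" using n M by (cases n) auto
    have nM: "n \<ge> 2 * M + 2" using n M by (intro order_trans[OF _ n]) (simp add: algebra_simps)
    have K0n: "real n / (2 * M) \<le> K0"
    proof -
      have "n - 1 < M * (K0 + 1)" using M unfolding K0_def
        by (metis Suc_eq_plus1 dividend_less_times_div mult_Suc_right add.commute gr0I not_one_le_zero)
      then have "real n \<le> M * (real K0 + 1)" using n1
        by (metis (mono_tags, lifting) Suc_diff_1 Suc_le_eq less_eq_Suc_le of_nat_1 of_nat_add of_nat_le_iff of_nat_mult One_nat_def)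
      moreover have "real n \<ge> 2 * M" using nM by linarith
      ultimately have "real n / 2 \<le> M * real K0" by (simp add: algebra_simps)
      then show ?thesis using M by (simp add: field_simps)
    qed
    have K0d: "d0 + 2 \<le> K0"
    proof -
      have "real (2 * M * (d0 + 2)) \<le> real n" using n by (simp only: of_nat_le_iff max.bounded_iff)
      then have "real (d0 + 2) \<le> real n / (2 * M)" using M by (simp add: field_simps)
      then show ?thesis using K0n by (meson of_nat_le_iff order_trans)
    qed
    have rn: "r n > 0" using r n1 by simp
    have rK: "r n < q ^ (K0\<^sup>2)"
    proof -
      have "ln (real (r n)) \<le> \<delta> * (real n)\<^sup>2" using n0[of n] n by simp
      also have "\<dots> = (real n / (2 * M))\<^sup>2 * ln q / 2"
        using M by (simp add: \<delta>_def power_divide power_mult_distrib field_simps)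
      also have "\<dots> < (real n / (2 * M))\<^sup>2 * ln q" using n1 M lnq by simp
      also have "\<dots> \<le> (real K0)\<^sup>2 * ln q" using K0n lnq by (intro mult_right_mono power_mono) auto
      also have "\<dots> = ln (real (q ^ (K0\<^sup>2)))" using q_ge_2 by (simp add: ln_realpow)
      finally show ?thesis using rn q_ge_2 by (simp only: ln_less_cancel_iff of_nat_0_less_iff zero_less_power of_nat_less_iff)
    qed
    define S where "S = {k \<in> {K0<..K0 * 2 ^ J}. gcd (r n) (q ^ (1 + W * k) - 1) ^ 4 \<le> q ^ (1 + W * k)}"
    define D where "D = (\<lambda>k. 1 + W * k) ` S"
    define \<Delta> where "\<Delta> = (\<Sum>d\<in>D. 1 / real d)"
    have "\<Delta> = (\<Sum>k\<in>S. 1 / real (1 + W * k))"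
      unfolding \<Delta>_def D_def using W by (subst sum.reindex) (auto simp: inj_on_def)
    also have "\<dots> \<ge> J / (6 * W)"
      unfolding S_def using K0d by (intro good_degrees_harmonic q_ge_2 rn rK W) auto
    finally have \<Delta>: "J / (6 * W) \<le> \<Delta>" .
    have JW: "0 < J / (6 * real W)" using J W by simp
    have "\<bar>avg n (\<lambda>A. if mat_trace (A ^\<^sub>m r n) = c then 1 else 0) - 1 / q\<bar> \<le> \<eta> + sqrt (1 / \<Delta> + 2 * \<eta>)"
    proof (rule trace_equidistribution_bound[OF _ _ _ rn _ \<Delta>_def])
      show "finite D" by (simp add: D_def S_def)
      show "D \<noteq> {}" using \<Delta> JW by (auto simp: \<Delta>_def)
    next
      fix d assume "d \<in> D"
      then obtain k where k: "d = 1 + W * k" "k \<in> S" by (auto simp: D_def)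
      have "W * k \<le> W * (K0 * 2 ^ J)" using k by (intro mult_left_mono) (auto simp: S_def)
      also have "\<dots> = M * K0" by (simp add: M_def)
      also have "\<dots> \<le> n - 1" by (simp add: K0_def)
      finally have "d \<le> n" using k n1 by simp
      moreover have "\<not> p dvd d"
      proof
        assume "p dvd d"
        then have "p dvd 1" using k(1) W(2) by (metis add.commute dvd_add_right_iff dvd_mult2)
        then show False using prime_char by (simp add: prime_nat_iff)
      qed
      ultimately show "1 \<le> d \<and> d \<le> n \<and> \<not> p dvd d" using k by simp
      have "d0 \<le> d"
      proof -
        have "K0 < k" using k by (simp add: S_def)
        also have "k \<le> W * k" using W by simp
        finally show ?thesis using k(1) K0d by simp
      qed
      define g where "g = gcd (r n) (q ^ d - 1)"
      have "g ^ 4 \<le> q ^ d" using k by (simp add: g_def S_def)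
      then have "real g ^ 4 \<le> real q ^ d" by (metis of_nat_le_iff of_nat_power)
      then have "((real g)\<^sup>2)\<^sup>2 \<le> real q ^ d" by (simp flip: power_mult)
      then have "(real g)\<^sup>2 \<le> sqrt (real q ^ d)" by (rule real_le_rsqrt)
      then have "real g \<le> sqrt (sqrt (real q ^ d))" by (rule real_le_rsqrt)
      then have "(real g + 2) * sqrt (real q ^ d) \<le> (sqrt (sqrt (real q ^ d)) + 2) * sqrt (real q ^ d)"
        by (intro mult_right_mono) auto
      also have "\<dots> \<le> \<eta> * \<tau> d" by (rule d0) fact
      finally show "(real (gcd (r n) (q ^ d - 1)) + 2) * sqrt (real q ^ d) \<le> \<eta> * \<tau> d" by (simp add: g_def)
    qed
    also have "\<eta> + sqrt (1 / \<Delta> + 2 * \<eta>) \<le> \<eta> + sqrt (\<epsilon>\<^sup>2 / 32 + \<epsilon>\<^sup>2 / 32)"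
    proof -
      have "\<Delta> > 0" using \<Delta> JW by linarith
      then have "1 / \<Delta> \<le> 1 / (J / (6 * W))" using \<Delta> JW by (intro divide_left_mono mult_pos_pos) simp_all
      also have "\<dots> \<le> \<epsilon>\<^sup>2 / 32" using J(1) by simp
      finally show ?thesis using \<eta>(3) by (intro add_left_mono real_sqrt_le_mono add_mono)
    qed
    also have "\<epsilon>\<^sup>2 / 32 + \<epsilon>\<^sup>2 / 32 = (\<epsilon> / 4)\<^sup>2" by (simp add: power2_eq_square)
    also have "\<eta> + sqrt ((\<epsilon> / 4)\<^sup>2) < \<epsilon>" using \<eta>(2) \<epsilon> by simp
    finally show "norm (avg n (\<lambda>A. if mat_trace (A ^\<^sub>m r n) = c then 1 else 0) - 1 / q) < \<epsilon>" by simp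
  qed
qed

end

section \<open>Absolute values and square roots\<close>

context nonarch_field
begin

lemma absv_0 [simp]: "absv 0 = 0"
  by (simp add: absv_eq_0_iff)

lemma absv_1 [simp]: "absv 1 = 1"
  using absv_mult[of 1 1] absv_eq_0_iff[of 1] by simp

lemma absv_minus [simp]: "absv (- x) = absv x"
proof -
  have "absv (- 1) * absv (- 1) = 1" using absv_mult[of "- 1" "- 1"] by simp
  then have "absv (- 1) = 1" using absv_nonneg[of "- 1"] by (simp add: square_eq_1_iff)
  then show ?thesis using absv_mult[of "- 1" x] by simp
qed

lemma absv_minus_commute: "absv (x - y) = absv (y - x)"
  using absv_minus[of "x - y"] by simp

lemma absv_pos: "x \<noteq> 0 \<Longrightarrow> absv x > 0"
  using absv_nonneg[of x] absv_eq_0_iff[of x] by linarith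

lemma absv_inverse: "absv (inverse x) = inverse (absv x)"
proof (cases "x = 0")
  case False
  then have "absv x * absv (inverse x) = 1" using absv_mult[of x "inverse x"] by simp
  then show ?thesis by (metis inverse_unique)
qed simp

lemma absv_divide: "absv (x / y) = absv x / absv y"
  by (simp add: divide_inverse absv_mult absv_inverse)

lemma absv_power: "absv (x ^ n) = absv x ^ n"
  by (induction n) (auto simp: absv_mult)

lemma absv_add_le: "absv x \<le> c \<Longrightarrow> absv y \<le> c \<Longrightarrow> absv (x + y) \<le> c"
  using absv_ultrametric[of x y] by linarith

lemma absv_add_less: "absv x < c \<Longrightarrow> absv y < c \<Longrightarrow> absv (x + y) < c"
  using absv_ultrametric[of x y] by linarith

lemma absv_diff_le: "absv x \<le> c \<Longrightarrow> absv y \<le> c \<Longrightarrow> absv (x - y) \<le> c"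
  using absv_add_le[of x c "- y"] by simp

lemma absv_diff_less: "absv x < c \<Longrightarrow> absv y < c \<Longrightarrow> absv (x - y) < c"
  using absv_add_less[of x c "- y"] by simp

lemma absv_sum_le: "(\<And>i. i \<in> I \<Longrightarrow> absv (f i) \<le> c) \<Longrightarrow> 0 \<le> c \<Longrightarrow> absv (sum f I) \<le> c"
  by (induction I rule: infinite_finite_induct) (auto intro: absv_add_le)

lemma absv_mult_le_1: "absv x \<le> 1 \<Longrightarrow> absv y \<le> 1 \<Longrightarrow> absv (x * y) \<le> 1"
  by (simp add: absv_mult absv_nonneg mult_le_one)

lemma absv_mult_less_1: "absv x < 1 \<Longrightarrow> absv y \<le> 1 \<Longrightarrow> absv (x * y) < 1"
  using mult_mono[of "absv x" "absv x" "absv y" 1] absv_nonneg[of x] absv_nonneg[of y] by (simp add: absv_mult)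

lemma absv_mult_less_1': "absv x \<le> 1 \<Longrightarrow> absv y < 1 \<Longrightarrow> absv (x * y) < 1"
  using absv_mult_less_1[of y x] by (simp add: mult.commute)

text \<open>The dominant summand decides: \<open>y\<close> is recovered as
  \<open>(x + y) - x\<close>.\<close>

lemma absv_add_eq: "absv x < absv y \<Longrightarrow> absv (x + y) = absv y"
  using absv_ultrametric[of x y] absv_ultrametric[of "x + y" "- x"] by simp

lemma absv_eq_of_close: "absv (x - y) < absv y \<Longrightarrow> absv x = absv y"
  using absv_add_eq[of "x - y" y] by simp

text \<open>Supplies a finite set of digits for expansions in powers of \<open>p\<close>.\<close>

lemma finite_representatives:
  assumes "finite (residue_field absv)"
  obtains T where "finite T" "T \<subseteq> integers absv" "\<forall>x. absv x \<le> 1 \<longrightarrow> (\<exists>t\<in>T. absv (x - t) < 1)"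
proof -
  let ?R = "{(x, y). x \<in> integers absv \<and> y \<in> integers absv \<and> x - y \<in> maximal_ideal absv}"
  define T where "T = (\<lambda>C. SOME x. x \<in> C) ` residue_field absv"
  have *: "\<exists>t\<in>T. absv t \<le> 1 \<and> absv (x - t) < 1" if x: "absv x \<le> 1" for x
  proof -
    have C: "?R `` {x} \<in> residue_field absv"
      unfolding residue_field_def using x by (intro quotientI) (simp add: integers_def)
    have "x \<in> ?R `` {x}" using x by (simp add: integers_def maximal_ideal_def)
    define t where "t = (SOME t. t \<in> ?R `` {x})"
    have "t \<in> ?R `` {x}" unfolding t_def using \<open>x \<in> ?R `` {x}\<close> by (rule someI)
    then have "absv t \<le> 1 \<and> absv (x - t) < 1" by (simp add: integers_def maximal_ideal_def)
    moreover have "t \<in> T" unfolding T_def t_def by (rule imageI[OF C])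
    ultimately show ?thesis by blast
  qed
  show thesis
  proof (rule that[of "T \<inter> integers absv"])
    show "finite (T \<inter> integers absv)" using assms by (simp add: T_def)
    show "\<forall>x. absv x \<le> 1 \<longrightarrow> (\<exists>t\<in>T \<inter> integers absv. absv (x - t) < 1)"
      using * by (fastforce simp: integers_def)
  qed simp
qed

end

context padic_extension
begin

section \<open>Values in a p-adic extension\<close>

lemma p_gt_1: "real p > 1"
  using prime_gt_1_nat[OF prime_p] by simp

lemma absv_of_nat: "n > 0 \<Longrightarrow> absv (of_nat n) = real p powi (- int (multiplicity p n))"
proof -
  assume n: "n > 0"
  have "quotient_of (of_nat n) = (int n, 1)"
    by (simp add: quotient_of_Fract normalize_def flip: Fract_of_nat_eq)
  moreover have "multiplicity (int p) (int n) = multiplicity p n"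
  proof (rule multiplicity_eqI)
    show "int p ^ multiplicity p n dvd int n" using multiplicity_dvd[of p n] by (metis int_dvd_int_iff of_nat_power)
    show "\<not> int p ^ Suc (multiplicity p n) dvd int n"
    proof
      assume "int p ^ Suc (multiplicity p n) dvd int n"
      then have "p ^ Suc (multiplicity p n) dvd n" by (metis int_dvd_int_iff of_nat_power)
      then have "Suc (multiplicity p n) \<le> multiplicity p n"
        using n prime_p by (intro multiplicity_geI) (auto simp: prime_nat_iff)
      then show False by simp
    qed
  qed
  ultimately have "padic_abs p (of_nat n) = real p powi (- int (multiplicity p n))"
    using n by (simp add: padic_abs_def padic_val_def)
  then show ?thesis using absv_of_rat[of "of_nat n"] by simp
qed

lemma absv_p: "absv (of_nat p) = 1 / real p"
  using absv_of_nat[of p] prime_p by (simp add: prime_gt_0_nat power_int_minus divide_inverse)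

lemma absv_of_nat_coprime: "n > 0 \<Longrightarrow> \<not> p dvd n \<Longrightarrow> absv (of_nat n) = 1"
  using absv_of_nat[of n] by (simp add: not_dvd_imp_multiplicity_0)

lemma absv_of_nat_le_1: "absv (of_nat n) \<le> 1"
  by (induction n) (auto intro: absv_add_le)

lemma Qp_0: "0 \<in> Qp" and Qp_1: "1 \<in> Qp" and Qp_of_nat: "of_nat n \<in> Qp"
  using Rats_subset_Qp by auto

lemma Qp_add: "x \<in> Qp \<Longrightarrow> y \<in> Qp \<Longrightarrow> x + y \<in> Qp"
  using Qp_diff[of x "0 - y"] Qp_diff[of 0 y] Qp_0 by simp

lemma Qp_sum: "(\<And>i. i \<in> I \<Longrightarrow> f i \<in> Qp) \<Longrightarrow> sum f I \<in> Qp"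
  by (induction I rule: infinite_finite_induct) (auto intro: Qp_add Qp_0)

text \<open>A rational number closer to \<open>x\<close> than \<open>absv x\<close> has the same
  absolute value as \<open>x\<close>.\<close>

lemma Qp_value_group: "x \<in> Qp \<Longrightarrow> x \<noteq> 0 \<Longrightarrow> \<exists>k. absv x = real p powi k"
proof -
  assume x: "x \<in> Qp" "x \<noteq> 0"
  interpret M: Metric_space UNIV "abs_dist absv" by (rule Metric_space_abs_dist)
  have "x \<in> M.mtopology closure_of \<rat>"
    using x Rats_dense_Qp by (auto simp: field_topology_def)
  then obtain y where y: "y \<in> \<rat>" "y \<in> M.mball x (absv x)"
    using absv_pos[OF x(2)] by (auto simp: M.metric_closure_of)
  then have d: "absv (x - y) < absv x" by (simp add: abs_dist_def)
  then have eq: "absv y = absv x" using absv_eq_of_close[of y x] absv_minus_commute by simp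
  obtain t where t: "y = of_rat t" using y(1) by (elim Rats_cases)
  have "t \<noteq> 0" using eq t absv_pos[OF x(2)] by auto
  then have "absv y = real p powi (- padic_val p t)"
    using t absv_of_rat[of t] by (simp add: padic_abs_def)
  then show ?thesis using eq by metis
qed

end

context unramified_padic_extension
begin

lemma value_group: "x \<noteq> 0 \<Longrightarrow> \<exists>k. absv x = real p powi k"
proof -
  assume "x \<noteq> 0"
  then have "absv x \<in> absv ` (UNIV - {0})" by simp
  then obtain y where "y \<in> Qp" "y \<noteq> 0" "absv x = absv y" unfolding value_group_eq by auto
  then show ?thesis using Qp_value_group[of y] by simp
qed

text \<open>All nonzero values are integral powers of \<open>p\<close>, because the extension is
  unramified. Hence \<open>p\<close> itself is a uniformizer.\<close>

lemma absv_less_1D: "absv x < 1 \<Longrightarrow> absv x \<le> 1 / real p"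
proof (cases "x = 0")
  case False
  assume lt: "absv x < 1"
  obtain k where k: "absv x = real p powi k" using value_group[OF False] by blast
  have "k < 0"
  proof (rule ccontr)
    assume "\<not> k < 0"
    then have "1 \<le> real p powi k" using p_gt_1 by (intro one_le_power_int) auto
    then show False using lt k by simp
  qed
  then have "real p powi k \<le> real p powi (- 1)" using p_gt_1 by (intro power_int_increasing) auto
  then show ?thesis using k by (simp add: power_int_minus divide_inverse)
qed (use p_gt_1 in simp)

text \<open>Completeness is assumed for \<open>Qp\<close> only. Since the digits come from a finite
  set, the series can be sorted by digit: the coefficient of each digit is a subseries of the powers
  of \<open>p\<close>, which converges in \<open>Qp\<close>.\<close>

lemma series_converges:
  assumes "finite T" "\<And>i. t i \<in> T" "T \<subseteq> integers absv"
  shows "\<exists>y. \<forall>\<epsilon>>0. \<exists>N. \<forall>n\<ge>N. absv ((\<Sum>i<n. t i * of_nat p ^ Suc i) - y) < \<epsilon>"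
proof -
  interpret Q: Metric_space Qp "abs_dist absv" by (rule Metric_space_abs_dist)
  \<comment> \<open>The partial sum of the powers of \<open>p\<close> over the positions that carry
    the digit \<open>c\<close>.\<close>
  define z :: "'a \<Rightarrow> nat \<Rightarrow> 'a" where "z c n = (\<Sum>i<n. if t i = c then of_nat p ^ Suc i else 0)" for c n
  have p0: "1 / real p < 1" "0 < 1 / real p" using p_gt_1 by auto
  have zQ: "z c n \<in> Qp" for c n
  proof -
    have "of_nat (p ^ k) \<in> Qp" for k by (rule Qp_of_nat)
    then show ?thesis unfolding z_def by (intro Qp_sum) (auto simp: Qp_0 simp del: power_Suc)
  qed
  have tail: "absv (z c n - z c m) \<le> (1 / real p) ^ m" if "m \<le> n" for c m n
  proof -
    have "{..<n} = {..<m} \<union> {m..<n}" using that by auto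
    then have "z c n = z c m + (\<Sum>i\<in>{m..<n}. if t i = c then of_nat p ^ Suc i else 0)"
      unfolding z_def by (simp add: sum.union_disjoint[symmetric] ivl_disj_int)
    then have "z c n - z c m = (\<Sum>i\<in>{m..<n}. if t i = c then of_nat p ^ Suc i else 0)" by simp
    also have "absv \<dots> \<le> (1 / real p) ^ m"
    proof (rule absv_sum_le)
      fix i assume i: "i \<in> {m..<n}"
      have "absv (of_nat p ^ Suc i) = (1 / real p) ^ Suc i" by (simp only: absv_power absv_p)
      also have "\<dots> \<le> (1 / real p) ^ m" using i p0 by (intro power_decreasing) auto
      finally show "absv (if t i = c then of_nat p ^ Suc i else 0) \<le> (1 / real p) ^ m" using p0 by simp
    qed (use p0 in simp)
    finally show ?thesis .
  qed
  have ex: "\<exists>l. \<forall>\<epsilon>>0. \<exists>N. \<forall>n\<ge>N. absv (z c n - l) < \<epsilon>" for c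
  proof -
    have "Q.MCauchy (z c)"
      unfolding Q.MCauchy_def
    proof (intro conjI allI impI)
      fix \<epsilon> :: real assume "\<epsilon> > 0"
      then obtain N where N: "(1 / real p) ^ N < \<epsilon>"
        using real_arch_pow_inv[OF _ p0(1)] by blast
      have "absv (z c n - z c n') < \<epsilon>" if nn: "N \<le> n" "N \<le> n'" for n n'
      proof -
        have "absv ((z c n - z c N) - (z c n' - z c N)) \<le> (1 / real p) ^ N"
          by (rule absv_diff_le[OF tail[OF nn(1)] tail[OF nn(2)]])
        then show ?thesis using N by simp
      qed
      then show "\<exists>N. \<forall>n n'. N \<le> n \<longrightarrow> N \<le> n' \<longrightarrow> abs_dist absv (z c n) (z c n') < \<epsilon>"
        by (auto simp: abs_dist_def)
    qed (use zQ in auto)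
    then obtain l where "limitin Q.mtopology (z c) l sequentially"
      using Qp_complete unfolding Q.mcomplete_def by blast
    then have "\<forall>\<epsilon>>0. \<exists>N. \<forall>n\<ge>N. absv (z c n - l) < \<epsilon>"
      unfolding Q.limit_metric_sequentially abs_dist_def by meson
    then show ?thesis ..
  qed
  define l where "l c = (SOME l. \<forall>\<epsilon>>0. \<exists>N. \<forall>n\<ge>N. absv (z c n - l) < \<epsilon>)" for c
  have l: "\<forall>\<epsilon>>0. \<exists>N. \<forall>n\<ge>N. absv (z c n - l c) < \<epsilon>" for c
    unfolding l_def using ex[of c] by (rule someI_ex)
  define y where "y = (\<Sum>c\<in>T. c * l c)"
  have eq: "(\<Sum>i<n. t i * of_nat p ^ Suc i) = (\<Sum>c\<in>T. c * z c n)" for n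
  proof -
    have "(\<Sum>c\<in>T. c * z c n) = (\<Sum>c\<in>T. \<Sum>i<n. if t i = c then c * of_nat p ^ Suc i else 0)"
      unfolding z_def by (auto simp: sum_distrib_left intro!: sum.cong)
    also have "\<dots> = (\<Sum>i<n. \<Sum>c\<in>T. if t i = c then c * of_nat p ^ Suc i else 0)" by (rule sum.swap)
    also have "\<dots> = (\<Sum>i<n. t i * of_nat p ^ Suc i)" using assms by simp
    finally show ?thesis by simp
  qed
  show ?thesis
  proof (intro exI[of _ y] allI impI)
    fix \<epsilon> :: real assume e: "\<epsilon> > 0"
    then have "\<forall>c. \<exists>N. \<forall>n\<ge>N. absv (z c n - l c) < \<epsilon> / 2" using l by (meson half_gt_zero)
    then have "\<exists>N. \<forall>c. \<forall>n\<ge>N c. absv (z c n - l c) < \<epsilon> / 2" by (rule choice)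
    then obtain N where N: "\<forall>c. \<forall>n\<ge>N c. absv (z c n - l c) < \<epsilon> / 2" ..
    define M where "M = Max (insert 0 (N ` T))"
    have "absv ((\<Sum>i<n. t i * of_nat p ^ Suc i) - y) < \<epsilon>" if n: "n \<ge> M" for n
    proof -
      have "absv (c * (z c n - l c)) \<le> \<epsilon> / 2" if "c \<in> T" for c
      proof -
        have "N c \<le> M" unfolding M_def using assms that by (intro Max_ge) auto
        then have "absv (z c n - l c) \<le> \<epsilon> / 2" using N n by (meson less_imp_le order_trans)
        moreover have "absv c \<le> 1" using assms that by (auto simp: integers_def)
        ultimately have "absv c * absv (z c n - l c) \<le> 1 * (\<epsilon> / 2)" using absv_nonneg by (intro mult_mono) auto
        then show ?thesis by (simp add: absv_mult)
      qed
      then have "absv (\<Sum>c\<in>T. c * (z c n - l c)) \<le> \<epsilon> / 2" using e by (intro absv_sum_le) auto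
      then show ?thesis unfolding eq y_def using e by (simp add: right_diff_distrib sum_subtractf)
    qed
    then show "\<exists>N. \<forall>n\<ge>N. absv ((\<Sum>i<n. t i * of_nat p ^ Suc i) - y) < \<epsilon>" by blast
  qed
qed

text \<open>Hensel lifting from the approximate root 1, one digit at a time; 2 is a unit as
  \<open>p\<close> is odd. The digits are taken from a finite set so that
  \<open>series_converges\<close> provides the limit.\<close>

lemma one_units_are_squares:
  assumes odd: "odd p" and fin: "finite (residue_field absv)" and a: "absv (a - 1) < 1"
  shows "\<exists>y. y\<^sup>2 = a"
proof -
  obtain T where T: "finite T" "T \<subseteq> integers absv" "\<forall>x. absv x \<le> 1 \<longrightarrow> (\<exists>t\<in>T. absv (x - t) < 1)"
    by (rule finite_representatives[OF fin])
  define P :: "nat \<Rightarrow> 'a" where "P j = of_nat p ^ Suc j" for j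
  have p0: "1 / real p < 1" "0 < 1 / real p" using p_gt_1 by auto
  have P: "absv (P j) = (1 / real p) ^ Suc j" for j by (simp only: P_def absv_power absv_p)
  have P0: "P j \<noteq> 0" for j using P[of j] p_gt_1 by auto
  have two: "absv 2 = 1"
  proof -
    have "\<not> p dvd 2" using odd prime_p
      by (metis dvd_refl even_numeral primes_dvd_imp_eq two_is_prime_nat)
    then show ?thesis using absv_of_nat_coprime[of 2] by simp
  qed
  \<comment> \<open>The Newton correction for the equation \<open>s\<^sup>2 = a\<close>, divided by
    \<open>P j\<close> and rounded to a digit.\<close>
  define tt where "tt s j = (SOME t. t \<in> T \<and> absv (- ((s\<^sup>2 - a) / P j) / (2 * s) - t) < 1)" for s j
  define s where "s = rec_nat 1 (\<lambda>j x. x + tt x j * P j)"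
  have s0: "s 0 = 1" and sS: "s (Suc j) = s j + tt (s j) j * P j" for j by (simp_all add: s_def)
  have inv: "absv (s j - 1) < 1 \<and> absv ((s j)\<^sup>2 - a) \<le> (1 / real p) ^ Suc j \<and> tt (s j) j \<in> T" for j
  proof -
    have tt: "tt (s j) j \<in> T \<and> absv (- (((s j)\<^sup>2 - a) / P j) / (2 * s j) - tt (s j) j) < 1"
      if j: "absv (s j - 1) < 1" "absv ((s j)\<^sup>2 - a) \<le> (1 / real p) ^ Suc j" for j
    proof -
      have sj: "absv (s j) = 1" using absv_eq_of_close[of "s j" 1] j(1) by simp
      have "absv (- (((s j)\<^sup>2 - a) / P j) / (2 * s j)) = absv ((s j)\<^sup>2 - a) / (1 / real p) ^ Suc j"
        unfolding absv_divide absv_minus absv_mult two sj P by simp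
      also have "\<dots> \<le> 1"
      proof -
        have "(1 / real p) ^ Suc j > 0" using p0(2) by (rule zero_less_power)
        then show ?thesis using j(2) by (metis divide_le_eq_1_pos)
      qed
      finally have "\<exists>t. t \<in> T \<and> absv (- (((s j)\<^sup>2 - a) / P j) / (2 * s j) - t) < 1" using T(3) by blast
      then show ?thesis unfolding tt_def by (rule someI_ex)
    qed
    have "absv (s j - 1) < 1 \<and> absv ((s j)\<^sup>2 - a) \<le> (1 / real p) ^ Suc j"
    proof (induction j)
      case 0
      have "absv (1 - a) < 1" using a by (simp add: absv_minus_commute)
      then show ?case using absv_less_1D by (simp add: s0)
    next
      case (Suc j)
      then have j: "absv (s j - 1) < 1" "absv ((s j)\<^sup>2 - a) \<le> (1 / real p) ^ Suc j" by auto
      define t where "t = tt (s j) j"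
      have t: "t \<in> T" "absv (- (((s j)\<^sup>2 - a) / P j) / (2 * s j) - t) < 1" using tt[OF j] by (auto simp: t_def)
      have t1: "absv t \<le> 1" using t T(2) by (auto simp: integers_def)
      have sj: "absv (s j) = 1" using absv_eq_of_close[of "s j" 1] j(1) by simp
      then have sj0: "s j \<noteq> 0" by auto
      have PS: "absv (t * P j) < 1"
      proof -
        have "absv (P j) < 1" unfolding P using p0 by (intro power_Suc_less_one) auto
        then show ?thesis using absv_mult_less_1' t1 by blast
      qed
      have "absv (s (Suc j) - 1) < 1"
        using absv_add_less[OF j(1) PS] by (simp add: sS t_def algebra_simps)
      moreover have "absv ((s (Suc j))\<^sup>2 - a) \<le> (1 / real p) ^ Suc (Suc j)"
      proof -
        define c where "c = ((s j)\<^sup>2 - a) / P j"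
        have "(s (Suc j))\<^sup>2 - a = P j * (c + 2 * s j * t) + t\<^sup>2 * (P j)\<^sup>2"
        proof -
          have "(s (Suc j))\<^sup>2 - a = ((s j)\<^sup>2 - a) + P j * (2 * s j * t) + t\<^sup>2 * (P j)\<^sup>2"
            unfolding sS t_def[symmetric] by (simp add: power2_eq_square algebra_simps)
          also have "(s j)\<^sup>2 - a = P j * c" using P0[of j] by (simp add: c_def)
          finally show ?thesis by (simp only: distrib_left)
        qed
        moreover have "absv (P j * (c + 2 * s j * t)) \<le> (1 / real p) ^ Suc (Suc j)"
        proof -
          define v where "v = c / (2 * s j)"
          have c: "c = 2 * s j * v" using sj0 by (simp add: v_def)
          have "c + 2 * s j * t = - (2 * s j) * (- v - t)"
            unfolding c by (simp add: algebra_simps)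
          then have "absv (c + 2 * s j * t) = absv (- v - t)"
            by (simp only: absv_mult absv_minus two sj mult_1)
          also have "\<dots> < 1" using t(2) by (simp add: c_def v_def)
          finally have "absv (c + 2 * s j * t) \<le> 1 / real p" by (rule absv_less_1D)
          then have "absv (P j) * absv (c + 2 * s j * t) \<le> (1 / real p) ^ Suc j * (1 / real p)"
            unfolding P using p0 by (intro mult_left_mono) auto
          then show ?thesis by (simp add: absv_mult mult_ac)
        qed
        moreover have "absv (t\<^sup>2 * (P j)\<^sup>2) \<le> (1 / real p) ^ Suc (Suc j)"
        proof -
          have "absv (t\<^sup>2 * (P j)\<^sup>2) = absv t ^ 2 * ((1 / real p) ^ Suc j) ^ 2" by (simp only: absv_mult absv_power P)
          also have "\<dots> \<le> 1 * ((1 / real p) ^ Suc j) ^ 2"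
            using t1 absv_nonneg[of t] by (intro mult_right_mono power_le_one) auto
          also have "\<dots> = (1 / real p) ^ (2 * Suc j)" by (simp only: mult_1 mult.commute flip: power_mult)
          also have "\<dots> \<le> (1 / real p) ^ Suc (Suc j)" using p0 by (intro power_decreasing) auto
          finally show ?thesis .
        qed
        ultimately show ?thesis by (simp only: absv_add_le)
      qed
      ultimately show ?case ..
    qed
    then show ?thesis using tt by blast
  qed
  have s_sum: "s n = 1 + (\<Sum>i<n. tt (s i) i * of_nat p ^ Suc i)" for n
    by (induction n) (auto simp: s0 sS P_def)
  obtain y where y: "\<forall>\<epsilon>>0. \<exists>N. \<forall>n\<ge>N. absv ((\<Sum>i<n. tt (s i) i * of_nat p ^ Suc i) - y) < \<epsilon>"
    using series_converges[of T "\<lambda>i. tt (s i) i"] T inv by blast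
  define w where "w = 1 + y"
  have small: "absv (w\<^sup>2 - a) < \<epsilon>" if e: "\<epsilon> > 0" for \<epsilon>
  proof -
    define \<delta> where "\<delta> = min \<epsilon> 1"
    have \<delta>: "\<delta> > 0" "\<delta> \<le> 1" "\<delta> \<le> \<epsilon>" using e by (auto simp: \<delta>_def)
    have sw: "s n - w = (\<Sum>i<n. tt (s i) i * of_nat p ^ Suc i) - y" for n
      by (subst s_sum) (simp add: w_def)
    have "\<exists>N. \<forall>n\<ge>N. absv (s n - w) < \<delta>" unfolding sw by (rule y[rule_format, OF \<delta>(1)])
    then obtain N where N: "\<forall>n\<ge>N. absv (s n - w) < \<delta>" ..
    obtain N' where N': "(1 / real p) ^ N' < \<epsilon>" using real_arch_pow_inv[OF e p0(1)] by blast
    define n where "n = max N N'"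
    have d: "absv (s n - w) < \<delta>" using N by (simp add: n_def)
    have sn: "absv (s n) = 1" using absv_eq_of_close[of "s n" 1] inv by simp
    have "absv w \<le> 1"
      using absv_diff_le[of "s n" 1 "s n - w"] sn d \<delta> by simp
    then have "absv (w + s n) \<le> 1" using sn by (intro absv_add_le) auto
    then have "absv ((w - s n) * (w + s n)) \<le> absv (w - s n) * 1"
      unfolding absv_mult using absv_nonneg by (intro mult_left_mono) auto
    then have 1: "absv (w\<^sup>2 - (s n)\<^sup>2) < \<epsilon>"
      using d \<delta> absv_minus_commute[of w "s n"] by (simp add: power2_eq_square algebra_simps)
    have "absv ((s n)\<^sup>2 - a) \<le> (1 / real p) ^ Suc n" using inv by blast
    also have "\<dots> \<le> (1 / real p) ^ N'" using p0 by (intro power_decreasing) (auto simp: n_def)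
    finally have "absv ((s n)\<^sup>2 - a) < \<epsilon>" using N' by simp
    from absv_add_less[OF 1 this] show ?thesis by simp
  qed
  have "\<not> absv (w\<^sup>2 - a) > 0" using small[of "absv (w\<^sup>2 - a)"] by auto
  then have "absv (w\<^sup>2 - a) = 0" using absv_nonneg[of "w\<^sup>2 - a"] by simp
  then have "w\<^sup>2 = a" by (simp add: absv_eq_0_iff)
  then show ?thesis ..
qed

text \<open>The valuation of a square is even. Concretely, a square has absolute value at least 1 or
  at most \<open>1 / p ^ 2\<close>.\<close>

lemma p_times_not_square: "absv a = 1 / real p \<Longrightarrow> y\<^sup>2 \<noteq> a"
proof
  assume a: "absv a = 1 / real p" "y\<^sup>2 = a"
  have sq: "absv y ^ 2 = 1 / real p" using a absv_power[of y 2] by simp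
  have p1: "1 / real p < 1" "0 < 1 / real p" using p_gt_1 by auto
  show False
  proof (cases "absv y < 1")
    case True
    then have "absv y ^ 2 \<le> (1 / real p) ^ 2" using absv_less_1D absv_nonneg by (intro power_mono) auto
    also have "\<dots> < (1 / real p) ^ 1" using p1 by (intro power_strict_decreasing) auto
    finally show False using sq by simp
  next
    case False
    then have "1 \<le> absv y ^ 2" by simp
    then show False using sq p1 by simp
  qed
qed

end

section \<open>A type for the residue field\<close>

text \<open>The prime and the copy of the p-adic numbers are quantified away, so that only the field
  and its absolute value remain.\<close>

definition odd_unramified :: "('a :: field_char_0 \<Rightarrow> real) \<Rightarrow> bool" where
  "odd_unramified absv \<longleftrightarrow> (\<exists>p Qp. odd p \<and> unramified_padic_extension absv p Qp \<and> finite (residue_field absv))"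

text \<open>Otherwise weak approximation gives an element close to 1 for \<open>v\<close> and close
  to \<open>p2\<close> for \<open>w\<close>. The first property makes it a square, the second gives
  it the value of a uniformizer and forbids this.\<close>

lemma odd_unramified_maximal_ideal_subset:
  assumes "odd_unramified v" "odd_unramified w" "v z < 1"
  shows "w z < 1"
proof (rule ccontr)
  assume wz: "\<not> w z < 1"
  obtain p1 Q1 where 1: "odd p1" "unramified_padic_extension v p1 Q1" "finite (residue_field v)"
    using assms(1) by (auto simp: odd_unramified_def)
  obtain p2 Q2 where 2: "odd p2" "unramified_padic_extension w p2 Q2" "finite (residue_field w)"
    using assms(2) by (auto simp: odd_unramified_def)
  interpret V: unramified_padic_extension v p1 Q1 by (rule 1(2))
  interpret W: unramified_padic_extension w p2 Q2 by (rule 2(2))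
  have p2: "(of_nat p2 :: 'a) \<noteq> 0" using W.p_gt_1 by auto
  have vp: "v (of_nat p2) > 0" using p2 by (rule V.absv_pos)
  obtain m where m: "v z ^ m < v (of_nat p2)" using real_arch_pow_inv[OF vp assms(3)] by blast
  \<comment> \<open>The division by \<open>p2\<close> makes \<open>y\<close> large for
    \<open>w\<close> even when \<open>w z = 1\<close>; the exponent \<open>m\<close> keeps it small
    for \<open>v\<close>.\<close>
  define y where "y = z ^ m / of_nat p2"
  have vy: "v y < 1" using m vp by (simp add: y_def V.absv_divide V.absv_power)
  have "1 \<le> w z ^ m" using wz by simp
  then have "real p2 * 1 \<le> real p2 * w z ^ m" by (intro mult_left_mono) auto
  then have "1 < real p2 * w z ^ m" using W.p_gt_1 by linarith
  then have wy: "w y > 1" by (simp add: y_def W.absv_divide W.absv_power W.absv_p mult.commute)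
  define c where "c = max 1 (v (of_nat p2 - 1))"
  have c0: "c \<ge> 1" by (simp add: c_def)
  then obtain n1 where n1: "v y ^ n1 < 1 / c" using real_arch_pow_inv[OF _ vy, of "1 / c"] by auto
  have "inverse (w y) < 1" using wy by (simp add: inverse_less_1_iff)
  then obtain n2 where n2: "inverse (w y) ^ n2 < 1 / real p2"
    using real_arch_pow_inv[of "1 / real p2" "inverse (w y)"] W.p_gt_1 by auto
  define n where "n = Suc (max n1 n2)"
  have yn: "v (y ^ n) < 1 / c" "v (y ^ n) < 1"
  proof -
    have "v (y ^ n) \<le> v y ^ n1" unfolding V.absv_power using vy V.absv_nonneg by (intro power_decreasing) (auto simp: n_def)
    then show "v (y ^ n) < 1 / c" using n1 by simp
    moreover have "1 / c \<le> 1" using c0 by simp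
    ultimately show "v (y ^ n) < 1" by simp
  qed
  have wyn: "w (y ^ n) > real p2" "w (y ^ n) > 1"
  proof -
    have "inverse (w y ^ n) \<le> inverse (w y) ^ n2"
      unfolding power_inverse[symmetric] using wy \<open>inverse (w y) < 1\<close> by (intro power_decreasing) (auto simp: n_def)
    then have lt: "inverse (w (y ^ n)) < inverse (real p2)" using n2 by (simp add: W.absv_power divide_inverse)
    show "w (y ^ n) > real p2" by (rule inverse_less_imp_less[OF lt]) (use wy in \<open>simp add: W.absv_power\<close>)
    then show "w (y ^ n) > 1" using W.p_gt_1 by simp
  qed
  \<comment> \<open>As \<open>y ^ n\<close> is close to 0 for \<open>v\<close> and very large for
    \<open>w\<close>, this fraction is close to 1 for \<open>v\<close> and to \<open>p2\<close> for
    \<open>w\<close>.\<close>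
  define a where "a = (1 + y ^ n * of_nat p2) / (1 + y ^ n)"
  have v1: "v (1 + y ^ n) = 1" using V.absv_add_eq[of "y ^ n" 1] yn by (simp add: add.commute)
  have w1: "w (1 + y ^ n) = w (y ^ n)" using W.absv_add_eq[of 1 "y ^ n"] wyn by simp
  have ne: "1 + y ^ n \<noteq> 0" using v1 by auto
  have "a - 1 = y ^ n * (of_nat p2 - 1) / (1 + y ^ n)"
    unfolding a_def using ne by (simp add: divide_simps) (simp add: algebra_simps)
  then have "v (a - 1) = v (y ^ n) * v (of_nat p2 - 1)" by (simp only: V.absv_divide V.absv_mult v1 div_by_1)
  also have "\<dots> \<le> v (y ^ n) * c" using V.absv_nonneg by (intro mult_left_mono) (auto simp: c_def)
  also have "\<dots> < 1" using yn(1) c0 by (simp add: less_divide_eq)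
  finally obtain s where s: "s\<^sup>2 = a" using V.one_units_are_squares[OF 1(1,3)] by blast
  have "a - of_nat p2 = (1 - of_nat p2) / (1 + y ^ n)"
    unfolding a_def using ne by (simp add: divide_simps) (simp add: algebra_simps)
  then have "w (a - of_nat p2) = w (1 - of_nat p2) / w (y ^ n)" by (simp only: W.absv_divide w1)
  also have "\<dots> \<le> 1 / w (y ^ n)"
    using wyn W.absv_of_nat_le_1 by (intro divide_right_mono W.absv_diff_le) auto
  also have "\<dots> < 1 / real p2" using wyn W.p_gt_1 by (intro divide_strict_left_mono mult_pos_pos) auto
  finally have "w a = 1 / real p2" using W.absv_eq_of_close[of a "of_nat p2"] by (simp add: W.absv_p)
  then show False using W.p_times_not_square s by blast
qed

text \<open>
  The absolute value of an odd unramified extension is determined by the field up to equivalence, so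
  the residue field can be represented by a type that depends on \<open>'a\<close> alone.  The trivial absolute
  value serves as a dummy for all other fields.
\<close>

definition can_absv :: "'a :: field_char_0 \<Rightarrow> real" where
  "can_absv = (if \<exists>v :: 'a \<Rightarrow> real. odd_unramified v then SOME v. odd_unramified v
     else (\<lambda>x. if x = 0 then 0 else 1))"

lemma nonarch_can_absv: "nonarch_field (can_absv :: 'a :: field_char_0 \<Rightarrow> real)"
proof (cases "\<exists>v :: 'a \<Rightarrow> real. odd_unramified v")
  case True
  then have "odd_unramified (can_absv :: 'a \<Rightarrow> real)" unfolding can_absv_def by (simp add: someI_ex)
  then show ?thesis
    by (auto simp: odd_unramified_def unramified_padic_extension_def padic_extension_def)
next
  case False
  then have eq: "can_absv = (\<lambda>x :: 'a. if x = 0 then 0 else 1)" by (simp add: can_absv_def)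
  show ?thesis unfolding eq by standard (auto simp: max_def)
qed

interpretation can: nonarch_field can_absv
  by (rule nonarch_can_absv)

lemma can_absv_less_1_iff:
  assumes "odd_unramified v"
  shows "can_absv x < 1 \<longleftrightarrow> v x < 1"
proof -
  have "odd_unramified (can_absv :: 'a \<Rightarrow> real)"
    unfolding can_absv_def using someI[of odd_unramified v] assms by auto
  then show ?thesis using assms odd_unramified_maximal_ideal_subset by blast
qed

text \<open>The maximal ideal determines the valuation ring: a nonzero element is integral exactly
  when its inverse is not in the ideal.\<close>

lemma can_absv_le_1_iff:
  fixes v :: "'a :: field_char_0 \<Rightarrow> real"
  assumes v: "odd_unramified v"
  shows "can_absv x \<le> 1 \<longleftrightarrow> v x \<le> 1"
proof -
  interpret V: nonarch_field v
    using v by (auto simp: odd_unramified_def unramified_padic_extension_def padic_extension_def)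
  have "V y \<le> 1 \<longleftrightarrow> y = 0 \<or> \<not> V (inverse y) < 1" if "nonarch_field V" for V and y :: 'a
  proof -
    interpret N: nonarch_field V by (rule that)
    show ?thesis using N.absv_pos[of y] by (auto simp: N.absv_inverse inverse_less_1_iff)
  qed
  then show ?thesis
    using can_absv_less_1_iff[OF v] can.nonarch_field_axioms V.nonarch_field_axioms by metis
qed

text \<open>A partial relation: elements outside the valuation ring are related to nothing, so the
  quotient is the ring modulo its maximal ideal.\<close>

definition residue_rel :: "'a :: field_char_0 \<Rightarrow> 'a \<Rightarrow> bool" where
  "residue_rel x y \<longleftrightarrow> can_absv x \<le> 1 \<and> can_absv y \<le> 1 \<and> can_absv (x - y) < 1"

quotient_type (overloaded) 'a resfield = "'a :: field_char_0" / partial: residue_rel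
proof (rule part_equivpI)
  show "\<exists>x :: 'a. residue_rel x x" by (rule exI[of _ 0]) (simp add: residue_rel_def)
  show "symp (residue_rel :: 'a \<Rightarrow> 'a \<Rightarrow> bool)"
    by (auto simp: symp_def residue_rel_def can.absv_minus_commute)
  show "transp (residue_rel :: 'a \<Rightarrow> 'a \<Rightarrow> bool)"
  proof (rule transpI)
    fix x y z :: 'a assume "residue_rel x y" "residue_rel y z"
    then show "residue_rel x z"
      using can.absv_add_less[of "x - y" 1 "y - z"] by (simp add: residue_rel_def)
  qed
qed

instantiation resfield :: (field_char_0) field
begin

lift_definition zero_resfield :: "'a resfield" is 0 by (simp add: residue_rel_def)

lift_definition one_resfield :: "'a resfield" is 1 by (simp add: residue_rel_def)

lift_definition plus_resfield :: "'a resfield \<Rightarrow> 'a resfield \<Rightarrow> 'a resfield" is "(+)"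
proof -
  fix x x' y y' :: 'a assume "residue_rel x x'" "residue_rel y y'"
  then show "residue_rel (x + y) (x' + y')"
    using can.absv_add_less[of "x - x'" 1 "y - y'"] by (simp add: residue_rel_def can.absv_add_le algebra_simps)
qed

lift_definition uminus_resfield :: "'a resfield \<Rightarrow> 'a resfield" is uminus
proof -
  fix x x' :: 'a assume "residue_rel x x'"
  then show "residue_rel (- x) (- x')"
    using can.absv_minus_commute[of x x'] by (simp add: residue_rel_def)
qed

lift_definition minus_resfield :: "'a resfield \<Rightarrow> 'a resfield \<Rightarrow> 'a resfield" is "(-)"
proof -
  fix x x' y y' :: 'a assume "residue_rel x x'" "residue_rel y y'"
  then show "residue_rel (x - y) (x' - y')"
    using can.absv_diff_less[of "x - x'" 1 "y - y'"] by (simp add: residue_rel_def can.absv_diff_le algebra_simps)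
qed

lift_definition times_resfield :: "'a resfield \<Rightarrow> 'a resfield \<Rightarrow> 'a resfield" is "(*)"
proof -
  fix x x' y y' :: 'a assume r: "residue_rel x x'" "residue_rel y y'"
  have "can_absv (x * (y - y') + (x - x') * y') < 1"
    using r by (intro can.absv_add_less can.absv_mult_less_1 can.absv_mult_less_1') (auto simp: residue_rel_def)
  moreover have "x * (y - y') + (x - x') * y' = x * y - x' * y'" by (simp add: algebra_simps)
  ultimately show "residue_rel (x * y) (x' * y')"
    using r by (simp add: residue_rel_def can.absv_mult_le_1)
qed

text \<open>Nonzero elements of the maximal ideal have no integral inverse; the value 0 on their
  class is the convention \<open>inverse 0 = 0\<close> of the field class.\<close>

lift_definition inverse_resfield :: "'a resfield \<Rightarrow> 'a resfield" is "\<lambda>x. if can_absv x < 1 then 0 else inverse x"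
proof -
  fix x y :: 'a assume r: "residue_rel x y"
  show "residue_rel (if can_absv x < 1 then 0 else inverse x) (if can_absv y < 1 then 0 else inverse y)"
  proof (cases "can_absv x < 1")
    case True
    then have "can_absv y < 1"
      using r can.absv_diff_less[of x 1 "x - y"] by (simp add: residue_rel_def)
    then show ?thesis using True by (simp add: residue_rel_def)
  next
    case False
    then have x: "can_absv x = 1" using r by (simp add: residue_rel_def)
    have y: "can_absv y = 1"
      using r x can.absv_eq_of_close[of y x] can.absv_minus_commute[of x y] by (simp add: residue_rel_def)
    have "x \<noteq> 0" "y \<noteq> 0" using x y by auto
    then have "inverse x - inverse y = (y - x) * inverse (x * y)" by (simp add: field_simps)
    then have "can_absv (inverse x - inverse y) = can_absv (x - y)"
      using x y can.absv_minus_commute[of x y] by (simp add: can.absv_mult can.absv_inverse)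
    then show ?thesis using r x y by (simp add: residue_rel_def can.absv_inverse)
  qed
qed

definition divide_resfield :: "'a resfield \<Rightarrow> 'a resfield \<Rightarrow> 'a resfield" where
  "divide_resfield x y = x * inverse y"

instance
proof
  fix a b c :: "'a resfield"
  have d: "residue_rel x y" if "x = y" "can_absv x \<le> 1" for x y :: 'a using that by (simp add: residue_rel_def)
  note cl = can.absv_add_le can.absv_mult_le_1 can.absv_diff_le
  show "a + b + c = a + (b + c)"
    by transfer (rule d, auto simp: residue_rel_def algebra_simps intro!: cl)
  show "a + b = b + a" by transfer (rule d, auto simp: residue_rel_def algebra_simps intro!: cl)
  show "0 + a = a" by transfer (rule d, auto simp: residue_rel_def)
  show "- a + a = 0" by transfer (rule d, auto simp: residue_rel_def)
  show "a - b = a + - b" by transfer (rule d, auto simp: residue_rel_def intro!: cl)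
  show "a * b * c = a * (b * c)" by transfer (rule d, auto simp: residue_rel_def algebra_simps intro!: cl)
  show "a * b = b * a" by transfer (rule d, auto simp: residue_rel_def algebra_simps intro!: cl)
  show "1 * a = a" by transfer (rule d, auto simp: residue_rel_def)
  show "(a + b) * c = a * c + b * c" by transfer (rule d, auto simp: residue_rel_def algebra_simps intro!: cl)
  show "(0 :: 'a resfield) \<noteq> 1" by transfer (simp add: residue_rel_def)
  show "a \<noteq> 0 \<Longrightarrow> inverse a * a = 1"
  proof transfer
    fix a :: 'a assume a: "residue_rel a a" "\<not> residue_rel a 0"
    then have 1: "can_absv a = 1" by (auto simp: residue_rel_def)
    then have "a \<noteq> 0" by auto
    then show "residue_rel ((if can_absv a < 1 then 0 else inverse a) * a) 1"
      using 1 by (simp add: residue_rel_def)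
  qed
  show "a div b = a * inverse b" by (rule divide_resfield_def)
  show "inverse (0 :: 'a resfield) = 0" by transfer (simp add: residue_rel_def)
qed

end

lemma abs_resfield_eq_iff:
  "can_absv x \<le> 1 \<Longrightarrow> can_absv y \<le> 1 \<Longrightarrow> abs_resfield x = abs_resfield y \<longleftrightarrow> can_absv (x - y) < 1"
  using Quotient_rel_abs[OF Quotient_resfield] Quotient_rel[OF Quotient_resfield, of x y] by (auto simp: residue_rel_def)

lemma abs_resfield_surj: "\<exists>x. can_absv x \<le> 1 \<and> abs_resfield x = k"
proof -
  have "residue_rel (rep_resfield k) (rep_resfield k)"
    by (rule Quotient_rep_reflp[OF Quotient_resfield])
  moreover have "abs_resfield (rep_resfield k) = k" by (rule Quotient_abs_rep[OF Quotient_resfield])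
  ultimately show ?thesis by (auto simp: residue_rel_def)
qed

lemma abs_resfield_simps:
  "abs_resfield 0 = 0" "abs_resfield 1 = 1"
  "can_absv x \<le> 1 \<Longrightarrow> can_absv y \<le> 1 \<Longrightarrow> abs_resfield (x + y) = abs_resfield x + abs_resfield y"
  "can_absv x \<le> 1 \<Longrightarrow> can_absv y \<le> 1 \<Longrightarrow> abs_resfield (x * y) = abs_resfield x * abs_resfield y"
  "can_absv x \<le> 1 \<Longrightarrow> can_absv y \<le> 1 \<Longrightarrow> abs_resfield (x - y) = abs_resfield x - abs_resfield y"
  by (simp_all add: zero_resfield.abs_eq one_resfield.abs_eq plus_resfield.abs_eq times_resfield.abs_eq
      minus_resfield.abs_eq eq_onp_def residue_rel_def)

section \<open>Balls in the ring of integers\<close>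

locale odd_unramified_extension = unramified_padic_extension absv p Qp
  for absv :: "'a :: field_char_0 \<Rightarrow> real" and p Qp +
  fixes m q :: nat
  assumes odd_p: "odd p" and q_eq_power: "q = p ^ m" and card_residue: "card (residue_field absv) = q"
begin

lemma q_pos: "q > 0"
  using prime_p by (simp add: q_eq_power prime_gt_0_nat)

lemma finite_residue: "finite (residue_field absv)"
  using card_residue q_pos by (intro card_ge_0_finite) simp

lemma odd_unram: "odd_unramified absv"
  unfolding odd_unramified_def using odd_p finite_residue unramified_padic_extension_axioms by blast

abbreviation red :: "'a \<Rightarrow> 'a resfield" where "red \<equiv> abs_resfield"

lemma red_eq_iff: "absv x \<le> 1 \<Longrightarrow> absv y \<le> 1 \<Longrightarrow> red x = red y \<longleftrightarrow> absv (x - y) < 1"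
  by (simp add: abs_resfield_eq_iff can_absv_le_1_iff[OF odd_unram] can_absv_less_1_iff[OF odd_unram])

lemma red_surj: "\<exists>x. absv x \<le> 1 \<and> red x = k"
  using abs_resfield_surj[of k] by (simp add: can_absv_le_1_iff[OF odd_unram])

lemma red_add: "absv x \<le> 1 \<Longrightarrow> absv y \<le> 1 \<Longrightarrow> red (x + y) = red x + red y"
  and red_mult: "absv x \<le> 1 \<Longrightarrow> absv y \<le> 1 \<Longrightarrow> red (x * y) = red x * red y"
  and red_diff: "absv x \<le> 1 \<Longrightarrow> absv y \<le> 1 \<Longrightarrow> red (x - y) = red x - red y"
  by (simp_all add: abs_resfield_simps can_absv_le_1_iff[OF odd_unram])

lemma red_0 [simp]: "red 0 = 0" and red_1 [simp]: "red 1 = 1"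
  by (simp_all add: abs_resfield_simps)

lemma red_eq_0_iff: "absv x \<le> 1 \<Longrightarrow> red x = 0 \<longleftrightarrow> absv x < 1"
  using red_eq_iff[of x 0] by simp

lemma red_minus: "absv x \<le> 1 \<Longrightarrow> red (- x) = - red x"
  using red_diff[of 0 x] by simp

lemma red_of_nat: "red (of_nat n) = of_nat n"
  by (induction n) (auto simp: red_add absv_of_nat_le_1)

lemma red_sum: "(\<And>i. i \<in> I \<Longrightarrow> absv (f i) \<le> 1) \<Longrightarrow> red (sum f I) = (\<Sum>i\<in>I. red (f i))"
  by (induction I rule: infinite_finite_induct) (auto simp: red_add absv_sum_le)

lemma absv_prod_le_1: "(\<And>i. i \<in> I \<Longrightarrow> absv (f i) \<le> 1) \<Longrightarrow> absv (prod f I) \<le> 1"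
  by (induction I rule: infinite_finite_induct) (auto simp: absv_mult_le_1)

lemma red_prod: "(\<And>i. i \<in> I \<Longrightarrow> absv (f i) \<le> 1) \<Longrightarrow> red (prod f I) = (\<Prod>i\<in>I. red (f i))"
  by (induction I rule: infinite_finite_induct) (auto simp: red_mult absv_prod_le_1)

text \<open>Links the type to the set of residue classes, so that the given cardinality
  \<open>q\<close> carries over to the type.\<close>

lemma bij_betw_residue_field:
  "bij_betw (\<lambda>k. {x. absv x \<le> 1 \<and> red x = k}) UNIV (residue_field absv)"
proof (rule bij_betw_imageI)
  show "inj (\<lambda>k. {x. absv x \<le> 1 \<and> red x = k})"
  proof (rule injI)
    fix k l assume eq: "{x. absv x \<le> 1 \<and> red x = k} = {x. absv x \<le> 1 \<and> red x = l}"
    obtain x where "absv x \<le> 1" "red x = k" using red_surj by blast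
    then show "k = l" using eq by auto
  qed
  let ?R = "{(x, y). x \<in> integers absv \<and> y \<in> integers absv \<and> x - y \<in> maximal_ideal absv}"
  have cl: "?R `` {x} = {y. absv y \<le> 1 \<and> red y = red x}" if "absv x \<le> 1" for x
    using that red_eq_iff absv_minus_commute by (auto simp: integers_def maximal_ideal_def)
  show "range (\<lambda>k. {x. absv x \<le> 1 \<and> red x = k}) = residue_field absv"
  proof
    show "range (\<lambda>k. {x. absv x \<le> 1 \<and> red x = k}) \<subseteq> residue_field absv"
    proof (rule image_subsetI)
      fix k obtain x where x: "absv x \<le> 1" "red x = k" using red_surj by blast
      have "?R `` {x} \<in> residue_field absv"
        unfolding residue_field_def using x by (intro quotientI) (simp add: integers_def)
      then show "{x. absv x \<le> 1 \<and> red x = k} \<in> residue_field absv" using cl[OF x(1)] x(2) by simp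
    qed
    show "residue_field absv \<subseteq> range (\<lambda>k. {x. absv x \<le> 1 \<and> red x = k})"
      unfolding residue_field_def using cl by (auto elim!: quotientE simp: integers_def)
  qed
qed

lemma finite_resfield: "finite (UNIV :: 'a resfield set)"
  and card_resfield: "CARD('a resfield) = q"
  using bij_betw_finite[OF bij_betw_residue_field] bij_betw_same_card[OF bij_betw_residue_field]
    finite_residue card_residue by simp_all

lemma absv_p_less_1: "absv (of_nat p) < 1"
  using absv_p p_gt_1 by simp

sublocale k: finite_field "TYPE('a resfield)" p m q
proof
  show "of_nat p = (0 :: 'a resfield)"
    using red_of_nat[of p] red_eq_0_iff[of "of_nat p"] absv_p_less_1 by simp
qed (use finite_resfield card_resfield prime_p q_eq_power in auto)

definition \<nu> :: real where "\<nu> = 1 / real p"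

lemma \<nu>: "0 < \<nu>" "\<nu> < 1" using p_gt_1 by (auto simp: \<nu>_def)

lemma absv_p_power: "absv (of_nat p ^ j) = \<nu> ^ j"
  by (simp add: absv_power absv_p \<nu>_def)

lemma absv_le_power_iff: "absv x \<le> \<nu> ^ j \<longleftrightarrow> (\<exists>z. absv z \<le> 1 \<and> x = of_nat p ^ j * z)"
proof
  assume x: "absv x \<le> \<nu> ^ j"
  have p0: "(of_nat p :: 'a) ^ j \<noteq> 0" using p_gt_1 by simp
  have "absv (x / of_nat p ^ j) \<le> 1"
    using x \<nu> by (simp add: absv_divide absv_p_power)
  then show "\<exists>z. absv z \<le> 1 \<and> x = of_nat p ^ j * z" using p0 by (intro exI[of _ "x / of_nat p ^ j"]) simp
next
  assume "\<exists>z. absv z \<le> 1 \<and> x = of_nat p ^ j * z"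
  then obtain z where z: "absv z \<le> 1" "x = of_nat p ^ j * z" by blast
  have "\<nu> ^ j * absv z \<le> \<nu> ^ j * 1" using z \<nu> by (intro mult_left_mono) auto
  then show "absv x \<le> \<nu> ^ j" by (simp add: z absv_mult absv_p_power)
qed

lemma absv_less_1_iff: "absv x < 1 \<longleftrightarrow> absv x \<le> \<nu>"
  using absv_less_1D[of x] \<nu>(2) unfolding \<nu>_def by (meson le_less_trans)

text \<open>The coset of \<open>x\<close> modulo \<open>p ^ j\<close> times the ring of integers.
  For integral \<open>x\<close>, level 0 is the whole ring and level 1 the residue class of
  \<open>x\<close>.\<close>

definition ball :: "nat \<Rightarrow> 'a \<Rightarrow> 'a set" where
  "ball j x = {y. absv (y - x) \<le> \<nu> ^ j}"

lemma ball_self: "x \<in> ball j x"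
  using \<nu> by (simp add: ball_def)

lemma ball_eq: "y \<in> ball j x \<Longrightarrow> ball j y = ball j x"
proof -
  assume y: "y \<in> ball j x"
  have "absv (z - x) \<le> \<nu> ^ j" if "absv (z - y) \<le> \<nu> ^ j" for z
    using absv_add_le[OF that, of "y - x"] y by (simp add: ball_def)
  moreover have "absv (z - y) \<le> \<nu> ^ j" if "absv (z - x) \<le> \<nu> ^ j" for z
    using absv_diff_le[OF that, of "y - x"] y by (simp add: ball_def)
  ultimately show ?thesis by (auto simp: ball_def)
qed

lemma ball_mono: "i \<le> j \<Longrightarrow> ball j x \<subseteq> ball i x"
proof
  fix y assume "i \<le> j" and y: "y \<in> ball j x"
  then have "\<nu> ^ j \<le> \<nu> ^ i" using \<nu> by (intro power_decreasing) auto
  then show "y \<in> ball i x" using y by (simp add: ball_def)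
qed

lemma ball_0: "absv x \<le> 1 \<Longrightarrow> ball 0 x = integers absv"
proof (intro equalityI subsetI)
  fix y assume "absv x \<le> 1" "y \<in> ball 0 x"
  then show "y \<in> integers absv" using absv_add_le[of "y - x" 1 x] by (simp add: ball_def integers_def)
next
  fix y assume "absv x \<le> 1" "y \<in> integers absv"
  then show "y \<in> ball 0 x" using absv_diff_le[of y 1 x] by (simp add: ball_def integers_def)
qed

lemma ball_subset_integers: "absv x \<le> 1 \<Longrightarrow> ball j x \<subseteq> integers absv"
  using ball_mono[of 0 j x] ball_0 by blast

lemma ball_Suc_0: "absv x \<le> 1 \<Longrightarrow> ball 1 x = {y. absv y \<le> 1 \<and> red y = red x}"
proof (intro equalityI subsetI)
  fix y assume x: "absv x \<le> 1" and y: "y \<in> ball 1 x"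
  then have "absv y \<le> 1" using ball_subset_integers[OF x, of 1] by (auto simp: integers_def)
  then show "y \<in> {y. absv y \<le> 1 \<and> red y = red x}"
    using red_eq_iff[of y x] x y by (simp add: ball_def absv_less_1_iff)
next
  fix y assume x: "absv x \<le> 1" and y: "y \<in> {y. absv y \<le> 1 \<and> red y = red x}"
  then show "y \<in> ball 1 x" using red_eq_iff[of y x] by (simp add: ball_def absv_less_1_iff)
qed

section \<open>Balls as a generator of the Borel sets\<close>

lemma topspace_integers [simp]: "topspace (integers_topology absv) = integers absv"
  using Metric_space.topspace_mtopology[OF Metric_space_abs_dist]
  by (simp add: integers_topology_def field_topology_def)

lemma openin_ball: "absv x \<le> 1 \<Longrightarrow> openin (integers_topology absv) (ball j x)"
proof -
  assume x: "absv x \<le> 1"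
  interpret M: Metric_space UNIV "abs_dist absv" by (rule Metric_space_abs_dist)
  have "openin M.mtopology (ball j x)"
    unfolding M.openin_mtopology
  proof (intro conjI allI impI)
    fix y assume y: "y \<in> ball j x"
    have "M.mball y (\<nu> ^ j) \<subseteq> ball j y" by (auto simp: ball_def abs_dist_def absv_minus_commute)
    then show "\<exists>r>0. M.mball y r \<subseteq> ball j x" using ball_eq[OF y] \<nu> by (intro exI[of _ "\<nu> ^ j"]) auto
  qed simp
  then show ?thesis
    unfolding integers_topology_def field_topology_def openin_subtopology
    using ball_subset_integers[OF x] by blast
qed

lemma open_contains_ball:
  assumes "openin (integers_topology absv) U" "x \<in> U"
  obtains j where "ball j x \<subseteq> U"
proof -
  interpret M: Metric_space UNIV "abs_dist absv" by (rule Metric_space_abs_dist)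
  obtain V where V: "openin M.mtopology V" "U = V \<inter> integers absv"
    using assms(1) unfolding integers_topology_def field_topology_def openin_subtopology by blast
  obtain r where r: "r > 0" "M.mball x r \<subseteq> V" using V assms(2) by (auto simp: M.openin_mtopology)
  obtain j where j: "\<nu> ^ j < r" using real_arch_pow_inv[OF r(1) \<nu>(2)] by blast
  have x: "absv x \<le> 1" using assms(2) V by (auto simp: integers_def)
  have "ball j x \<subseteq> M.mball x r" using j by (auto simp: ball_def abs_dist_def absv_minus_commute)
  then have "ball j x \<subseteq> U" using r V ball_subset_integers[OF x] by blast
  then show thesis by (rule that)
qed

text \<open>An intersection-stable generator: two balls that meet are nested, and the empty set
  takes care of disjoint ones.\<close>

definition balls :: "'a set set" where
  "balls = insert {} {ball j x |j x. absv x \<le> 1}"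

text \<open>Digit expansions of length \<open>j\<close> with digits from a finite set of residue
  representatives.\<close>

lemma finite_ball_representatives:
  "\<exists>T. finite T \<and> T \<subseteq> integers absv \<and> (\<forall>x. absv x \<le> 1 \<longrightarrow> (\<exists>t\<in>T. x \<in> ball j t))"
proof (induction j)
  case 0
  have "\<forall>x. absv x \<le> 1 \<longrightarrow> x \<in> ball 0 0" by (simp add: ball_def)
  then show ?case by (intro exI[of _ "{0}"]) (auto simp: integers_def)
next
  case (Suc j)
  then obtain T where T: "finite T" "T \<subseteq> integers absv" "\<forall>x. absv x \<le> 1 \<longrightarrow> (\<exists>t\<in>T. x \<in> ball j t)" by blast
  obtain R where R: "finite R" "R \<subseteq> integers absv" "\<forall>x. absv x \<le> 1 \<longrightarrow> (\<exists>t\<in>R. absv (x - t) < 1)"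
    by (rule finite_representatives[OF finite_residue])
  let ?T = "(\<lambda>(t, s). t + of_nat p ^ j * s) ` (T \<times> R)"
  have pj: "absv (of_nat p ^ j) \<le> 1" unfolding absv_p_power using \<nu> by (simp add: power_le_one)
  have "\<exists>t\<in>?T. x \<in> ball (Suc j) t" if x: "absv x \<le> 1" for x
  proof -
    obtain t where t: "t \<in> T" "x \<in> ball j t" using T(3) x by blast
    then obtain z where z: "absv z \<le> 1" "x - t = of_nat p ^ j * z" by (auto simp: ball_def absv_le_power_iff)
    obtain s where s: "s \<in> R" "absv (z - s) < 1" using R(3) z(1) by blast
    have "x - (t + of_nat p ^ j * s) = of_nat p ^ j * (z - s)" using z(2) by (simp add: algebra_simps)
    then have "absv (x - (t + of_nat p ^ j * s)) = \<nu> ^ j * absv (z - s)" by (simp only: absv_mult absv_p_power)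
    also have "\<dots> \<le> \<nu> ^ j * \<nu>" using s(2) \<nu> by (intro mult_left_mono) (auto simp: absv_less_1_iff)
    finally have "x \<in> ball (Suc j) (t + of_nat p ^ j * s)" by (simp add: ball_def mult.commute)
    then show ?thesis using t s by force
  qed
  moreover have "?T \<subseteq> integers absv"
    using T(2) R(2) pj by (auto simp: integers_def intro!: absv_add_le absv_mult_le_1)
  ultimately show ?case using T R by (intro exI[of _ ?T]) auto
qed

lemma countable_balls: "countable balls"
proof -
  have "finite {ball j x |x. absv x \<le> 1}" for j
  proof -
    from finite_ball_representatives[of j] obtain T
      where T: "finite T \<and> T \<subseteq> integers absv \<and> (\<forall>x. absv x \<le> 1 \<longrightarrow> (\<exists>t\<in>T. x \<in> ball j t))" ..
    have "{ball j x |x. absv x \<le> 1} \<subseteq> ball j ` T"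
    proof
      fix B assume "B \<in> {ball j x |x. absv x \<le> 1}"
      then obtain x where x: "B = ball j x" "absv x \<le> 1" by auto
      obtain t where "t \<in> T" "x \<in> ball j t" using T x(2) by auto
      then show "B \<in> ball j ` T" using ball_eq[of x j t] x(1) by auto
    qed
    then show ?thesis using T by (meson finite_imageI finite_subset)
  qed
  moreover have "balls = insert {} (\<Union>j. {ball j x |x. absv x \<le> 1})" by (auto simp: balls_def)
  ultimately show ?thesis by (simp add: countable_finite)
qed

text \<open>An open set is the union of the balls inside it, and there are only countably many
  balls.\<close>

lemma sets_borel_integers: "sets (borel_of (integers_topology absv)) = sigma_sets (integers absv) balls"
proof -
  have bp: "balls \<subseteq> Pow (integers absv)" using ball_subset_integers by (auto simp: balls_def)
  have op: "{U. openin (integers_topology absv) U} \<subseteq> Pow (integers absv)"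
    using openin_subset by fastforce
  have "sigma_sets (integers absv) {U. openin (integers_topology absv) U} = sigma_sets (integers absv) balls"
  proof (rule sigma_sets_eqI)
    fix U assume "U \<in> {U. openin (integers_topology absv) U}"
    then have U: "openin (integers_topology absv) U" by simp
    have "U = \<Union> {B \<in> balls. B \<subseteq> U}"
    proof
      show "U \<subseteq> \<Union> {B \<in> balls. B \<subseteq> U}"
      proof
        fix x assume x: "x \<in> U"
        obtain j where j: "ball j x \<subseteq> U" by (rule open_contains_ball[OF U x])
        have "absv x \<le> 1" using openin_subset[OF U] x by (auto simp: integers_def)
        then have "ball j x \<in> balls" by (auto simp: balls_def)
        then show "x \<in> \<Union> {B \<in> balls. B \<subseteq> U}" using j ball_self by blast
      qed
    qed auto
    moreover have "\<Union> {B \<in> balls. B \<subseteq> U} \<in> sigma_sets (integers absv) balls"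
      by (rule sigma_sets_UNION) (auto intro: countable_subset[OF _ countable_balls])
    ultimately show "U \<in> sigma_sets (integers absv) balls" by simp
  next
    fix B assume "B \<in> balls"
    then have "openin (integers_topology absv) B" by (auto simp: balls_def openin_ball)
    then show "B \<in> sigma_sets (integers absv) {U. openin (integers_topology absv) U}" by auto
  qed
  then show ?thesis unfolding borel_of_def topspace_integers using sets_measure_of[OF op] by simp
qed

lemma space_borel_integers: "space (borel_of (integers_topology absv)) = integers absv"
proof -
  have op: "{U. openin (integers_topology absv) U} \<subseteq> Pow (integers absv)"
    using openin_subset by fastforce
  then show ?thesis unfolding borel_of_def topspace_integers by (rule space_measure_of)
qed

lemma ball_in_sets: "absv x \<le> 1 \<Longrightarrow> ball j x \<in> sets (borel_of (integers_topology absv))"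
  unfolding sets_borel_integers by (auto simp: balls_def)

lemma Int_stable_balls: "Int_stable balls"
proof (rule Int_stableI)
  fix A B assume A: "A \<in> balls" and B: "B \<in> balls"
  show "A \<inter> B \<in> balls"
  proof (cases "A \<inter> B = {}")
    case False
    then obtain z where z: "z \<in> A" "z \<in> B" by blast
    obtain i x where x: "absv x \<le> 1" "A = ball i x" using A False by (auto simp: balls_def)
    obtain j y where y: "absv y \<le> 1" "B = ball j y" using B False by (auto simp: balls_def)
    have "A = ball i z" "B = ball j z" using ball_eq z x y by auto
    then have "A \<inter> B = A \<or> A \<inter> B = B" using ball_mono[of i j z] ball_mono[of j i z] by (cases "i \<le> j") auto
    then show ?thesis using A B by metis
  qed (simp add: balls_def)
qed


text \<open>A ball splits into \<open>q\<close> balls of the next level, one for each residue class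
  of the next digit; by \<open>inv\<close> they have equal mass.\<close>

lemma measure_ball_Suc:
  assumes M: "finite_measure M" "sets M = sets (borel_of (integers_topology absv))" and x: "absv x \<le> 1"
    and inv: "\<And>s. absv s \<le> 1 \<Longrightarrow> measure M (ball (Suc j) (x + of_nat p ^ j * s)) = measure M (ball (Suc j) x)"
  shows "measure M (ball j x) = q * measure M (ball (Suc j) x)"
proof -
  interpret finite_measure M by (rule M(1))
  define l where "l k = (SOME x. absv x \<le> 1 \<and> red x = k)" for k
  have l: "absv (l k) \<le> 1" "red (l k) = k" for k
    using someI_ex[OF red_surj[of k]] by (auto simp: l_def)
  have pj: "absv (of_nat p ^ j) \<le> 1" unfolding absv_p_power using \<nu> by (simp add: power_le_one)
  have xl: "absv (x + of_nat p ^ j * l k) \<le> 1" for k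
    using x l pj by (intro absv_add_le absv_mult_le_1) auto
  have mem: "y \<in> ball (Suc j) (x + of_nat p ^ j * l k) \<longleftrightarrow> (\<exists>z. absv z \<le> 1 \<and> red z = k \<and> y = x + of_nat p ^ j * z)" for y k
  proof
    assume y: "y \<in> ball (Suc j) (x + of_nat p ^ j * l k)"
    then obtain z where z: "absv z \<le> 1" "y - (x + of_nat p ^ j * l k) = of_nat p ^ Suc j * z"
      unfolding ball_def mem_Collect_eq absv_le_power_iff by blast
    have "y = x + of_nat p ^ j * (l k + of_nat p * z)" using z(2) by (simp add: algebra_simps)
    moreover have "red (l k + of_nat p * z) = k" "absv (l k + of_nat p * z) \<le> 1"
    proof -
      have pz: "absv (of_nat p * z) < 1" using absv_p_less_1 z by (intro absv_mult_less_1)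
      then show "absv (l k + of_nat p * z) \<le> 1" using l by (intro absv_add_le) auto
      show "red (l k + of_nat p * z) = k" using pz l red_eq_0_iff[of "of_nat p * z"] by (simp add: red_add)
    qed
    ultimately show "\<exists>z. absv z \<le> 1 \<and> red z = k \<and> y = x + of_nat p ^ j * z" by blast
  next
    assume "\<exists>z. absv z \<le> 1 \<and> red z = k \<and> y = x + of_nat p ^ j * z"
    then obtain z where z: "absv z \<le> 1" "red z = k" "y = x + of_nat p ^ j * z" by blast
    have "absv (z - l k) \<le> \<nu>" using red_eq_iff[OF z(1) l(1)[of k]] z l by (simp add: absv_less_1_iff)
    then have "\<nu> ^ j * absv (z - l k) \<le> \<nu> ^ j * \<nu>" using \<nu> by (intro mult_left_mono) auto
    moreover have "y - (x + of_nat p ^ j * l k) = of_nat p ^ j * (z - l k)" using z by (simp add: algebra_simps)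
    ultimately show "y \<in> ball (Suc j) (x + of_nat p ^ j * l k)"
      by (simp add: ball_def absv_mult absv_p_power mult.commute)
  qed
  have U: "ball j x = (\<Union>k. ball (Suc j) (x + of_nat p ^ j * l k))"
  proof -
    have "y \<in> ball j x \<longleftrightarrow> (\<exists>z. absv z \<le> 1 \<and> y = x + of_nat p ^ j * z)" for y
      unfolding ball_def mem_Collect_eq absv_le_power_iff by (auto simp: algebra_simps)
    then show ?thesis using mem by auto
  qed
  have p0: "(of_nat p :: 'a) ^ j \<noteq> 0" using p_gt_1 by simp
  have "measure M (ball j x) = (\<Sum>k\<in>UNIV. measure M (ball (Suc j) (x + of_nat p ^ j * l k)))"
    unfolding U
  proof (rule finite_measure_finite_Union)
    show "disjoint_family_on (\<lambda>k. ball (Suc j) (x + of_nat p ^ j * l k)) UNIV"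
      unfolding disjoint_family_on_def using mem p0 by auto
    show "(\<lambda>k. ball (Suc j) (x + of_nat p ^ j * l k)) ` UNIV \<subseteq> sets M"
      using M(2) ball_in_sets xl by auto
  qed (rule finite_resfield)
  also have "\<dots> = (\<Sum>k\<in>(UNIV :: 'a resfield set). measure M (ball (Suc j) x))"
    using inv l by (intro sum.cong) auto
  also have "\<dots> = q * measure M (ball (Suc j) x)" by (simp add: card_resfield)
  finally show ?thesis .
qed

definition fibre :: "'a resfield \<Rightarrow> 'a set" where
  "fibre k = {x. absv x \<le> 1 \<and> red x = k}"

lemma fibre_eq_ball: "absv x \<le> 1 \<Longrightarrow> fibre (red x) = ball 1 x"
  using ball_Suc_0 by (simp add: fibre_def)

lemma fibre_in_sets: "fibre k \<in> sets (borel_of (integers_topology absv))"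
  using red_surj[of k] fibre_eq_ball ball_in_sets by metis

text \<open>Iterates \<open>measure_ball_Suc\<close> from level 1 on. Invariance is asked only for
  \<open>j \<ge> 1\<close>, where shifts stay inside a residue class, so the masses of the classes
  themselves remain unconstrained.\<close>

lemma measure_ball_of_fibre:
  assumes M: "finite_measure M" "sets M = sets (borel_of (integers_topology absv))"
    and inv: "\<And>j x s. j \<ge> 1 \<Longrightarrow> absv x \<le> 1 \<Longrightarrow> absv s \<le> 1 \<Longrightarrow>
       measure M (ball (Suc j) (x + of_nat p ^ j * s)) = measure M (ball (Suc j) x)"
    and x: "absv x \<le> 1"
  shows "measure M (ball (Suc j) x) = measure M (fibre (red x)) / real q ^ j"
proof (induction j)
  case 0
  then show ?case by (simp add: fibre_eq_ball[OF x])
next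
  case (Suc j)
  have "measure M (ball (Suc j) x) = q * measure M (ball (Suc (Suc j)) x)"
    using inv[of "Suc j" x] x by (intro measure_ball_Suc M) auto
  then show ?case using Suc q_pos by (simp add: field_simps)
qed

lemma haar_measure_ball:
  assumes H: "haar_prob (integers_topology absv) (+) N"
  shows "absv x \<le> 1 \<Longrightarrow> absv s \<le> 1 \<Longrightarrow> measure N (ball j (x + s)) = measure N (ball j x)"
    and "measure N (fibre k) = 1 / q"
proof -
  have N: "prob_space N" "sets N = sets (borel_of (integers_topology absv))"
    "\<forall>g \<in> integers absv. \<forall>S \<in> sets N. emeasure N ((+) g ` S) = emeasure N S"
    using H by (auto simp: haar_prob_def)
  interpret prob_space N by (rule N(1))
  have tr: "measure N (ball j (x + s)) = measure N (ball j x)" if x: "absv x \<le> 1" and s: "absv s \<le> 1" for x s j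
  proof -
    have "(+) s ` ball j x = ball j (x + s)"
    proof -
      have "y \<in> (+) s ` ball j x" if "y \<in> ball j (x + s)" for y
        using that by (intro image_eqI[of _ _ "y - s"]) (auto simp: ball_def algebra_simps)
      then show ?thesis by (auto simp: ball_def algebra_simps)
    qed
    moreover have "emeasure N ((+) s ` ball j x) = emeasure N (ball j x)"
      using N(3) s ball_in_sets[OF x] N(2) by (auto simp: integers_def)
    ultimately show ?thesis by (simp add: measure_def)
  qed
  then show "absv x \<le> 1 \<Longrightarrow> absv s \<le> 1 \<Longrightarrow> measure N (ball j (x + s)) = measure N (ball j x)" by blast
  obtain x where x: "absv x \<le> 1" "red x = k" using red_surj by blast
  have "measure N (ball 0 x) = q * measure N (ball (Suc 0) x)"
    using tr x N(2) by (intro measure_ball_Suc finite_measure_axioms) auto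
  moreover have "measure N (ball 0 x) = 1"
    using prob_space ball_0[OF x(1)] sets_eq_imp_space_eq[OF N(2)] space_borel_integers by simp
  moreover have "ball (Suc 0) x = fibre k" using fibre_eq_ball[OF x(1)] x(2) by simp
  ultimately show "measure N (fibre k) = 1 / q" using q_pos by (simp add: field_simps)
qed

text \<open>Inside a residue class both measures divide their mass equally among the balls of each
  level. They are thus proportional on balls and hence on Borel sets; the constant follows from
  \<open>measure N (fibre k) = 1 / q\<close>.\<close>

lemma measure_Int_fibre:
  assumes M: "finite_measure M" "sets M = sets (borel_of (integers_topology absv))"
    and inv: "\<And>j x s. j \<ge> 1 \<Longrightarrow> absv x \<le> 1 \<Longrightarrow> absv s \<le> 1 \<Longrightarrow>
       measure M (ball (Suc j) (x + of_nat p ^ j * s)) = measure M (ball (Suc j) x)"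
    and H: "haar_prob (integers_topology absv) (+) N"
    and S: "S \<in> sets (borel_of (integers_topology absv))"
  shows "measure M (S \<inter> fibre k) = q * measure M (fibre k) * measure N (S \<inter> fibre k)"
proof -
  interpret M: finite_measure M by (rule M(1))
  have N: "prob_space N" "sets N = sets (borel_of (integers_topology absv))" using H by (auto simp: haar_prob_def)
  interpret N: prob_space N by (rule N(1))
  let ?B = "borel_of (integers_topology absv)"
  define c where "c = real q * measure M (fibre k)"
  have c0: "c \<ge> 0" by (simp add: c_def)
  have invN: "measure N (ball (Suc j) (x + of_nat p ^ j * s)) = measure N (ball (Suc j) x)"
    if "absv x \<le> 1" "absv s \<le> 1" for j x s
  proof -
    have "absv (of_nat p ^ j * s) \<le> 1"
      using that \<nu> by (intro absv_mult_le_1) (auto simp: absv_p_power power_le_one)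
    then show ?thesis using haar_measure_ball(1)[OF H] that by blast
  qed
  define M1 where "M1 = density M (indicator (fibre k))"
  define N1 where "N1 = density N (\<lambda>x. ennreal c * indicator (fibre k) x)"
  have eM: "emeasure M1 A = measure M (A \<inter> fibre k)" if "A \<in> sets ?B" for A
  proof -
    have "emeasure M1 A = (\<integral>\<^sup>+ x. indicator (fibre k) x * indicator A x \<partial>M)"
      unfolding M1_def using that M(2) fibre_in_sets by (intro emeasure_density) auto
    also have "\<dots> = (\<integral>\<^sup>+ x. indicator (A \<inter> fibre k) x \<partial>M)"
      by (intro nn_integral_cong) (auto split: split_indicator)
    also have "\<dots> = emeasure M (A \<inter> fibre k)"
      using that M(2) fibre_in_sets by (intro nn_integral_indicator) auto
    finally show ?thesis by (simp add: M.emeasure_eq_measure)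
  qed
  have eN: "emeasure N1 A = ennreal (c * measure N (A \<inter> fibre k))" if "A \<in> sets ?B" for A
  proof -
    have "emeasure N1 A = (\<integral>\<^sup>+ x. ennreal c * indicator (fibre k) x * indicator A x \<partial>N)"
      unfolding N1_def using that N(2) fibre_in_sets by (intro emeasure_density) auto
    also have "\<dots> = (\<integral>\<^sup>+ x. ennreal c * indicator (A \<inter> fibre k) x \<partial>N)"
      by (intro nn_integral_cong) (auto split: split_indicator)
    also have "\<dots> = ennreal c * emeasure N (A \<inter> fibre k)"
      using that N(2) fibre_in_sets by (intro nn_integral_cmult_indicator) auto
    finally show ?thesis using c0 by (simp add: N.emeasure_eq_measure ennreal_mult)
  qed
  have key: "measure M (A \<inter> fibre k) = c * measure N (A \<inter> fibre k)" if A: "A \<in> balls" for A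
  proof (cases "A \<inter> fibre k = {}")
    case False
    then obtain x where x: "x \<in> A" "x \<in> fibre k" by blast
    then have x1: "absv x \<le> 1" "red x = k" by (auto simp: fibre_def)
    obtain i y where y: "A = ball i y" using A False by (auto simp: balls_def)
    then have Ax: "A = ball i x" using ball_eq x by auto
    \<comment> \<open>The ball of level 0 is the whole ring, and any smaller ball that meets the
      fibre lies inside it.\<close>
    have "A \<inter> fibre k = fibre k \<or> (\<exists>j. A \<inter> fibre k = ball (Suc j) x)"
    proof (cases i)
      case 0
      then show ?thesis using Ax ball_0[OF x1(1)] by (auto simp: fibre_def integers_def)
    next
      case (Suc j)
      have "ball (Suc j) x \<subseteq> fibre k" using ball_mono[of 1 "Suc j" x] fibre_eq_ball[OF x1(1)] x1(2) by simp
      then show ?thesis using Ax Suc by blast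
    qed
    then show ?thesis
    proof
      assume "A \<inter> fibre k = fibre k"
      then show ?thesis using haar_measure_ball(2)[OF H, of k] q_pos by (simp add: c_def)
    next
      assume "\<exists>j. A \<inter> fibre k = ball (Suc j) x"
      then obtain j where j: "A \<inter> fibre k = ball (Suc j) x" by blast
      have "measure M (ball (Suc j) x) = measure M (fibre k) / real q ^ j"
        using measure_ball_of_fibre[OF M inv x1(1)] x1 by simp
      moreover have "measure N (ball (Suc j) x) = measure N (fibre k) / real q ^ j"
        using measure_ball_of_fibre[OF N.finite_measure_axioms N(2) invN x1(1)] x1 by simp
      ultimately show ?thesis using j haar_measure_ball(2)[OF H, of k] q_pos by (simp add: c_def)
    qed
  qed simp
  have "M1 = N1"
  proof (rule measure_eqI_generator_eq[OF Int_stable_balls, of "integers absv" _ _ "\<lambda>_ :: nat. integers absv"])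
    show "balls \<subseteq> Pow (integers absv)" using ball_subset_integers by (auto simp: balls_def)
    show "emeasure M1 A = emeasure N1 A" if "A \<in> balls" for A
    proof -
      have "A \<in> sets ?B" unfolding sets_borel_integers using that by auto
      then show ?thesis using eM eN key[OF that] by simp
    qed
    show "sets M1 = sigma_sets (integers absv) balls" "sets N1 = sigma_sets (integers absv) balls"
      using M(2) N(2) sets_borel_integers by (auto simp: M1_def N1_def)
    have I: "integers absv \<in> balls" using ball_0[of 0] by (force simp: balls_def)
    then show "range (\<lambda>_ :: nat. integers absv) \<subseteq> balls" by auto
    have "integers absv \<in> sets ?B" unfolding sets_borel_integers using I by auto
    then show "emeasure M1 (integers absv) \<noteq> \<infinity>" using eM by simp
  qed simp
  then have "ennreal (measure M (S \<inter> fibre k)) = ennreal (c * measure N (S \<inter> fibre k))"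
    using eM[OF S] eN[OF S] by simp
  then show ?thesis using c0 by (simp add: c_def)
qed

text \<open>Conditionally on the residue class the two laws agree, so only the masses of the classes
  matter. The factor \<open>measure N (S \<inter> fibre k)\<close> is estimated by 1, which is
  harmless for a fixed finite residue field.\<close>

lemma tv_dist_le:
  assumes M: "prob_space M" "sets M = sets (borel_of (integers_topology absv))"
    and inv: "\<And>j x s. j \<ge> 1 \<Longrightarrow> absv x \<le> 1 \<Longrightarrow> absv s \<le> 1 \<Longrightarrow>
       measure M (ball (Suc j) (x + of_nat p ^ j * s)) = measure M (ball (Suc j) x)"
    and H: "haar_prob (integers_topology absv) (+) N"
  shows "0 \<le> tv_dist (integers_topology absv) M N"
    and "tv_dist (integers_topology absv) M N \<le> (\<Sum>k\<in>UNIV. \<bar>q * measure M (fibre k) - 1\<bar>)"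
proof -
  interpret M: prob_space M by (rule M(1))
  have N: "prob_space N" "sets N = sets (borel_of (integers_topology absv))" using H by (auto simp: haar_prob_def)
  interpret N: prob_space N by (rule N(1))
  let ?B = "borel_of (integers_topology absv)"
  let ?\<delta> = "\<Sum>k\<in>UNIV. \<bar>q * measure M (fibre k) - 1\<bar>"
  have bound: "\<bar>measure M S - measure N S\<bar> \<le> ?\<delta>" if S: "S \<in> sets ?B" for S
  proof -
    have SU: "S = (\<Union>k\<in>UNIV. S \<inter> fibre k)"
      using sets.sets_into_space[OF S] by (auto simp: space_borel_integers fibre_def integers_def)
    have dec: "measure L S = (\<Sum>k\<in>UNIV. measure L (S \<inter> fibre k))" if "finite_measure L" "sets L = sets ?B" for L
    proof -
      interpret L: finite_measure L by (rule that(1))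
      have "measure L (\<Union>k\<in>UNIV. S \<inter> fibre k) = (\<Sum>k\<in>UNIV. measure L (S \<inter> fibre k))"
        using S that(2) fibre_in_sets
        by (intro L.finite_measure_finite_Union finite_resfield) (auto simp: disjoint_family_on_def fibre_def)
      then show ?thesis using SU by simp
    qed
    have "measure M S - measure N S = (\<Sum>k\<in>UNIV. (q * measure M (fibre k) - 1) * measure N (S \<inter> fibre k))"
      unfolding dec[OF M.finite_measure_axioms M(2)] dec[OF N.finite_measure_axioms N(2)] sum_subtractf[symmetric]
      using measure_Int_fibre[OF M.finite_measure_axioms M(2) inv H S] by (intro sum.cong) (auto simp: algebra_simps)
    also have "\<bar>\<dots>\<bar> \<le> (\<Sum>k\<in>UNIV. \<bar>(q * measure M (fibre k) - 1) * measure N (S \<inter> fibre k)\<bar>)" by (rule sum_abs)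
    also have "\<dots> \<le> ?\<delta>"
    proof (rule sum_mono)
      fix k :: "'a resfield"
      have "\<bar>q * measure M (fibre k) - 1\<bar> * measure N (S \<inter> fibre k) \<le> \<bar>q * measure M (fibre k) - 1\<bar> * 1"
        by (intro mult_left_mono) auto
      then show "\<bar>(q * measure M (fibre k) - 1) * measure N (S \<inter> fibre k)\<bar> \<le> \<bar>q * measure M (fibre k) - 1\<bar>"
        by (simp add: abs_mult)
    qed
    finally show ?thesis .
  qed
  have ne: "sets ?B \<noteq> {}" by blast
  show "tv_dist (integers_topology absv) M N \<le> ?\<delta>"
    unfolding tv_dist_def using ne bound by (intro cSUP_least) auto
  \<comment> \<open>The empty set contributes 0 to the supremum, which is bounded above by the first
    part.\<close>
  have "\<bar>measure M {} - measure N {}\<bar> \<le> tv_dist (integers_topology absv) M N"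
    unfolding tv_dist_def using bound by (intro cSUP_upper bdd_aboveI2[where M = ?\<delta>]) auto
  then show "0 \<le> tv_dist (integers_topology absv) M N" by simp
qed

end

section \<open>Integral matrices\<close>

lemma mat_pow_add:
  assumes "(A :: 'a :: semiring_1 mat) \<in> carrier_mat n n"
  shows "A ^\<^sub>m (k + l) = A ^\<^sub>m k * A ^\<^sub>m l"
proof (induction l)
  case (Suc l)
  have c: "A ^\<^sub>m k \<in> carrier_mat n n" "A ^\<^sub>m l \<in> carrier_mat n n" using assms by auto
  show ?case using Suc assoc_mult_mat[OF c assms] by simp
qed (use assms in simp)

context odd_unramified_extension
begin

definition int_mats :: "nat \<Rightarrow> 'a mat set" where
  "int_mats n = {A \<in> carrier_mat n n. \<forall>i<n. \<forall>j<n. absv (A $$ (i, j)) \<le> 1}"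

definition rm :: "'a mat \<Rightarrow> 'a resfield mat" where
  "rm A = map_mat red A"

lemma int_matsD: "A \<in> int_mats n \<Longrightarrow> A \<in> carrier_mat n n" "A \<in> int_mats n \<Longrightarrow> i < n \<Longrightarrow> j < n \<Longrightarrow> absv (A $$ (i, j)) \<le> 1"
  by (auto simp: int_mats_def)

lemma rm_carrier: "A \<in> carrier_mat n n \<Longrightarrow> rm A \<in> carrier_mat n n"
  by (simp add: rm_def)

lemma rm_index: "A \<in> carrier_mat n n \<Longrightarrow> i < n \<Longrightarrow> j < n \<Longrightarrow> rm A $$ (i, j) = red (A $$ (i, j))"
  by (simp add: rm_def)

lemma mult_index:
  assumes "A \<in> carrier_mat n n" "B \<in> carrier_mat n n" "i < n" "j < n"
  shows "(A * B) $$ (i, j) = (\<Sum>l<n. A $$ (i, l) * B $$ (l, j))"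
  using assms by (simp add: scalar_prod_def lessThan_atLeast0)

lemma int_mats_mult: "A \<in> int_mats n \<Longrightarrow> B \<in> int_mats n \<Longrightarrow> A * B \<in> int_mats n"
  unfolding int_mats_def
proof safe
  fix i j assume *: "A \<in> carrier_mat n n" "B \<in> carrier_mat n n" "\<forall>i<n. \<forall>j<n. absv (A $$ (i, j)) \<le> 1"
    "\<forall>i<n. \<forall>j<n. absv (B $$ (i, j)) \<le> 1" "i < n" "j < n"
  show "absv ((A * B) $$ (i, j)) \<le> 1"
    unfolding mult_index[OF *(1,2,5,6)] using * by (intro absv_sum_le absv_mult_le_1) auto
qed auto

lemma int_mats_one: "1\<^sub>m n \<in> int_mats n"
  by (auto simp: int_mats_def)

lemma int_mats_pow: "A \<in> int_mats n \<Longrightarrow> A ^\<^sub>m r \<in> int_mats n"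
proof (induction r)
  case 0
  then show ?case using int_matsD(1)[of A n] int_mats_one by simp
qed (simp add: int_mats_mult)

lemma int_mats_add: "A \<in> int_mats n \<Longrightarrow> B \<in> int_mats n \<Longrightarrow> A + B \<in> int_mats n"
  by (auto simp: int_mats_def intro!: absv_add_le)

lemma int_mats_smult: "A \<in> int_mats n \<Longrightarrow> absv c \<le> 1 \<Longrightarrow> c \<cdot>\<^sub>m A \<in> int_mats n"
  by (auto simp: int_mats_def intro!: absv_mult_le_1)

lemma rm_mult: "A \<in> int_mats n \<Longrightarrow> B \<in> int_mats n \<Longrightarrow> rm (A * B) = rm A * rm B"
proof (rule eq_matI)
  assume A: "A \<in> int_mats n" and B: "B \<in> int_mats n"
  note c = int_matsD(1)[OF A] int_matsD(1)[OF B]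
  show "dim_row (rm (A * B)) = dim_row (rm A * rm B)" "dim_col (rm (A * B)) = dim_col (rm A * rm B)"
    by (auto simp: rm_def)
  fix i j assume "i < dim_row (rm A * rm B)" "j < dim_col (rm A * rm B)"
  then have ij: "i < n" "j < n" using c by (auto simp: rm_def)
  have "rm (A * B) $$ (i, j) = red (\<Sum>l<n. A $$ (i, l) * B $$ (l, j))"
    using rm_index[OF mult_carrier_mat[OF c] ij] mult_index[OF c ij] by (simp only:)
  also have "\<dots> = (\<Sum>l<n. red (A $$ (i, l)) * red (B $$ (l, j)))"
  proof -
    have e: "absv (A $$ (i, l)) \<le> 1" "absv (B $$ (l, j)) \<le> 1" if "l \<in> {..<n}" for l
      using int_matsD(2)[OF A] int_matsD(2)[OF B] ij that by auto
    show ?thesis by (subst red_sum) (auto intro!: sum.cong absv_mult_le_1 red_mult e)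
  qed
  also have "\<dots> = (rm A * rm B) $$ (i, j)"
    using ij c by (simp add: rm_def scalar_prod_def lessThan_atLeast0)
  finally show "rm (A * B) $$ (i, j) = (rm A * rm B) $$ (i, j)" .
qed

lemma rm_one: "rm (1\<^sub>m n) = 1\<^sub>m n"
  by (intro eq_matI) (auto simp: rm_def)

lemma rm_pow: "A \<in> int_mats n \<Longrightarrow> rm (A ^\<^sub>m r) = rm A ^\<^sub>m r"
proof (induction r)
  case 0
  then show ?case using int_matsD(1)[of A n] by (simp add: rm_one rm_def[of A])
next
  case (Suc r)
  then show ?case using rm_mult[OF int_mats_pow[OF Suc.prems] Suc.prems, of r] by simp
qed

lemma absv_mat_trace: "A \<in> int_mats n \<Longrightarrow> absv (mat_trace A) \<le> 1"
  using int_matsD[of A n] by (auto simp: mat_trace_def intro!: absv_sum_le)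

lemma red_mat_trace: "A \<in> int_mats n \<Longrightarrow> red (mat_trace A) = mat_trace (rm A)"
proof -
  assume A: "A \<in> int_mats n"
  have "mat_trace A = (\<Sum>i<n. A $$ (i, i))" using int_matsD(1)[OF A] by (simp add: mat_trace_def)
  also have "red \<dots> = (\<Sum>i<n. red (A $$ (i, i)))" using int_matsD(2)[OF A] by (intro red_sum) auto
  also have "\<dots> = mat_trace (rm A)" using int_matsD(1)[OF A] by (simp add: mat_trace_def rm_def)
  finally show ?thesis .
qed

lemma absv_signof: "absv (signof \<sigma>) = 1"
  by (simp add: sign_def)

lemma red_signof: "red (signof \<sigma>) = signof \<sigma>"
  using red_minus[of 1] by (simp add: sign_def)

lemma det_terms:
  assumes A: "A \<in> int_mats n" and \<sigma>: "\<sigma> permutes {0..<n}"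
  shows "absv (signof \<sigma> * (\<Prod>i=0..<n. A $$ (i, \<sigma> i))) \<le> 1"
    and "red (signof \<sigma> * (\<Prod>i=0..<n. A $$ (i, \<sigma> i))) = signof \<sigma> * (\<Prod>i=0..<n. rm A $$ (i, \<sigma> i))"
proof -
  have s: "\<sigma> i < n" if "i < n" for i using permutes_in_image[OF \<sigma>, of i] that by simp
  have e: "absv (A $$ (i, \<sigma> i)) \<le> 1" if "i \<in> {0..<n}" for i using int_matsD(2)[OF A] s that by auto
  have pr: "absv (\<Prod>i=0..<n. A $$ (i, \<sigma> i)) \<le> 1" using e by (intro absv_prod_le_1)
  then show "absv (signof \<sigma> * (\<Prod>i=0..<n. A $$ (i, \<sigma> i))) \<le> 1" by (intro absv_mult_le_1) (auto simp: absv_signof)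
  have "red (\<Prod>i=0..<n. A $$ (i, \<sigma> i)) = (\<Prod>i=0..<n. rm A $$ (i, \<sigma> i))"
    using e s int_matsD(1)[OF A] by (subst red_prod) (auto simp: rm_index[of _ n] intro!: prod.cong)
  then show "red (signof \<sigma> * (\<Prod>i=0..<n. A $$ (i, \<sigma> i))) = signof \<sigma> * (\<Prod>i=0..<n. rm A $$ (i, \<sigma> i))"
    using pr by (simp add: red_mult absv_signof red_signof)
qed

lemma absv_det: "A \<in> int_mats n \<Longrightarrow> absv (det A) \<le> 1"
  by (subst det_def'[OF int_matsD(1)]) (auto intro!: absv_sum_le det_terms(1))

lemma red_det: "A \<in> int_mats n \<Longrightarrow> red (det A) = det (rm A)"
proof -
  assume A: "A \<in> int_mats n"
  note c = int_matsD(1)[OF A]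
  have "red (\<Sum>\<sigma> | \<sigma> permutes {0..<n}. signof \<sigma> * (\<Prod>i=0..<n. A $$ (i, \<sigma> i))) =
    (\<Sum>\<sigma> | \<sigma> permutes {0..<n}. red (signof \<sigma> * (\<Prod>i=0..<n. A $$ (i, \<sigma> i))))"
    by (rule red_sum) (auto intro: det_terms(1)[OF A])
  also have "\<dots> = (\<Sum>\<sigma> | \<sigma> permutes {0..<n}. signof \<sigma> * (\<Prod>i=0..<n. rm A $$ (i, \<sigma> i)))"
    by (rule sum.cong) (auto intro: det_terms(2)[OF A])
  finally show ?thesis by (simp only: det_def'[OF c] det_def'[OF rm_carrier[OF c]])
qed

lemma GL_integers_iff:
  "A \<in> GL_integers absv n \<longleftrightarrow> A \<in> int_mats n \<and> (\<exists>B \<in> int_mats n. A * B = 1\<^sub>m n \<and> B * A = 1\<^sub>m n)"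
proof -
  have "elements_mat A \<subseteq> integers absv \<longleftrightarrow> (\<forall>i<n. \<forall>j<n. absv (A $$ (i, j)) \<le> 1)"
    if "A \<in> carrier_mat n n" for A :: "'a mat"
  proof
    assume sub: "elements_mat A \<subseteq> integers absv"
    show "\<forall>i<n. \<forall>j<n. absv (A $$ (i, j)) \<le> 1"
    proof (intro allI impI)
      fix i j assume "i < n" "j < n"
      then have "A $$ (i, j) \<in> integers absv" using elements_matI[OF that _ _ refl] sub by blast
      then show "absv (A $$ (i, j)) \<le> 1" by (simp add: integers_def)
    qed
  next
    assume "\<forall>i<n. \<forall>j<n. absv (A $$ (i, j)) \<le> 1"
    then show "elements_mat A \<subseteq> integers absv"
      using that by (auto simp: integers_def dest!: elements_matD)
  qed
  then show ?thesis by (auto simp: GL_integers_def int_mats_def)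
qed

lemma GL_int_mats: "A \<in> GL_integers absv n \<Longrightarrow> A \<in> int_mats n"
  by (simp add: GL_integers_iff)

lemma GL_mult: "A \<in> GL_integers absv n \<Longrightarrow> B \<in> GL_integers absv n \<Longrightarrow> A * B \<in> GL_integers absv n"
proof -
  assume "A \<in> GL_integers absv n" "B \<in> GL_integers absv n"
  then obtain A' B' where A: "A \<in> int_mats n" "A' \<in> int_mats n" "A * A' = 1\<^sub>m n" "A' * A = 1\<^sub>m n"
    and B: "B \<in> int_mats n" "B' \<in> int_mats n" "B * B' = 1\<^sub>m n" "B' * B = 1\<^sub>m n" by (auto simp: GL_integers_iff)
  note c = int_matsD(1)[OF A(1)] int_matsD(1)[OF A(2)] int_matsD(1)[OF B(1)] int_matsD(1)[OF B(2)]
  note as = assoc_mult_mat[of _ n n _ n _ n]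
  have "A * B * (B' * A') = A * (B * B') * A'" "B' * A' * (A * B) = B' * (A' * A) * B" using c by (simp_all add: as)
  then have "A * B * (B' * A') = 1\<^sub>m n" "B' * A' * (A * B) = 1\<^sub>m n" using A B c by simp_all
  then show ?thesis using A B by (auto simp: GL_integers_iff int_mats_mult)
qed

lemma GL_inverse:
  assumes "A \<in> GL_integers absv n"
  obtains B where "B \<in> GL_integers absv n" "A * B = 1\<^sub>m n" "B * A = 1\<^sub>m n"
  using assms unfolding GL_integers_iff by blast

lemma rm_GL: "A \<in> GL_integers absv n \<Longrightarrow> rm A \<in> general_linear n"
proof -
  assume "A \<in> GL_integers absv n"
  then obtain B where A: "A \<in> int_mats n" "B \<in> int_mats n" "A * B = 1\<^sub>m n" by (auto simp: GL_integers_iff)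
  then have "rm A * rm B = 1\<^sub>m n" using rm_mult[OF A(1,2)] rm_one by simp
  then show ?thesis using A by (intro general_linearI[of _ n "rm B"]) (auto intro!: rm_carrier dest: int_matsD(1))
qed

lemma int_mats_adj: "A \<in> int_mats n \<Longrightarrow> adj_mat A \<in> int_mats n"
proof -
  assume A: "A \<in> int_mats n"
  note c = int_matsD(1)[OF A]
  have "absv (adj_mat A $$ (i, j)) \<le> 1" if ij: "i < n" "j < n" for i j
  proof -
    have "mat_delete A j i \<in> int_mats (n - 1)"
      unfolding int_mats_def
    proof (intro CollectI conjI allI impI)
      show "mat_delete A j i \<in> carrier_mat (n - 1) (n - 1)" using c by (rule mat_delete_carrier)
      fix a b assume "a < n - 1" "b < n - 1"
      then show "absv (mat_delete A j i $$ (a, b)) \<le> 1"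
        using c int_matsD(2)[OF A] by (auto simp: mat_delete_def)
    qed
    then have "absv (det (mat_delete A j i)) \<le> 1" by (rule absv_det)
    moreover have "absv ((- 1) ^ (j + i)) = 1" by (simp only: absv_power absv_minus absv_1 power_one)
    ultimately have "absv ((- 1) ^ (j + i) * det (mat_delete A j i)) \<le> 1" by (simp add: absv_mult)
    then show ?thesis using ij c by (simp add: adj_mat_def cofactor_def)
  qed
  then show ?thesis using adj_mat(1)[OF c] by (simp add: int_mats_def)
qed

text \<open>The determinant does not reduce to zero, so it is a unit, and the inverse is given by
  the integral adjugate.\<close>

lemma GL_of_rm: "A \<in> int_mats n \<Longrightarrow> rm A \<in> general_linear n \<Longrightarrow> A \<in> GL_integers absv n"
proof -
  assume A: "A \<in> int_mats n" and G: "rm A \<in> general_linear n"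
  note c = int_matsD(1)[OF A]
  have "red (det A) \<noteq> 0" using G red_det[OF A] by (simp add: general_linear_def)
  then have d: "absv (det A) = 1" using red_eq_0_iff[OF absv_det[OF A]] absv_det[OF A] by simp
  then have d0: "det A \<noteq> 0" by auto
  define B where "B = inverse (det A) \<cdot>\<^sub>m adj_mat A"
  have B: "B \<in> int_mats n" unfolding B_def using d by (intro int_mats_smult int_mats_adj A) (simp add: absv_inverse)
  have "A * B = 1\<^sub>m n" "B * A = 1\<^sub>m n"
    using adj_mat[OF c] c d0 unfolding B_def
    by (simp_all add: mult_smult_distrib[of _ n n _ n] mult_smult_assoc_mat[of _ n n _ n])
      (intro eq_matI; auto)+
  then show ?thesis using A B by (auto simp: GL_integers_iff)
qed

lemma rm_lift: "B \<in> carrier_mat n n \<Longrightarrow> \<exists>A \<in> int_mats n. rm A = B"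
proof -
  assume B: "B \<in> carrier_mat n n"
  define l where "l k = (SOME x. absv x \<le> 1 \<and> red x = k)" for k
  have l: "absv (l k) \<le> 1" "red (l k) = k" for k
    using someI_ex[OF red_surj[of k]] by (auto simp: l_def)
  show ?thesis
    using B l by (intro bexI[of _ "map_mat l B"]) (auto simp: rm_def int_mats_def intro!: eq_matI)
qed

section \<open>Congruence neighbourhoods and continuity\<close>

lemma topspace_GL [simp]: "topspace (GL_topology absv n) = GL_integers absv n"
  unfolding GL_topology_def topspace_pullback_topology
  by (auto simp: GL_integers_iff int_mats_def PiE_def extensional_def integers_def)

text \<open>Invertible integral matrices congruent to \<open>A0\<close> modulo \<open>p ^ j\<close>.
  With these open sets all continuity arguments become entrywise congruences.\<close>

definition nbhd :: "nat \<Rightarrow> nat \<Rightarrow> 'a mat \<Rightarrow> 'a mat set" where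
  "nbhd n j A0 = {A \<in> GL_integers absv n. \<forall>i<n. \<forall>k<n. absv (A $$ (i, k) - A0 $$ (i, k)) \<le> \<nu> ^ j}"

lemma openin_nbhd: "A0 \<in> GL_integers absv n \<Longrightarrow> openin (GL_topology absv n) (nbhd n j A0)"
proof -
  assume A0: "A0 \<in> GL_integers absv n"
  let ?I = "{..<n} \<times> {..<n}"
  let ?U = "PiE ?I (\<lambda>ij. ball j (A0 $$ ij))"
  have "openin (product_topology (\<lambda>_. integers_topology absv) ?I) ?U"
    using A0 int_matsD(2)[OF GL_int_mats[OF A0]] by (subst openin_PiE) (auto simp: openin_ball)
  moreover have "nbhd n j A0 = (\<lambda>A. \<lambda>ij \<in> ?I. A $$ ij) -` ?U \<inter> GL_integers absv n"
  proof -
    have "(\<lambda>ij \<in> ?I. A $$ ij) \<in> ?U \<longleftrightarrow> (\<forall>i<n. \<forall>k<n. absv (A $$ (i, k) - A0 $$ (i, k)) \<le> \<nu> ^ j)" for A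
    proof -
      have "(\<lambda>ij \<in> ?I. A $$ ij) \<in> ?U \<longleftrightarrow> (\<forall>ij\<in>?I. A $$ ij \<in> ball j (A0 $$ ij))" by (simp add: PiE_iff)
      also have "\<dots> \<longleftrightarrow> (\<forall>i<n. \<forall>k<n. absv (A $$ (i, k) - A0 $$ (i, k)) \<le> \<nu> ^ j)"
        unfolding Ball_def split_paired_All by (simp add: ball_def) blast
      finally show ?thesis .
    qed
    then show ?thesis by (auto simp: nbhd_def)
  qed
  ultimately show ?thesis unfolding GL_topology_def openin_pullback_topology by blast
qed

lemma nbhd_self: "A \<in> GL_integers absv n \<Longrightarrow> A \<in> nbhd n j A"
  using \<nu> by (simp add: nbhd_def)

lemma openin_GLI:
  assumes "S \<subseteq> GL_integers absv n" "\<And>A. A \<in> S \<Longrightarrow> \<exists>j. nbhd n j A \<subseteq> S"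
  shows "openin (GL_topology absv n) S"
proof -
  have "\<exists>T. openin (GL_topology absv n) T \<and> A \<in> T \<and> T \<subseteq> S" if A: "A \<in> S" for A
  proof -
    obtain j where j: "nbhd n j A \<subseteq> S" using assms(2)[OF A] by blast
    have "A \<in> GL_integers absv n" using A assms(1) by blast
    then show ?thesis by (intro exI[of _ "nbhd n j A"] conjI openin_nbhd nbhd_self j)
  qed
  then show ?thesis by (subst openin_subopen) blast
qed

text \<open>The difference of the products is \<open>A * (B - B') + (A - A') * B'\<close>, and
  integral factors do not increase absolute values.\<close>

lemma mult_close:
  assumes "A \<in> int_mats n" "A' \<in> int_mats n" "B \<in> int_mats n" "B' \<in> int_mats n" "0 \<le> c"
    and "\<And>i k. i < n \<Longrightarrow> k < n \<Longrightarrow> absv (A $$ (i, k) - A' $$ (i, k)) \<le> c"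
    and "\<And>i k. i < n \<Longrightarrow> k < n \<Longrightarrow> absv (B $$ (i, k) - B' $$ (i, k)) \<le> c"
    and ij: "i < n" "k < n"
  shows "absv ((A * B) $$ (i, k) - (A' * B') $$ (i, k)) \<le> c"
proof -
  note cr = int_matsD(1)[OF assms(1)] int_matsD(1)[OF assms(2)] int_matsD(1)[OF assms(3)] int_matsD(1)[OF assms(4)]
  have "(A * B) $$ (i, k) - (A' * B') $$ (i, k) =
    (\<Sum>l<n. A $$ (i, l) * (B $$ (l, k) - B' $$ (l, k)) + (A $$ (i, l) - A' $$ (i, l)) * B' $$ (l, k))"
    unfolding mult_index[OF cr(1,3) ij] mult_index[OF cr(2,4) ij] sum_subtractf[symmetric]
    by (intro sum.cong) (auto simp: algebra_simps)
  also have "absv \<dots> \<le> c"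
  proof (rule absv_sum_le)
    fix l assume "l \<in> {..<n}"
    then have l: "l < n" by simp
    have "absv (A $$ (i, l)) * absv (B $$ (l, k) - B' $$ (l, k)) \<le> 1 * c"
      using int_matsD(2)[OF assms(1) ij(1) l] assms(7)[OF l ij(2)] absv_nonneg by (intro mult_mono) auto
    moreover have "absv (A $$ (i, l) - A' $$ (i, l)) * absv (B' $$ (l, k)) \<le> c * 1"
      using int_matsD(2)[OF assms(4) l ij(2)] assms(6)[OF ij(1) l] absv_nonneg assms(5) by (intro mult_mono) auto
    ultimately show "absv (A $$ (i, l) * (B $$ (l, k) - B' $$ (l, k)) + (A $$ (i, l) - A' $$ (i, l)) * B' $$ (l, k)) \<le> c"
      by (intro absv_add_le) (simp_all add: absv_mult)
  qed (rule assms(5))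
  finally show ?thesis .
qed

lemma pow_close:
  assumes "A \<in> int_mats n" "A' \<in> int_mats n" "0 \<le> c"
    and cl: "\<And>i k. i < n \<Longrightarrow> k < n \<Longrightarrow> absv (A $$ (i, k) - A' $$ (i, k)) \<le> c"
  shows "i < n \<Longrightarrow> k < n \<Longrightarrow> absv ((A ^\<^sub>m r) $$ (i, k) - (A' ^\<^sub>m r) $$ (i, k)) \<le> c"
proof (induction r arbitrary: i k)
  case 0
  then show ?case using int_matsD(1)[OF assms(1)] int_matsD(1)[OF assms(2)] assms(3) by simp
next
  case (Suc r)
  show ?case
    unfolding pow_mat.simps
    by (rule mult_close[OF int_mats_pow[OF assms(1)] int_mats_pow[OF assms(2)] assms(1,2,3) Suc.IH cl]) (use Suc.prems in auto)
qed

lemma trace_pow_close: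
  assumes "A \<in> int_mats n" "A' \<in> int_mats n" "0 \<le> c"
    and cl: "\<And>i k. i < n \<Longrightarrow> k < n \<Longrightarrow> absv (A $$ (i, k) - A' $$ (i, k)) \<le> c"
  shows "absv (mat_trace (A ^\<^sub>m r) - mat_trace (A' ^\<^sub>m r)) \<le> c"
proof -
  have "dim_row (A ^\<^sub>m r) = n" "dim_row (A' ^\<^sub>m r) = n"
    using int_matsD(1)[OF int_mats_pow[OF assms(1)]] int_matsD(1)[OF int_mats_pow[OF assms(2)]] by (auto simp only: carrier_matD)
  then have "mat_trace (A ^\<^sub>m r) - mat_trace (A' ^\<^sub>m r) = (\<Sum>i<n. (A ^\<^sub>m r) $$ (i, i) - (A' ^\<^sub>m r) $$ (i, i))"
    by (simp only: mat_trace_def sum_subtractf)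
  also have "absv \<dots> \<le> c" using pow_close[OF assms] assms(3) by (intro absv_sum_le) auto
  finally show ?thesis .
qed

lemma rm_close:
  assumes "A \<in> int_mats n" "A' \<in> int_mats n"
    and cl: "\<And>i k. i < n \<Longrightarrow> k < n \<Longrightarrow> absv (A $$ (i, k) - A' $$ (i, k)) \<le> \<nu>"
  shows "rm A = rm A'"
proof (rule eq_matI)
  note c = int_matsD(1)[OF assms(1)] int_matsD(1)[OF assms(2)]
  fix i j assume "i < dim_row (rm A')" "j < dim_col (rm A')"
  then have ij: "i < n" "j < n" using c by (auto simp: rm_def)
  then show "rm A $$ (i, j) = rm A' $$ (i, j)"
    using red_eq_iff[OF int_matsD(2)[OF assms(1) ij] int_matsD(2)[OF assms(2) ij]] cl[OF ij] c
    by (simp add: rm_index[of _ n] absv_less_1_iff)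
qed (use int_matsD(1)[OF assms(1)] int_matsD(1)[OF assms(2)] in \<open>auto simp: rm_def\<close>)

text \<open>\<open>D\<close> is the noncommutative derivative, a sum of terms with \<open>Y\<close>
  between powers of \<open>A\<close>. Its shape is irrelevant: against a power of \<open>A\<close>,
  cyclicity of the trace makes all \<open>Suc r\<close> terms equal. The free exponent
  \<open>l\<close> carries the induction; the application takes \<open>l = 0\<close>.\<close>

lemma pow_expansion:
  assumes A: "A \<in> int_mats n" and Y: "Y \<in> int_mats n" and e: "absv e \<le> 1"
  shows "\<exists>D \<in> int_mats n. \<exists>R \<in> int_mats n. (A + e \<cdot>\<^sub>m Y) ^\<^sub>m Suc r = A ^\<^sub>m Suc r + e \<cdot>\<^sub>m D + (e * e) \<cdot>\<^sub>m R \<and>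
     (\<forall>l. mat_trace (D * A ^\<^sub>m l) = of_nat (Suc r) * mat_trace (A ^\<^sub>m (r + l) * Y))"
proof (induction r)
  case 0
  note c = int_matsD(1)[OF A] int_matsD(1)[OF Y]
  have "(A + e \<cdot>\<^sub>m Y) ^\<^sub>m Suc 0 = A ^\<^sub>m Suc 0 + e \<cdot>\<^sub>m Y + (e * e) \<cdot>\<^sub>m 0\<^sub>m n n"
    using c by (auto intro!: eq_matI)
  moreover have "mat_trace (Y * A ^\<^sub>m l) = of_nat (Suc 0) * mat_trace (A ^\<^sub>m (0 + l) * Y)" for l
    using mat_trace_mult_commute[of Y n n "A ^\<^sub>m l"] c by simp
  moreover have "0\<^sub>m n n \<in> int_mats n" by (auto simp: int_mats_def)
  ultimately show ?case using Y by (intro bexI[of _ Y] bexI[of _ "0\<^sub>m n n"] conjI allI)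
next
  case (Suc r)
  then obtain D R where D: "D \<in> int_mats n" and R: "R \<in> int_mats n"
    and eq: "(A + e \<cdot>\<^sub>m Y) ^\<^sub>m Suc r = A ^\<^sub>m Suc r + e \<cdot>\<^sub>m D + (e * e) \<cdot>\<^sub>m R"
    and tr: "\<And>l. mat_trace (D * A ^\<^sub>m l) = of_nat (Suc r) * mat_trace (A ^\<^sub>m (r + l) * Y)" by blast
  define P where "P = A ^\<^sub>m Suc r"
  have P: "P \<in> int_mats n" unfolding P_def by (rule int_mats_pow[OF A])
  note c = int_matsD(1)[OF A] int_matsD(1)[OF Y] int_matsD(1)[OF D] int_matsD(1)[OF R] int_matsD(1)[OF P]
  \<comment> \<open>The coefficients of \<open>e\<close> and \<open>e * e\<close> after multiplying
    the expansion by \<open>A + e * Y\<close>, with the cubic term absorbed into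
    \<open>R'\<close>.\<close>
  define D' where "D' = D * A + P * Y"
  define R' where "R' = R * A + D * Y + e \<cdot>\<^sub>m (R * Y)"
  have "(A + e \<cdot>\<^sub>m Y) ^\<^sub>m Suc (Suc r) = (P + e \<cdot>\<^sub>m D + (e * e) \<cdot>\<^sub>m R) * (A + e \<cdot>\<^sub>m Y)"
    using eq unfolding P_def by simp
  also have "\<dots> = P * A + e \<cdot>\<^sub>m D' + (e * e) \<cdot>\<^sub>m R'"
  proof (rule eq_matI)
    fix i j assume "i < dim_row (P * A + e \<cdot>\<^sub>m D' + (e * e) \<cdot>\<^sub>m R')" "j < dim_col (P * A + e \<cdot>\<^sub>m D' + (e * e) \<cdot>\<^sub>m R')"
    then have ij: "i < n" "j < n" using c by (auto simp: R'_def)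
    have "((P + e \<cdot>\<^sub>m D + (e * e) \<cdot>\<^sub>m R) * (A + e \<cdot>\<^sub>m Y)) $$ (i, j) =
      (\<Sum>l<n. (P $$ (i, l) + e * D $$ (i, l) + e * e * R $$ (i, l)) * (A $$ (l, j) + e * Y $$ (l, j)))"
      using c ij by (subst mult_index[of _ n]) (auto simp: add.assoc)
    also have "\<dots> = (\<Sum>l<n. P $$ (i, l) * A $$ (l, j)) + e * ((\<Sum>l<n. D $$ (i, l) * A $$ (l, j)) + (\<Sum>l<n. P $$ (i, l) * Y $$ (l, j)))
      + e * e * ((\<Sum>l<n. R $$ (i, l) * A $$ (l, j)) + (\<Sum>l<n. D $$ (i, l) * Y $$ (l, j)) + e * (\<Sum>l<n. R $$ (i, l) * Y $$ (l, j)))"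
    proof -
      have "(\<Sum>l<n. (P $$ (i, l) + e * D $$ (i, l) + e * e * R $$ (i, l)) * (A $$ (l, j) + e * Y $$ (l, j))) =
        (\<Sum>l<n. P $$ (i, l) * A $$ (l, j) + e * (D $$ (i, l) * A $$ (l, j) + P $$ (i, l) * Y $$ (l, j)) +
          e * e * (R $$ (i, l) * A $$ (l, j) + D $$ (i, l) * Y $$ (l, j) + e * (R $$ (i, l) * Y $$ (l, j))))"
        by (intro sum.cong refl) (simp add: algebra_simps)
      then show ?thesis by (simp only: sum.distrib sum_distrib_left[symmetric])
    qed
    also have "\<dots> = (P * A + e \<cdot>\<^sub>m D' + (e * e) \<cdot>\<^sub>m R') $$ (i, j)"
      unfolding mult_index[OF c(5,1) ij, symmetric] mult_index[OF c(3,1) ij, symmetric] mult_index[OF c(5,2) ij, symmetric]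
        mult_index[OF c(4,1) ij, symmetric] mult_index[OF c(3,2) ij, symmetric] mult_index[OF c(4,2) ij, symmetric]
      using c ij by (simp add: D'_def R'_def)
    finally show "((P + e \<cdot>\<^sub>m D + (e * e) \<cdot>\<^sub>m R) * (A + e \<cdot>\<^sub>m Y)) $$ (i, j) = (P * A + e \<cdot>\<^sub>m D' + (e * e) \<cdot>\<^sub>m R') $$ (i, j)" .
  qed (use c in \<open>auto simp: D'_def R'_def\<close>)
  finally have 1: "(A + e \<cdot>\<^sub>m Y) ^\<^sub>m Suc (Suc r) = A ^\<^sub>m Suc (Suc r) + e \<cdot>\<^sub>m D' + (e * e) \<cdot>\<^sub>m R'"
    unfolding P_def by simp
  have 2: "mat_trace (D' * A ^\<^sub>m l) = of_nat (Suc (Suc r)) * mat_trace (A ^\<^sub>m (Suc r + l) * Y)" for l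
  proof -
    define Q where "Q = A ^\<^sub>m l"
    have Q: "Q \<in> carrier_mat n n" unfolding Q_def using c by simp
    have AQ: "A * Q = A ^\<^sub>m Suc l"
      using mat_pow_add[of A n 1 l] c by (simp add: Q_def)
    have QP: "Q * P = A ^\<^sub>m (Suc r + l)" unfolding P_def Q_def using mat_pow_add[of A n l "Suc r"] c by (simp add: add.commute)
    have "D' * Q = D * (A * Q) + P * Y * Q"
      unfolding D'_def using c Q by (simp add: add_mult_distrib_mat[of _ n n] assoc_mult_mat[of _ n n _ n _ n])
    then have "mat_trace (D' * Q) = mat_trace (D * A ^\<^sub>m Suc l) + mat_trace (P * Y * Q)"
      using c Q by (simp add: mat_trace_add[of _ n] AQ del: pow_mat.simps)
    also have "mat_trace (P * Y * Q) = mat_trace (Q * (P * Y))" using c Q by (intro mat_trace_mult_commute[of _ n n]) auto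
    also have "Q * (P * Y) = A ^\<^sub>m (Suc r + l) * Y" unfolding QP[symmetric] using c Q by (simp add: assoc_mult_mat[of _ n n _ n _ n])
    also have "mat_trace (D * A ^\<^sub>m Suc l) = of_nat (Suc r) * mat_trace (A ^\<^sub>m (Suc r + l) * Y)" using tr[of "Suc l"] by simp
    finally show ?thesis unfolding Q_def by (simp add: algebra_simps)
  qed
  have "D' \<in> int_mats n" unfolding D'_def by (intro int_mats_add int_mats_mult A Y D P)
  moreover have "R' \<in> int_mats n" unfolding R'_def by (intro int_mats_add int_mats_mult int_mats_smult A Y D R e)
  ultimately show ?case by (intro bexI[of _ D'] bexI[of _ R'] conjI allI 1 2)
qed

text \<open>The linear term of the trace is \<open>e\<close> times
  \<open>of_nat r * mat_trace (Z * A ^\<^sub>m r)\<close>. By hypothesis the latter factor is 1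
  modulo the maximal ideal, so the linear term is \<open>e\<close> up to one further level.\<close>

lemma trace_pow_left_mult:
  assumes A: "A \<in> int_mats n" and Z: "Z \<in> int_mats n" and r: "r > 0"
    and Zr: "red (of_nat r * mat_trace (Z * A ^\<^sub>m r)) = 1" and s: "absv s \<le> 1" and j: "j \<ge> 1"
  shows "absv (mat_trace (((1\<^sub>m n + (of_nat p ^ j * s) \<cdot>\<^sub>m Z) * A) ^\<^sub>m r) - (mat_trace (A ^\<^sub>m r) + of_nat p ^ j * s)) \<le> \<nu> ^ Suc j"
proof -
  note c = int_matsD(1)[OF A] int_matsD(1)[OF Z]
  define e where "e = of_nat p ^ j * s"
  have ej: "absv e \<le> \<nu> ^ j" unfolding e_def using s absv_le_power_iff by blast
  have "\<nu> ^ j \<le> 1" using \<nu> by (simp add: power_le_one)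
  then have e1: "absv e \<le> 1" using ej by simp
  obtain r' where r': "r = Suc r'" using r by (cases r) auto
  define Y where "Y = Z * A"
  have Y: "Y \<in> int_mats n" unfolding Y_def by (rule int_mats_mult[OF Z A])
  have gA: "(1\<^sub>m n + e \<cdot>\<^sub>m Z) * A = A + e \<cdot>\<^sub>m Y"
    unfolding Y_def using c by (simp add: add_mult_distrib_mat[of _ n n] mult_smult_assoc_mat[of _ n n _ n])
  obtain D R where D: "D \<in> int_mats n" and R: "R \<in> int_mats n"
    and eq: "(A + e \<cdot>\<^sub>m Y) ^\<^sub>m r = A ^\<^sub>m r + e \<cdot>\<^sub>m D + (e * e) \<cdot>\<^sub>m R"
    and tr: "\<And>l. mat_trace (D * A ^\<^sub>m l) = of_nat r * mat_trace (A ^\<^sub>m (r' + l) * Y)"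
    using pow_expansion[OF A Y e1, of r'] unfolding r' by blast
  note cd = int_matsD(1)[OF D] int_matsD(1)[OF R]
  have tD: "mat_trace D = of_nat r * mat_trace (Z * A ^\<^sub>m r)"
  proof -
    define Q where "Q = A ^\<^sub>m r'"
    have Q: "Q \<in> carrier_mat n n" using c by (simp add: Q_def)
    have AQ: "A * Q = A ^\<^sub>m r" unfolding r' Q_def using mat_pow_add[of A n 1 r'] c by simp
    have "mat_trace D = of_nat r * mat_trace (Q * (Z * A))" using tr[of 0] c cd by (simp add: Y_def Q_def)
    also have "mat_trace (Q * (Z * A)) = mat_trace (Z * A * Q)" using c Q by (intro mat_trace_mult_commute[of _ n n]) auto
    also have "Z * A * Q = Z * A ^\<^sub>m r" using c Q AQ by (simp add: assoc_mult_mat[of _ n n _ n _ n])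
    finally show ?thesis .
  qed
  have Ar: "A ^\<^sub>m r \<in> carrier_mat n n" using c by simp
  have "mat_trace ((A + e \<cdot>\<^sub>m Y) ^\<^sub>m r) = mat_trace (A ^\<^sub>m r) + e * mat_trace D + e * e * mat_trace R"
    unfolding eq using Ar cd by (simp add: mat_trace_add[of _ n] mat_trace_smult[of _ n])
  then have "mat_trace ((A + e \<cdot>\<^sub>m Y) ^\<^sub>m r) - (mat_trace (A ^\<^sub>m r) + e) = e * (mat_trace D - 1) + e * e * mat_trace R"
    by (simp add: algebra_simps)
  also have "absv \<dots> \<le> \<nu> ^ Suc j"
  proof (rule absv_add_le)
    have "absv (mat_trace D) \<le> 1" using D by (rule absv_mat_trace)
    then have "absv (mat_trace D - 1) \<le> \<nu>" using red_eq_iff[of "mat_trace D" 1] Zr tD by (simp add: absv_less_1_iff)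
    then have "absv e * absv (mat_trace D - 1) \<le> \<nu> ^ j * \<nu>" using ej absv_nonneg \<nu> by (intro mult_mono) auto
    then show "absv (e * (mat_trace D - 1)) \<le> \<nu> ^ Suc j" by (simp add: absv_mult mult.commute)
    \<comment> \<open>As \<open>j \<ge> 1\<close>, the quadratic term is at least one level smaller
      than \<open>e\<close>.\<close>
    have "absv e * absv e \<le> \<nu> ^ j * \<nu>"
    proof (rule mult_mono)
      have "\<nu> ^ j \<le> \<nu> ^ 1" using \<nu> j by (intro power_decreasing) auto
      then show "absv e \<le> \<nu>" using ej by simp
    qed (use ej absv_nonneg \<nu> in auto)
    then have "absv e * absv e * absv (mat_trace R) \<le> \<nu> ^ j * \<nu> * 1"
      by (rule mult_mono) (use absv_mat_trace[OF R] absv_nonneg \<nu> in auto)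
    then show "absv (e * e * mat_trace R) \<le> \<nu> ^ Suc j" by (simp add: absv_mult mult.commute)
  qed
  finally show ?thesis unfolding e_def[symmetric] gA .
qed

end

section \<open>Haar measure on the general linear group\<close>

locale haar_GL = odd_unramified_extension +
  fixes n r :: nat and \<rho> :: "'a mat measure"
  assumes n_pos: "n \<ge> 1" and r_pos: "r > 0" and r_coprime: "\<not> p dvd r"
    and haar: "haar_prob (GL_topology absv n) (*) \<rho>"
begin

sublocale prob_space \<rho>
  using haar by (simp add: haar_prob_def)

lemma GL_opens_Pow: "{U. openin (GL_topology absv n) U} \<subseteq> Pow (GL_integers absv n)"
  using openin_subset by fastforce

lemma sets_rho: "sets \<rho> = sigma_sets (GL_integers absv n) {U. openin (GL_topology absv n) U}"
  using haar sets_measure_of[OF GL_opens_Pow] by (simp add: haar_prob_def borel_of_def)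

lemma space_rho: "space \<rho> = GL_integers absv n"
proof -
  have "space \<rho> = space (borel_of (GL_topology absv n))"
    using haar by (intro sets_eq_imp_space_eq) (simp add: haar_prob_def)
  then show ?thesis using space_measure_of[OF GL_opens_Pow] by (simp add: borel_of_def)
qed

lemma open_in_sets: "openin (GL_topology absv n) U \<Longrightarrow> U \<in> sets \<rho>"
  unfolding sets_rho by auto

lemma measure_left_mult:
  assumes "g \<in> GL_integers absv n" "S \<in> sets \<rho>"
  shows "measure \<rho> ((*) g ` S) = measure \<rho> S"
  using haar assms by (simp add: haar_prob_def measure_def)

definition T :: "'a mat \<Rightarrow> 'a" where "T A = mat_trace (A ^\<^sub>m r)"

lemma T_integer: "A \<in> GL_integers absv n \<Longrightarrow> absv (T A) \<le> 1"
  unfolding T_def by (intro absv_mat_trace[of _ n] int_mats_pow GL_int_mats)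

lemma red_T: "A \<in> GL_integers absv n \<Longrightarrow> red (T A) = mat_trace (rm A ^\<^sub>m r)"
  unfolding T_def by (simp add: red_mat_trace[OF int_mats_pow[OF GL_int_mats]] rm_pow[OF GL_int_mats])

lemma nbhd_T: "A' \<in> nbhd n j A \<Longrightarrow> A \<in> GL_integers absv n \<Longrightarrow> T A' \<in> ball j (T A)"
  unfolding T_def ball_def nbhd_def using \<nu> by (auto intro!: trace_pow_close[of _ n] dest: GL_int_mats)

lemma nbhd_rm: "A' \<in> nbhd n j A \<Longrightarrow> A \<in> GL_integers absv n \<Longrightarrow> j \<ge> 1 \<Longrightarrow> rm A' = rm A"
proof (rule rm_close[of _ n])
  assume *: "A' \<in> nbhd n j A" "A \<in> GL_integers absv n" "j \<ge> 1"
  show "A' \<in> int_mats n" "A \<in> int_mats n" using * by (auto simp: nbhd_def dest: GL_int_mats)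
  fix i k assume "i < n" "k < n"
  then have "absv (A' $$ (i, k) - A $$ (i, k)) \<le> \<nu> ^ j" using * by (simp add: nbhd_def)
  also have "\<dots> \<le> \<nu> ^ 1" using \<nu> * by (intro power_decreasing) auto
  finally show "absv (A' $$ (i, k) - A $$ (i, k)) \<le> \<nu>" by simp
qed

text \<open>The whole reduction \<open>B\<close> is fixed, and not only the residue of the trace, so
  that one multiplier serves all matrices of the cell.\<close>

definition cell :: "'a resfield mat \<Rightarrow> 'a set \<Rightarrow> 'a mat set" where
  "cell B U = {A \<in> GL_integers absv n. rm A = B \<and> T A \<in> U}"

lemma openin_T_preimage:
  assumes "openin (integers_topology absv) U"
  shows "openin (GL_topology absv n) {A \<in> GL_integers absv n. T A \<in> U}"
proof (rule openin_GLI)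
  fix A assume A: "A \<in> {A \<in> GL_integers absv n. T A \<in> U}"
  then have A': "A \<in> GL_integers absv n" by simp
  have TU: "T A \<in> U" using A by simp
  obtain j where j: "ball j (T A) \<subseteq> U" by (rule open_contains_ball[OF assms TU])
  have "nbhd n j A \<subseteq> {A \<in> GL_integers absv n. T A \<in> U}"
  proof
    fix A1 assume A1: "A1 \<in> nbhd n j A"
    then show "A1 \<in> {A \<in> GL_integers absv n. T A \<in> U}" using nbhd_T[OF A1 A'] j by (auto simp: nbhd_def)
  qed
  then show "\<exists>j. nbhd n j A \<subseteq> {A \<in> GL_integers absv n. T A \<in> U}" ..
qed auto

lemma openin_cell_UNIV: "openin (GL_topology absv n) {A \<in> GL_integers absv n. rm A = B}"
proof (rule openin_GLI)
  fix A assume A: "A \<in> {A \<in> GL_integers absv n. rm A = B}"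
  have "nbhd n 1 A \<subseteq> {A \<in> GL_integers absv n. rm A = B}"
  proof
    fix A1 assume A1: "A1 \<in> nbhd n 1 A"
    then show "A1 \<in> {A \<in> GL_integers absv n. rm A = B}" using nbhd_rm[OF A1] A by (auto simp: nbhd_def)
  qed
  then show "\<exists>j. nbhd n j A \<subseteq> {A \<in> GL_integers absv n. rm A = B}" ..
qed auto

lemma measurable_T: "T \<in> \<rho> \<rightarrow>\<^sub>M borel_of (integers_topology absv)"
  unfolding borel_of_def
proof (rule measurable_measure_of)
  show "{U. openin (integers_topology absv) U} \<subseteq> Pow (topspace (integers_topology absv))"
    using openin_subset by fastforce
  show "T \<in> space \<rho> \<rightarrow> topspace (integers_topology absv)"
    using T_integer by (auto simp: space_rho integers_def)
  fix U assume "U \<in> {U. openin (integers_topology absv) U}"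
  then have "{A \<in> GL_integers absv n. T A \<in> U} \<in> sets \<rho>" using openin_T_preimage open_in_sets by blast
  moreover have "T -` U \<inter> space \<rho> = {A \<in> GL_integers absv n. T A \<in> U}" by (auto simp: space_rho)
  ultimately show "T -` U \<inter> space \<rho> \<in> sets \<rho>" by simp
qed

lemma T_preimage_in_sets:
  "S \<in> sets (borel_of (integers_topology absv)) \<Longrightarrow> {A \<in> GL_integers absv n. T A \<in> S} \<in> sets \<rho>"
  using measurable_sets[OF measurable_T, of S] by (simp add: space_rho vimage_def Int_def conj_commute)

lemma cell_in_sets:
  assumes "S \<in> sets (borel_of (integers_topology absv))"
  shows "cell B S \<in> sets \<rho>"
proof -
  have "cell B S = {A \<in> GL_integers absv n. T A \<in> S} \<inter> {A \<in> GL_integers absv n. rm A = B}"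
    by (auto simp: cell_def)
  then show ?thesis using T_preimage_in_sets[OF assms] open_in_sets[OF openin_cell_UNIV] by auto
qed

lemma measure_T_preimage:
  assumes "S \<in> sets (borel_of (integers_topology absv))"
  shows "measure \<rho> {A \<in> GL_integers absv n. T A \<in> S} = (\<Sum>B\<in>general_linear n. measure \<rho> (cell B S))"
proof -
  have "{A \<in> GL_integers absv n. T A \<in> S} = (\<Union>B\<in>general_linear n. cell B S)"
    using rm_GL by (auto simp: cell_def)
  also have "measure \<rho> \<dots> = (\<Sum>B\<in>general_linear n. measure \<rho> (cell B S))"
    using cell_in_sets[OF assms]
    by (intro finite_measure_finite_Union finite_general_linear finite_resfield)
       (auto simp: disjoint_family_on_def cell_def)
  finally show ?thesis .
qed

text \<open>The condition on \<open>Z\<close> depends only on the reduction of \<open>A\<close>, so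
  one \<open>g\<close> shifts the trace on the entire cell. Being congruent to the identity it
  preserves the reduction, and its inverse shows that the cells correspond exactly.\<close>

lemma cell_shift:
  assumes B: "B \<in> general_linear n" and j: "j \<ge> 1" and x: "absv x \<le> 1" and s: "absv s \<le> 1"
  shows "measure \<rho> (cell B (ball (Suc j) (x + of_nat p ^ j * s))) = measure \<rho> (cell B (ball (Suc j) x))"
proof -
  have Bc: "B \<in> carrier_mat n n" using B by (rule general_linear_carrier)
  have Br: "B ^\<^sub>m r \<in> general_linear n"
  proof (induction r)
    case 0
    then show ?case using Bc one_in_general_linear by simp
  qed (simp add: B general_linear_mult)
  obtain C where C: "C \<in> general_linear n" "B ^\<^sub>m r * C = 1\<^sub>m n" "C * B ^\<^sub>m r = 1\<^sub>m n"
    using general_linear_inverse[OF Br] .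
  note Cc = general_linear_carrier[OF C(1)]
  \<comment> \<open>A matrix of trace 1; \<open>Zb\<close> divides it by \<open>r\<close> and by
    \<open>B ^\<^sub>m r\<close>. A multiple of the identity would not do when \<open>p\<close>
    divides \<open>n\<close>.\<close>
  define E where "E = mat n n (\<lambda>(i, k). if i = 0 \<and> k = 0 then 1 else 0 :: 'a resfield)"
  have Ec: "E \<in> carrier_mat n n" by (simp add: E_def)
  have trE: "mat_trace E = 1"
  proof -
    have "mat_trace E = (\<Sum>i<n. if i = 0 then 1 else 0)" by (auto simp: mat_trace_def E_def intro!: sum.cong)
    then show ?thesis using n_pos by simp
  qed
  have r0: "of_nat r \<noteq> (0 :: 'a resfield)"
    using red_of_nat[of r] red_eq_0_iff[OF absv_of_nat_le_1, of r] absv_of_nat_coprime[OF r_pos r_coprime] by simp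
  define Zb where "Zb = inverse (of_nat r) \<cdot>\<^sub>m (E * C)"
  have Zbc: "Zb \<in> carrier_mat n n" using Ec Cc by (simp add: Zb_def)
  have trZ: "of_nat r * mat_trace (Zb * B ^\<^sub>m r) = 1"
  proof -
    have "Zb * B ^\<^sub>m r = inverse (of_nat r) \<cdot>\<^sub>m (E * (C * B ^\<^sub>m r))"
      unfolding Zb_def using Ec Cc general_linear_carrier[OF Br]
      by (simp add: mult_smult_assoc_mat[of _ n n _ n] assoc_mult_mat[of _ n n _ n _ n])
    also have "\<dots> = inverse (of_nat r) \<cdot>\<^sub>m E" using C(3) Ec by simp
    finally have "mat_trace (Zb * B ^\<^sub>m r) = inverse (of_nat r)"
      using mat_trace_smult[OF Ec] trE by simp
    then show ?thesis using r0 by simp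
  qed
  obtain Z where Z: "Z \<in> int_mats n" "rm Z = Zb" using rm_lift[OF Zbc] by blast
  define e where "e = of_nat p ^ j * s"
  define g where "g = 1\<^sub>m n + e \<cdot>\<^sub>m Z"
  have ej: "absv e \<le> \<nu> ^ j" unfolding e_def using s absv_le_power_iff by blast
  have "\<nu> ^ j \<le> \<nu> ^ 1" using \<nu> j by (intro power_decreasing) auto
  then have e\<nu>: "absv e \<le> \<nu>" using ej by simp
  then have e1: "absv e \<le> 1" using \<nu> by simp
  have gi: "g \<in> int_mats n" unfolding g_def by (intro int_mats_add int_mats_one int_mats_smult Z e1)
  have rmg: "rm g = 1\<^sub>m n"
  proof -
    have "rm g = rm (1\<^sub>m n)"
    proof (rule rm_close[OF gi int_mats_one])
      fix i k assume ik: "i < n" "k < n"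
      have "absv (e * Z $$ (i, k)) \<le> \<nu> * 1"
        unfolding absv_mult using e\<nu> int_matsD(2)[OF Z(1) ik] absv_nonneg \<nu> by (intro mult_mono) auto
      then show "absv (g $$ (i, k) - 1\<^sub>m n $$ (i, k)) \<le> \<nu>"
        using ik int_matsD(1)[OF Z(1)] by (simp add: g_def)
    qed
    then show ?thesis by (simp add: rm_one)
  qed
  then have gGL: "g \<in> GL_integers absv n" by (intro GL_of_rm[OF gi]) (simp add: one_in_general_linear)
  have shift: "absv (T (g * A) - (T A + e)) \<le> \<nu> ^ Suc j" "rm (g * A) = B" if A: "A \<in> GL_integers absv n" "rm A = B" for A
  proof -
    have Ai: "A \<in> int_mats n" using A by (simp add: GL_int_mats)
    have "red (of_nat r * mat_trace (Z * A ^\<^sub>m r)) = of_nat r * mat_trace (rm Z * rm A ^\<^sub>m r)"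
      using absv_mat_trace[OF int_mats_mult[OF Z(1) int_mats_pow[OF Ai]], of r]
      by (simp add: red_mult absv_of_nat_le_1 red_of_nat red_mat_trace[OF int_mats_mult[OF Z(1) int_mats_pow[OF Ai]]]
          rm_mult[OF Z(1) int_mats_pow[OF Ai]] rm_pow[OF Ai])
    then have "red (of_nat r * mat_trace (Z * A ^\<^sub>m r)) = 1" using trZ Z(2) A(2) by simp
    from trace_pow_left_mult[OF Ai Z(1) r_pos this s j]
    show "absv (T (g * A) - (T A + e)) \<le> \<nu> ^ Suc j" by (simp only: T_def g_def e_def)
    show "rm (g * A) = B" using rm_mult[OF gi Ai] rmg A(2) Bc by simp
  qed
  have iff: "T (g * A) \<in> ball (Suc j) (x + e) \<longleftrightarrow> T A \<in> ball (Suc j) x" if A: "A \<in> GL_integers absv n" "rm A = B" for A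
  proof
    assume "T (g * A) \<in> ball (Suc j) (x + e)"
    then have "absv ((T (g * A) - (x + e)) - (T (g * A) - (T A + e))) \<le> \<nu> ^ Suc j"
      by (intro absv_diff_le[OF _ shift(1)[OF A]]) (simp add: ball_def)
    then show "T A \<in> ball (Suc j) x" by (simp add: ball_def)
  next
    assume "T A \<in> ball (Suc j) x"
    then have "absv ((T (g * A) - (T A + e)) + (T A - x)) \<le> \<nu> ^ Suc j"
      by (intro absv_add_le[OF shift(1)[OF A]]) (simp add: ball_def)
    then show "T (g * A) \<in> ball (Suc j) (x + e)" by (simp add: ball_def algebra_simps)
  qed
  have "(*) g ` cell B (ball (Suc j) x) = cell B (ball (Suc j) (x + e))"
  proof (intro equalityI subsetI)
    fix A assume "A \<in> (*) g ` cell B (ball (Suc j) x)"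
    then show "A \<in> cell B (ball (Suc j) (x + e))" using iff shift(2) GL_mult[OF gGL] by (auto simp: cell_def)
  next
    fix A assume "A \<in> cell B (ball (Suc j) (x + e))"
    then have A: "A \<in> GL_integers absv n" "rm A = B" "T A \<in> ball (Suc j) (x + e)" by (auto simp: cell_def)
    obtain h where h: "h \<in> GL_integers absv n" "g * h = 1\<^sub>m n" "h * g = 1\<^sub>m n" by (rule GL_inverse[OF gGL])
    note c = int_matsD(1)[OF gi] int_matsD(1)[OF GL_int_mats[OF h(1)]] int_matsD(1)[OF GL_int_mats[OF A(1)]]
    have ghA: "g * (h * A) = A" using h c by (simp flip: assoc_mult_mat[of _ n n _ n _ n])
    have hA: "h * A \<in> GL_integers absv n" using h A GL_mult by blast
    have "rm (h * A) = B"
    proof -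
      have "rm g * rm h = 1\<^sub>m n" using rm_mult[OF gi GL_int_mats[OF h(1)]] h(2) rm_one by simp
      then have "rm h = 1\<^sub>m n" using rmg rm_carrier[OF c(2)] by simp
      then show ?thesis using rm_mult[OF GL_int_mats[OF h(1)] GL_int_mats[OF A(1)]] A(2) Bc by simp
    qed
    then have "h * A \<in> cell B (ball (Suc j) x)" using hA iff[OF hA] ghA A(3) by (simp add: cell_def)
    then show "A \<in> (*) g ` cell B (ball (Suc j) x)" using ghA by (metis imageI)
  qed
  then show ?thesis
    using measure_left_mult[OF gGL cell_in_sets[OF ball_in_sets[OF x], of B "Suc j"]] by (simp add: e_def)
qed

text \<open>Left translation by a lift of \<open>B\<close> carries the fibre over the identity onto
  the fibre over \<open>B\<close>, so all fibres have the same mass.\<close>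

lemma measure_reduction_fibre:
  assumes B: "B \<in> general_linear n"
  shows "measure \<rho> {A \<in> GL_integers absv n. rm A = B} = 1 / card (general_linear n :: 'a resfield mat set)"
proof -
  let ?F = "\<lambda>B. {A \<in> GL_integers absv n. rm A = B}"
  have eq: "measure \<rho> (?F B) = measure \<rho> (?F (1\<^sub>m n))" if B: "B \<in> general_linear n" for B
  proof -
    have Bc: "B \<in> carrier_mat n n" using B by (rule general_linear_carrier)
    obtain g where g: "g \<in> int_mats n" "rm g = B" using rm_lift[OF Bc] by blast
    then have gGL: "g \<in> GL_integers absv n" using GL_of_rm B by simp
    obtain h where h: "h \<in> GL_integers absv n" "g * h = 1\<^sub>m n" "h * g = 1\<^sub>m n" by (rule GL_inverse[OF gGL])
    note ci = GL_int_mats[OF h(1)]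
    have "(*) g ` ?F (1\<^sub>m n) = ?F B"
    proof (intro equalityI subsetI)
      fix A assume "A \<in> (*) g ` ?F (1\<^sub>m n)"
      then obtain A' where A': "A = g * A'" "A' \<in> GL_integers absv n" "rm A' = 1\<^sub>m n" by blast
      then have "rm A = B" using rm_mult[OF g(1) GL_int_mats[OF A'(2)]] g(2) Bc by simp
      then show "A \<in> ?F B" using A' GL_mult[OF gGL] by simp
    next
      fix A assume "A \<in> ?F B"
      then have A: "A \<in> GL_integers absv n" "rm A = B" by auto
      note c = int_matsD(1)[OF g(1)] int_matsD(1)[OF ci] int_matsD(1)[OF GL_int_mats[OF A(1)]]
      have ghA: "g * (h * A) = A" using h c by (simp flip: assoc_mult_mat[of _ n n _ n _ n])
      have "rm (h * A) = rm h * rm g" using rm_mult[OF ci GL_int_mats[OF A(1)]] A(2) g(2) by simp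
      also have "\<dots> = 1\<^sub>m n" using rm_mult[OF ci g(1)] h(3) rm_one by simp
      finally have "h * A \<in> ?F (1\<^sub>m n)" using GL_mult[OF h(1) A(1)] by simp
      then show "A \<in> (*) g ` ?F (1\<^sub>m n)" using ghA by (metis (no_types, lifting) imageI)
    qed
    then show ?thesis using measure_left_mult[OF gGL open_in_sets[OF openin_cell_UNIV, of "1\<^sub>m n"]] by simp
  qed
  have "1 = measure \<rho> (\<Union>B\<in>general_linear n. ?F B)"
  proof -
    have "(\<Union>B\<in>general_linear n. ?F B) = space \<rho>" using rm_GL by (auto simp: space_rho)
    then show ?thesis using prob_space by simp
  qed
  also have "\<dots> = (\<Sum>B\<in>general_linear n. measure \<rho> (?F B))"
    using open_in_sets[OF openin_cell_UNIV]
    by (intro finite_measure_finite_Union finite_general_linear finite_resfield) (auto simp: disjoint_family_on_def)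
  also have "\<dots> = (\<Sum>B\<in>(general_linear n :: 'a resfield mat set). measure \<rho> (?F (1\<^sub>m n)))"
    by (rule sum.cong[OF refl eq])
  also have "\<dots> = card (general_linear n :: 'a resfield mat set) * measure \<rho> (?F (1\<^sub>m n))" by simp
  finally show ?thesis
    using eq[OF B] card_general_linear_pos[OF finite_resfield, of n] by (simp add: field_simps)
qed

section \<open>The law of the trace\<close>

definition \<mu> :: "'a measure" where "\<mu> = distr \<rho> (borel_of (integers_topology absv)) T"

lemma prob_space_mu: "prob_space \<mu>"
  unfolding \<mu>_def by (rule prob_space_distr[OF measurable_T])

lemma sets_mu: "sets \<mu> = sets (borel_of (integers_topology absv))"
  by (simp add: \<mu>_def)

lemma measure_mu:
  "S \<in> sets (borel_of (integers_topology absv)) \<Longrightarrow> measure \<mu> S = measure \<rho> {A \<in> GL_integers absv n. T A \<in> S}"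
  unfolding \<mu>_def using measure_distr[OF measurable_T, of S] by (simp add: space_rho vimage_def Int_def conj_commute)

lemma measure_mu_ball_shift:
  assumes "j \<ge> 1" "absv x \<le> 1" "absv s \<le> 1"
  shows "measure \<mu> (ball (Suc j) (x + of_nat p ^ j * s)) = measure \<mu> (ball (Suc j) x)"
proof -
  have "absv (of_nat p ^ j * s) \<le> 1"
    using assms \<nu> by (intro absv_mult_le_1) (auto simp: absv_p_power power_le_one)
  then have "absv (x + of_nat p ^ j * s) \<le> 1" using assms by (intro absv_add_le)
  then show ?thesis
    using assms by (simp add: measure_mu ball_in_sets measure_T_preimage cell_shift)
qed

text \<open>The residue of the trace is a function of the reduced matrix, and that matrix is uniform
  in the finite group.\<close>

lemma measure_mu_fibre:
  "measure \<mu> (fibre k) = k.avg n (\<lambda>B. if mat_trace (B ^\<^sub>m r) = k then 1 else 0)"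
proof -
  have "measure \<mu> (fibre k) = (\<Sum>B\<in>general_linear n. measure \<rho> (cell B (fibre k)))"
    by (simp add: measure_mu measure_T_preimage fibre_in_sets)
  also have "\<dots> = (\<Sum>B\<in>general_linear n. (if mat_trace (B ^\<^sub>m r) = k then 1 else 0) / card (general_linear n :: 'a resfield mat set))"
  proof (rule sum.cong[OF refl])
    fix B :: "'a resfield mat" assume B: "B \<in> general_linear n"
    have "cell B (fibre k) = (if mat_trace (B ^\<^sub>m r) = k then {A \<in> GL_integers absv n. rm A = B} else {})"
      using T_integer red_T by (auto simp: cell_def fibre_def)
    then show "measure \<rho> (cell B (fibre k)) = (if mat_trace (B ^\<^sub>m r) = k then 1 else 0) / card (general_linear n :: 'a resfield mat set)"
      using measure_reduction_fibre[OF B] by simp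
  qed
  also have "\<dots> = k.avg n (\<lambda>B. if mat_trace (B ^\<^sub>m r) = k then 1 else 0)"
    by (simp add: k.avg_def sum_divide_distrib)
  finally show ?thesis .
qed

end

theorem theorem1p7:
  fixes absv :: "'a :: field_char_0 \<Rightarrow> real"
    and Qp :: "'a set" and \<pi> :: 'a
    and p q :: nat
    and \<Omega> :: "'u measure" and U :: "'u \<Rightarrow> 'a"
    and P :: "nat \<Rightarrow> 'w measure" and A :: "nat \<Rightarrow> 'w \<Rightarrow> 'a mat"
    and r :: "nat \<Rightarrow> nat"
  assumes p: "prime p" "odd p"
    and q: "\<exists>m>0. q = p ^ m"
    and F: "unramified_padic_extension absv p Qp"
    and pi: "uniformizer absv \<pi>"
    and residue: "card (residue_field absv) = q"
    and U_space: "prob_space \<Omega>"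
    and U_rv: "U \<in> \<Omega> \<rightarrow>\<^sub>M borel_of (integers_topology absv)"
    and U_haar: "haar_prob (integers_topology absv) (+) (distr \<Omega> (borel_of (integers_topology absv)) U)"
    and r_pos: "\<And>n. n \<ge> 1 \<Longrightarrow> r n > 0"
    and r_coprime: "\<And>n. n \<ge> 1 \<Longrightarrow> \<not> p dvd r n"
    and r_growth: "(\<lambda>n. ln (real (r n))) \<in> o(\<lambda>n. (real n)\<^sup>2)"
    and A_space: "\<And>n. n \<ge> 1 \<Longrightarrow> prob_space (P n)"
    and A_rv: "\<And>n. n \<ge> 1 \<Longrightarrow> A n \<in> P n \<rightarrow>\<^sub>M borel_of (GL_topology absv n)"
    and A_haar: "\<And>n. n \<ge> 1 \<Longrightarrow>
      haar_prob (GL_topology absv n) (*) (distr (P n) (borel_of (GL_topology absv n)) (A n))"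
  shows "(\<lambda>n. tv_dist (integers_topology absv)
            (distr (P n) (borel_of (integers_topology absv)) (\<lambda>\<omega>. mat_trace (A n \<omega> ^\<^sub>m r n)))
            (distr \<Omega> (borel_of (integers_topology absv)) U)) \<longlonglongrightarrow> 0"
proof -
  obtain m where m: "q = p ^ m" using q by blast
  interpret odd_unramified_extension absv p Qp m q
    using F p m residue by (intro odd_unramified_extension.intro odd_unramified_extension_axioms.intro)
  let ?B = "borel_of (integers_topology absv)"
  let ?N = "distr \<Omega> ?B U"
  let ?M = "\<lambda>n. distr (P n) ?B (\<lambda>\<omega>. mat_trace (A n \<omega> ^\<^sub>m r n))"
  let ?avg = "\<lambda>k n. k.avg n (\<lambda>B. if mat_trace (B ^\<^sub>m r n) = k then 1 else 0)"
  have bounds: "0 \<le> tv_dist (integers_topology absv) (?M n) ?N \<and>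
      tv_dist (integers_topology absv) (?M n) ?N \<le> (\<Sum>k\<in>UNIV. \<bar>q * ?avg k n - 1\<bar>)" if n: "n \<ge> 1" for n
  proof -
    interpret H: haar_GL absv p Qp m q n "r n" "distr (P n) (borel_of (GL_topology absv n)) (A n)"
      using n r_pos r_coprime A_haar by unfold_locales auto
    \<comment> \<open>\<open>H.\<mu>\<close> lives on the group with its Haar measure,
      \<open>?M n\<close> on the given probability space; composing push-forwards identifies
      them.\<close>
    have "H.\<mu> = ?M n"
    proof -
      have T: "H.T = (\<lambda>C. mat_trace (C ^\<^sub>m r n))" by (simp add: fun_eq_iff H.T_def)
      have "H.T \<in> borel_of (GL_topology absv n) \<rightarrow>\<^sub>M ?B"
        using H.measurable_T by (simp add: measurable_def)
      from distr_distr[OF this A_rv[OF n]] show ?thesis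
        unfolding H.\<mu>_def T by (simp add: comp_def)
    qed
    then show ?thesis
      using tv_dist_le[OF H.prob_space_mu H.sets_mu H.measure_mu_ball_shift U_haar] H.measure_mu_fibre by simp
  qed
  \<comment> \<open>A sum over the fixed finite residue field, so convergence for each residue class
    separately suffices.\<close>
  have "(\<lambda>n. \<Sum>k\<in>UNIV. \<bar>q * ?avg k n - 1\<bar>) \<longlonglongrightarrow> (\<Sum>k\<in>(UNIV :: 'a resfield set). \<bar>q * (1 / q) - 1\<bar>)"
    using k.trace_equidistribution[OF r_pos r_growth] by (intro tendsto_intros)
  then have lim: "(\<lambda>n. \<Sum>k\<in>UNIV. \<bar>q * ?avg k n - 1\<bar>) \<longlonglongrightarrow> 0" using q_pos by simp
  show ?thesis
  proof (rule tendsto_sandwich[OF _ _ tendsto_const lim])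
    show "eventually (\<lambda>n. 0 \<le> tv_dist (integers_topology absv) (?M n) ?N) sequentially"
      by (rule eventually_mono[OF eventually_ge_at_top[of 1]]) (use bounds in blast)
    show "eventually (\<lambda>n. tv_dist (integers_topology absv) (?M n) ?N \<le> (\<Sum>k\<in>UNIV. \<bar>q * ?avg k n - 1\<bar>)) sequentially"
      by (rule eventually_mono[OF eventually_ge_at_top[of 1]]) (use bounds in blast)
  qed
qed

end
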